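(* Let $H$ be a cocommutative Hopf algebra over a field $\mathbf{k}$, let $\mathcal{L}=\oplus_{n\in\mathbb{Z}}\mathcal{L}^n$ be a graded left $H$-module and put $\mathcal{W}=\mathcal{L}[-1]$. Then there is a one-to-one correspondence between $L_\infty$ $H$-pseudoalgebra structures on $\mathcal{L}$ and Maurer-Cartan elements in the graded Lie algebra $\big(\oplus_{p\in\mathbb{Z}}\mathrm{symHom}^p_{\mathrm{poly}}(\mathcal{W},\mathcal{W}),\llbracket\ ,\ \rrbracket\big)$.
   Context: Polylinear maps. $H^{\otimes n}$ is a right $H$-module via $(h_1\otimes\cdots\otimes h_n)h=h_1h_{(1)}\otimes\cdots\otimes h_nh_{(n)}$ (Sweedler notation for the iterated coproduct). For graded left $H$-modules, $\mathrm{Hom}^p_{H^{\otimes n}}(\mathcal{L}_1\boxtimes\cdots\boxtimes\mathcal{L}_n,H^{\otimes n}\otimes_H\mathcal{M})$ is the space of degree $p$ maps $\varphi:\mathcal{L}_1\otimes\cdots\otimes\mathcal{L}_n\to H^{\otimes n}\otimes_H\mathcal{M}$ that are $H^{\otimes n}$-linear, where $H^{\otimes n}$ acts factorwise on the source and by left multiplication on the target; $H$ sits in degree $0$. Composition. If $\psi(y_1,\dots,y_l)=\sum_i(h_i^1\otimes\cdots\otimes h_i^l)\otimes_H e_i$ and $\varphi(e_i,x_2,\dots,x_k)=\sum_j(f_{ij}^1\otimes\cdots\otimes f_{ij}^k)\otimes_H e_{ij}$, then $\varphi(\psi(y_1,\dots,y_l),x_2,\dots,x_k)=\sum_{i,j}(h_i^1f^1_{ij(1)}\otimes\cdots\otimes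 h_i^lf^1_{ij(l)}\otimes f_{ij}^2\otimes\cdots\otimes f_{ij}^k)\otimes_He_{ij}$. Slot convention. Each tensor factor of $H^{\otimes N}$ is attached to one argument. In any identity whose terms involve the same elements $x_1,\dots,x_N$ in different orders, the factors of $H^{\otimes N}$ in each term are permuted so that the $r$-th factor is the one attached to $x_r$ (well defined by cocommutativity). Signs. $\epsilon(\sigma)$ is the Koszul sign of the permutation $(x_1,\dots,x_N)\mapsto(x_{\sigma(1)},\dots,x_{\sigma(N)})$ of homogeneous elements, $(-1)^\sigma$ is the signature, and $\mathrm{Sh}(l,k-1)$ is the set of $\sigma\in S_{l+k-1}$ with $\sigma(1)<\cdots<\sigma(l)$ and $\sigma(l+1)<\cdots<\sigma(l+k-1)$. A polylinear map $\varphi$ in $k$ arguments is graded symmetric (resp. graded skew-symmetric) if, under the slot convention, $\varphi(x_1,\dots,x_k)=\epsilon(\sigma)\varphi(x_{\sigma(1)},\dots,x_{\sigma(k)})$ (resp. $=(-1)^\sigma\epsilon(\sigma)\varphi(x_{\sigma(1)},\dots,x_{\sigma(k)})$) for all $\sigma\in S_k$. $L_\infty$ $H$-pseudoalgebra structure on $\mathcal{L}$: graded skew-symmetric maps $\beta_k\in\mathrm{Hom}^{k-2}_{H^{\otimes k}}(\mathcal{L}^{\boxtimes k},H^{\otimes k}\otimes_H\mathcal{L})$, $k\ge1$, such that for all $N\ge1$ and homogeneous $x_1,\dots,x_N\in\mathcal{L}$, $$\sum_{k+l=N+1}\sum_{\sigma\in\mathrm{Sh}(l,k-1)}(-1)^\sigma\epsilon(\sigma)(-1)^{l(k-1)}\beta_k\big(\beta_l(x_{\sigma(1)},\dots,x_{\sigma(l)}),x_{\sigma(l+1)},\dots,x_{\sigma(N)}\big)=0.$$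 Shift. $(\mathcal{L}[-1])^n=\mathcal{L}^{n-1}$. The graded Lie algebra. $\mathrm{symHom}^p_{\mathrm{poly}}(\mathcal{W},\mathcal{W})$ consists of formal sums $\eta=\sum_{k\ge1}\eta_k$ with $\eta_k\in\mathrm{Hom}^p_{H^{\otimes k}}(\mathcal{W}^{\boxtimes k},H^{\otimes k}\otimes_H\mathcal{W})$ graded symmetric. For $\eta$ of degree $p$ and $\zeta=\sum_l\zeta_l$ of degree $q$, $$\llbracket\eta,\zeta\rrbracket=\sum_{N\ge1}\sum_{k+l=N+1}\big(\eta_k\diamond\zeta_l-(-1)^{pq}\zeta_l\diamond\eta_k\big),$$ $$(\eta_k\diamond\zeta_l)(w_1,\dots,w_N)=\sum_{\sigma\in\mathrm{Sh}(l,k-1)}\epsilon(\sigma)\,\eta_k\big(\zeta_l(w_{\sigma(1)},\dots,w_{\sigma(l)}),w_{\sigma(l+1)},\dots,w_{\sigma(N)}\big).$$ This is a graded Lie bracket (known). A Maurer-Cartan element is an element $\eta$ of degree $-1$ with $\llbracket\eta,\eta\rrbracket=0$.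
   Formalization: The field k is assumed to have characteristic different from 2; in characteristic 2 the claim fails (H = k = F_2, L = L^0 = k has one L-infinity structure but two Maurer-Cartan elements, since [[η,η]] = 2 η◇η vanishes identically). *)

theory Defs
  imports Complex_Main "HOL-Library.Poly_Mapping" "HOL-Library.FuncSet" "HOL-Combinatorics.Permutations"
begin

section \<open>Formal linear combinations and their quotients\<close>

text \<open>
  The free \<open>'k\<close>-vector space on a type \<open>'x\<close> is \<open>'x \<Rightarrow>\<^sub>0 'k\<close>.  Tensor products are
  quotients of such spaces by the span of the usual relations; an element of a quotient is
  a coset.
\<close>

definition fscale :: "'k::field \<Rightarrow> ('x \<Rightarrow>\<^sub>0 'k) \<Rightarrow> ('x \<Rightarrow>\<^sub>0 'k)" where
  "fscale c = Poly_Mapping.map ((*) c)"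

lemma lookup_fscale: "Poly_Mapping.lookup (fscale c f) x = c * Poly_Mapping.lookup f x"
  by (simp add: fscale_def Poly_Mapping.map.rep_eq when_def)

interpretation free: vector_space fscale
  by unfold_locales (auto intro!: poly_mapping_eqI simp: lookup_fscale lookup_add algebra_simps)

abbreviation gen :: "'x \<Rightarrow> ('x \<Rightarrow>\<^sub>0 'k::field)" where
  "gen x \<equiv> Poly_Mapping.single x 1"

text \<open>Linear extension of a map defined on generators, into a space with scaling \<open>s\<close>.\<close>

definition lin_ext :: "('k::field \<Rightarrow> 'v \<Rightarrow> 'v::comm_monoid_add) \<Rightarrow> ('x \<Rightarrow> 'v) \<Rightarrow> ('x \<Rightarrow>\<^sub>0 'k) \<Rightarrow> 'v" where
  "lin_ext s F f = (\<Sum>x\<in>Poly_Mapping.keys f. s (Poly_Mapping.lookup f x) (F x))"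

abbreviation lin :: "('x \<Rightarrow> ('y \<Rightarrow>\<^sub>0 'k::field)) \<Rightarrow> ('x \<Rightarrow>\<^sub>0 'k) \<Rightarrow> ('y \<Rightarrow>\<^sub>0 'k)" where
  "lin \<equiv> lin_ext fscale"

definition bilin :: "('x \<Rightarrow> 'y \<Rightarrow> ('z \<Rightarrow>\<^sub>0 'k::field)) \<Rightarrow> ('x \<Rightarrow>\<^sub>0 'k) \<Rightarrow> ('y \<Rightarrow>\<^sub>0 'k) \<Rightarrow> ('z \<Rightarrow>\<^sub>0 'k)" where
  "bilin F f g = lin (\<lambda>x. lin (F x) g) f"

definition cls :: "('x \<Rightarrow>\<^sub>0 'k::field) set \<Rightarrow> ('x \<Rightarrow>\<^sub>0 'k) \<Rightarrow> ('x \<Rightarrow>\<^sub>0 'k) set" where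
  "cls R f = {g. g - f \<in> free.span R}"

text \<open>
  Maps out of a quotient are defined below by evaluating on the representative \<open>rep T\<close>;
  the result, taken modulo the relations of the target, does not depend on its choice.
\<close>

definition rep :: "'x set \<Rightarrow> 'x" where
  "rep T = (SOME f. f \<in> T)"


section \<open>Tensor powers, Hopf algebras, graded modules\<close>

definition tensor_rel :: "('k::field \<Rightarrow> 'x \<Rightarrow> 'x) \<Rightarrow> nat \<Rightarrow> ('x::ab_group_add list \<Rightarrow>\<^sub>0 'k) set" where
  "tensor_rel s n =
     {gen (xs[i := x + y]) - gen (xs[i := x]) - gen (xs[i := y]) | xs i x y. length xs = n \<and> i < n} \<union>
     {gen (xs[i := s c x]) - fscale c (gen (xs[i := x])) | xs i c x. length xs = n \<and> i < n}"

definition tensor_power :: "('k::field \<Rightarrow> 'x \<Rightarrow> 'x) \<Rightarrow> nat \<Rightarrow> ('x::ab_group_add list \<Rightarrow>\<^sub>0 'k) set set" where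
  "tensor_power s n = {cls (tensor_rel s n) f | f. \<forall>xs\<in>Poly_Mapping.keys f. length xs = n}"

record (overloaded) ('k, 'h) hopf =
  hscale :: "'k::field \<Rightarrow> 'h::ring_1 \<Rightarrow> 'h"
  comult :: "'h \<Rightarrow> ('h list \<Rightarrow>\<^sub>0 'k) set"
  counit :: "'h \<Rightarrow> 'k"
  antipode :: "'h \<Rightarrow> 'h"

abbreviation Hrel :: "('k::field, 'h::ring_1) hopf \<Rightarrow> nat \<Rightarrow> ('h list \<Rightarrow>\<^sub>0 'k) set" where
  "Hrel H \<equiv> tensor_rel (hscale H)"

definition cop :: "('k::field, 'h::ring_1) hopf \<Rightarrow> 'h \<Rightarrow> ('h list \<Rightarrow>\<^sub>0 'k)" where
  "cop H h = rep (comult H h)"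

definition cop_first :: "('k::field, 'h::ring_1) hopf \<Rightarrow> ('h list \<Rightarrow>\<^sub>0 'k) \<Rightarrow> ('h list \<Rightarrow>\<^sub>0 'k)" where
  "cop_first H = lin (\<lambda>hs. lin (\<lambda>ds. gen (ds @ tl hs)) (cop H (hd hs)))"

definition cop_last :: "('k::field, 'h::ring_1) hopf \<Rightarrow> ('h list \<Rightarrow>\<^sub>0 'k) \<Rightarrow> ('h list \<Rightarrow>\<^sub>0 'k)" where
  "cop_last H = lin (\<lambda>hs. lin (\<lambda>ds. gen (butlast hs @ ds)) (cop H (last hs)))"

text \<open>
  \<open>coprod H n h\<close> represents the iterated coproduct of \<open>h\<close> in the \<open>(n + 1)\<close>-st tensor power;
  \<open>coprod H 0\<close> is the identity of \<open>H\<close>.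
\<close>

primrec coprod :: "('k::field, 'h::ring_1) hopf \<Rightarrow> nat \<Rightarrow> 'h \<Rightarrow> ('h list \<Rightarrow>\<^sub>0 'k)" where
  "coprod H 0 h = gen [h]"
| "coprod H (Suc n) h = cop_first H (coprod H n h)"

definition cocommutative_hopf_algebra :: "('k::field, 'h::ring_1) hopf \<Rightarrow> bool" where
  "cocommutative_hopf_algebra H \<longleftrightarrow>
     \<comment> \<open>associative unital algebra\<close>
     vector_space (hscale H) \<and>
     (\<forall>c x y. hscale H c x * y = hscale H c (x * y) \<and> x * hscale H c y = hscale H c (x * y)) \<and>
     \<comment> \<open>the coproduct is a linear map to the tensor square, coassociative and cocommutative\<close>
     (\<forall>x. comult H x \<in> tensor_power (hscale H) 2) \<and>
     (\<forall>x y. comult H (x + y) = cls (Hrel H 2) (cop H x + cop H y)) \<and>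
     (\<forall>c x. comult H (hscale H c x) = cls (Hrel H 2) (fscale c (cop H x))) \<and>
     (\<forall>x. cls (Hrel H 3) (cop_first H (cop H x)) = cls (Hrel H 3) (cop_last H (cop H x))) \<and>
     (\<forall>x. cls (Hrel H 2) (lin (\<lambda>hs. gen (rev hs)) (cop H x)) = comult H x) \<and>
     \<comment> \<open>counit\<close>
     (\<forall>x y. counit H (x + y) = counit H x + counit H y) \<and>
     (\<forall>c x. counit H (hscale H c x) = c * counit H x) \<and>
     (\<forall>x. lin_ext (hscale H) (\<lambda>hs. hscale H (counit H (hs ! 0)) (hs ! 1)) (cop H x) = x) \<and>
     (\<forall>x. lin_ext (hscale H) (\<lambda>hs. hscale H (counit H (hs ! 1)) (hs ! 0)) (cop H x) = x) \<and>
     \<comment> \<open>coproduct and counit are algebra homomorphisms\<close>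
     comult H 1 = cls (Hrel H 2) (gen [1, 1]) \<and>
     (\<forall>x y. comult H (x * y) =
        cls (Hrel H 2) (bilin (\<lambda>as bs. gen (map2 (*) as bs)) (cop H x) (cop H y))) \<and>
     counit H 1 = 1 \<and>
     (\<forall>x y. counit H (x * y) = counit H x * counit H y) \<and>
     \<comment> \<open>antipode\<close>
     (\<forall>x y. antipode H (x + y) = antipode H x + antipode H y) \<and>
     (\<forall>c x. antipode H (hscale H c x) = hscale H c (antipode H x)) \<and>
     (\<forall>x. lin_ext (hscale H) (\<lambda>hs. antipode H (hs ! 0) * hs ! 1) (cop H x) = hscale H (counit H x) 1) \<and>
     (\<forall>x. lin_ext (hscale H) (\<lambda>hs. hs ! 0 * antipode H (hs ! 1)) (cop H x) = hscale H (counit H x) 1)"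

text \<open>
  A graded module lives on a whole type; \<open>grade M n\<close> is its homogeneous component of degree \<open>n\<close>.
\<close>

record ('h, 'm) gmod =
  act :: "'h::ring_1 \<Rightarrow> 'm::ab_group_add \<Rightarrow> 'm"
  grade :: "int \<Rightarrow> 'm set"

definition is_decomp :: "('h::ring_1, 'm::ab_group_add) gmod \<Rightarrow> 'm \<Rightarrow> (int \<Rightarrow>\<^sub>0 'm) \<Rightarrow> bool" where
  "is_decomp M x c \<longleftrightarrow> (\<forall>n. Poly_Mapping.lookup c n \<in> grade M n) \<and>
     x = (\<Sum>n\<in>Poly_Mapping.keys c. Poly_Mapping.lookup c n)"

definition graded_left_module :: "('h::ring_1, 'm::ab_group_add) gmod \<Rightarrow> bool" where
  "graded_left_module M \<longleftrightarrow>
     (\<forall>h x y. act M h (x + y) = act M h x + act M h y) \<and>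
     (\<forall>g h x. act M (g + h) x = act M g x + act M h x) \<and>
     (\<forall>g h x. act M (g * h) x = act M g (act M h x)) \<and>
     (\<forall>x. act M 1 x = x) \<and>
     (\<forall>n. 0 \<in> grade M n) \<and>
     (\<forall>n. \<forall>x\<in>grade M n. \<forall>y\<in>grade M n. x + y \<in> grade M n) \<and>
     (\<forall>n h. \<forall>x\<in>grade M n. act M h x \<in> grade M n) \<and>
     (\<forall>x. \<exists>!c. is_decomp M x c)"

definition components :: "('h::ring_1, 'm::ab_group_add) gmod \<Rightarrow> 'm \<Rightarrow> (int \<Rightarrow>\<^sub>0 'm)" where
  "components M x = (THE c. is_decomp M x c)"

text \<open>\<open>shift j M\<close> is \<open>M[j]\<close>, with the same underlying module; the shift isomorphism is the identity.\<close>

definition shift :: "int \<Rightarrow> ('h::ring_1, 'm::ab_group_add) gmod \<Rightarrow> ('h, 'm) gmod" where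
  "shift j M = M\<lparr>grade := \<lambda>n. grade M (n + j)\<rparr>"

definition homogeneous :: "('h::ring_1, 'm::ab_group_add) gmod \<Rightarrow> 'm list \<Rightarrow> int list \<Rightarrow> bool" where
  "homogeneous M xs ds \<longleftrightarrow> list_all2 (\<lambda>x d. x \<in> grade M d) xs ds"


section \<open>Polylinear maps\<close>

definition mscale :: "('k::field, 'h::ring_1) hopf \<Rightarrow> ('h, 'm::ab_group_add) gmod \<Rightarrow> 'k \<Rightarrow> 'm \<Rightarrow> 'm" where
  "mscale H M c x = act M (hscale H c 1) x"

abbreviation Mrel :: "('k::field, 'h::ring_1) hopf \<Rightarrow> ('h, 'm::ab_group_add) gmod \<Rightarrow> nat \<Rightarrow> ('m list \<Rightarrow>\<^sub>0 'k) set" where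
  "Mrel H M \<equiv> tensor_rel (mscale H M)"

abbreviation Mpow :: "('k::field, 'h::ring_1) hopf \<Rightarrow> ('h, 'm::ab_group_add) gmod \<Rightarrow> nat \<Rightarrow> ('m list \<Rightarrow>\<^sub>0 'k) set set" where
  "Mpow H M \<equiv> tensor_power (mscale H M)"

definition pure :: "('k::field, 'h::ring_1) hopf \<Rightarrow> ('h, 'm::ab_group_add) gmod \<Rightarrow> 'm list \<Rightarrow> ('m list \<Rightarrow>\<^sub>0 'k) set" where
  "pure H M xs = cls (Mrel H M (length xs)) (gen xs)"

definition Mpow_grade :: "('k::field, 'h::ring_1) hopf \<Rightarrow> ('h, 'm::ab_group_add) gmod \<Rightarrow> nat \<Rightarrow> int \<Rightarrow> ('m list \<Rightarrow>\<^sub>0 'k) set set" where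
  "Mpow_grade H M n d = {cls (Mrel H M n) f | f.
     \<forall>xs\<in>Poly_Mapping.keys f. length xs = n \<and> (\<exists>ds. homogeneous M xs ds \<and> sum_list ds = d)}"

text \<open>
  The tensor product over \<open>H\<close> of the \<open>n\<close>-th tensor power of \<open>H\<close> (\<open>n \<ge> 1\<close>) with \<open>M\<close>: the
  generator \<open>(hs, m)\<close> stands for the tensor of \<open>hs ! 0, \<dots>, hs ! (n - 1)\<close> and \<open>m\<close>.  The last
  family of relations moves an element of \<open>H\<close> across the tensor sign over \<open>H\<close>.
\<close>

definition Prel :: "('k::field, 'h::ring_1) hopf \<Rightarrow> ('h, 'm::ab_group_add) gmod \<Rightarrow> nat \<Rightarrow> ('h list \<times> 'm \<Rightarrow>\<^sub>0 'k) set" where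
  "Prel H M n =
     {gen (hs[i := g + h], m) - gen (hs[i := g], m) - gen (hs[i := h], m) | hs i g h m.
        length hs = n \<and> i < n} \<union>
     {gen (hs[i := hscale H c h], m) - fscale c (gen (hs[i := h], m)) | hs i c h m.
        length hs = n \<and> i < n} \<union>
     {gen (hs, x + y) - gen (hs, x) - gen (hs, y) | hs x y. length hs = n} \<union>
     {gen (hs, mscale H M c x) - fscale c (gen (hs, x)) | hs c x. length hs = n} \<union>
     {lin (\<lambda>ds. gen (map2 (*) hs ds, m)) (coprod H (n - 1) h) - gen (hs, act M h m) | hs h m.
        length hs = n}"

definition Ptens :: "('k::field, 'h::ring_1) hopf \<Rightarrow> ('h, 'm::ab_group_add) gmod \<Rightarrow> nat \<Rightarrow> ('h list \<times> 'm \<Rightarrow>\<^sub>0 'k) set set" where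
  "Ptens H M n = {cls (Prel H M n) f | f. \<forall>(hs, m)\<in>Poly_Mapping.keys f. length hs = n}"

definition Ptens_grade :: "('k::field, 'h::ring_1) hopf \<Rightarrow> ('h, 'm::ab_group_add) gmod \<Rightarrow> nat \<Rightarrow> int \<Rightarrow> ('h list \<times> 'm \<Rightarrow>\<^sub>0 'k) set set" where
  "Ptens_grade H M n d = {cls (Prel H M n) f | f.
     \<forall>(hs, m)\<in>Poly_Mapping.keys f. length hs = n \<and> m \<in> grade M d}"

type_synonym ('k, 'h, 'm) pmap = "('m list \<Rightarrow>\<^sub>0 'k) set \<Rightarrow> ('h list \<times> 'm \<Rightarrow>\<^sub>0 'k) set"

text \<open>
  Degree \<open>p\<close> maps, linear over the \<open>n\<close>-th tensor power of \<open>H\<close>, from the \<open>n\<close>-th tensor power of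
  \<open>M\<close> to \<open>Ptens H M n\<close>.
\<close>

definition polyHom :: "('k::field, 'h::ring_1) hopf \<Rightarrow> ('h, 'm::ab_group_add) gmod \<Rightarrow> int \<Rightarrow> nat \<Rightarrow> ('k, 'h, 'm) pmap set" where
  "polyHom H M p n = {\<phi> \<in> Mpow H M n \<rightarrow>\<^sub>E Ptens H M n.
     (\<forall>s\<in>Mpow H M n. \<forall>t\<in>Mpow H M n.
        \<phi> (cls (Mrel H M n) (rep s + rep t)) = cls (Prel H M n) (rep (\<phi> s) + rep (\<phi> t))) \<and>
     (\<forall>a\<in>tensor_power (hscale H) n. \<forall>t\<in>Mpow H M n.
        \<phi> (cls (Mrel H M n) (bilin (\<lambda>hs xs. gen (map2 (act M) hs xs)) (rep a) (rep t))) =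
        cls (Prel H M n) (bilin (\<lambda>hs (gs, m). gen (map2 (*) hs gs, m)) (rep a) (rep (\<phi> t)))) \<and>
     (\<forall>d. \<forall>t\<in>Mpow_grade H M n d. \<phi> t \<in> Ptens_grade H M n (d + p))}"

text \<open>
  \<open>pcompose H M \<phi> \<psi> ys xs\<close> is \<open>\<phi>(\<psi>(ys), xs)\<close>.
\<close>

definition pcompose :: "('k::field, 'h::ring_1) hopf \<Rightarrow> ('h, 'm::ab_group_add) gmod \<Rightarrow>
    ('k, 'h, 'm) pmap \<Rightarrow> ('k, 'h, 'm) pmap \<Rightarrow> 'm list \<Rightarrow> 'm list \<Rightarrow> ('h list \<times> 'm \<Rightarrow>\<^sub>0 'k) set" where
  "pcompose H M \<phi> \<psi> ys xs = cls (Prel H M (length ys + length xs))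
     (lin (\<lambda>(hs, e).
        lin (\<lambda>(fs, e').
          lin (\<lambda>ds. gen (map2 (*) hs ds @ tl fs, e')) (coprod H (length ys - 1) (hd fs)))
        (rep (\<phi> (pure H M (e # xs)))))
      (rep (\<psi> (pure H M ys))))"

text \<open>
  In a term with arguments \<open>x\<^bsub>\<sigma> 0\<^esub>, \<dots>, x\<^bsub>\<sigma> (N - 1)\<^esub>\<close> the factor in position \<open>i\<close> is attached to
  \<open>x\<^bsub>\<sigma> i\<^esub>\<close>; \<open>reslot\<close> moves it to position \<open>\<sigma> i\<close>.  Recall \<open>permute_list \<tau> xs ! i = xs ! \<tau> i\<close>.
\<close>

definition reslot :: "('k::field, 'h::ring_1) hopf \<Rightarrow> ('h, 'm::ab_group_add) gmod \<Rightarrow> nat \<Rightarrow> (nat \<Rightarrow> nat) \<Rightarrow>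
    ('h list \<times> 'm \<Rightarrow>\<^sub>0 'k) set \<Rightarrow> ('h list \<times> 'm \<Rightarrow>\<^sub>0 'k) set" where
  "reslot H M N \<sigma> T = cls (Prel H M N) (lin (\<lambda>(hs, m). gen (permute_list (inv \<sigma>) hs, m)) (rep T))"

definition koszul :: "int list \<Rightarrow> (nat \<Rightarrow> nat) \<Rightarrow> 'k::field" where
  "koszul ds \<sigma> = (\<Prod>(i, j)\<in>{(i, j). i < j \<and> j < length ds \<and> \<sigma> j < \<sigma> i}.
     (-1) powi (ds ! \<sigma> i * ds ! \<sigma> j))"

definition shuffles :: "nat \<Rightarrow> nat \<Rightarrow> (nat \<Rightarrow> nat) set" where
  "shuffles l m = {\<sigma>. \<sigma> permutes {..<l + m} \<and> strict_mono_on {..<l} \<sigma> \<and> strict_mono_on {l..<l + m} \<sigma>}"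

definition graded_symmetric :: "('k::field, 'h::ring_1) hopf \<Rightarrow> ('h, 'm::ab_group_add) gmod \<Rightarrow> nat \<Rightarrow> ('k, 'h, 'm) pmap \<Rightarrow> bool" where
  "graded_symmetric H M k \<phi> \<longleftrightarrow>
     (\<forall>\<sigma> xs ds. \<sigma> permutes {..<k} \<and> length xs = k \<and> homogeneous M xs ds \<longrightarrow>
        \<phi> (pure H M xs) = cls (Prel H M k)
          (fscale (koszul ds \<sigma>) (rep (reslot H M k \<sigma> (\<phi> (pure H M (permute_list \<sigma> xs)))))))"

definition graded_skew_symmetric :: "('k::field, 'h::ring_1) hopf \<Rightarrow> ('h, 'm::ab_group_add) gmod \<Rightarrow> nat \<Rightarrow> ('k, 'h, 'm) pmap \<Rightarrow> bool" where
  "graded_skew_symmetric H M k \<phi> \<longleftrightarrow>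
     (\<forall>\<sigma> xs ds. \<sigma> permutes {..<k} \<and> length xs = k \<and> homogeneous M xs ds \<longrightarrow>
        \<phi> (pure H M xs) = cls (Prel H M k)
          (fscale (of_int (sign \<sigma>) * koszul ds \<sigma>)
            (rep (reslot H M k \<sigma> (\<phi> (pure H M (permute_list \<sigma> xs)))))))"


section \<open>L-infinity pseudoalgebras and Maurer-Cartan elements\<close>

text \<open>
  Families of maps indexed by \<open>k \<ge> 1\<close> are extensional functions on \<open>{1..}\<close>.
\<close>

definition Linf_structures :: "('k::field, 'h::ring_1) hopf \<Rightarrow> ('h, 'm::ab_group_add) gmod \<Rightarrow> (nat \<Rightarrow> ('k, 'h, 'm) pmap) set" where
  "Linf_structures H M =
     {\<beta> \<in> (\<Pi>\<^sub>E k\<in>{1..}. {\<phi> \<in> polyHom H M (int k - 2) k. graded_skew_symmetric H M k \<phi>}).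
       \<forall>N\<ge>1. \<forall>xs ds. length xs = N \<and> homogeneous M xs ds \<longrightarrow>
         cls (Prel H M N)
           (\<Sum>(k, l)\<in>{(k, l). 1 \<le> k \<and> 1 \<le> l \<and> k + l = N + 1}. \<Sum>\<sigma>\<in>shuffles l (k - 1).
              fscale (of_int (sign \<sigma>) * koszul ds \<sigma> * (-1) ^ (l * (k - 1)))
                (rep (reslot H M N \<sigma>
                  (pcompose H M (\<beta> k) (\<beta> l)
                     (take l (permute_list \<sigma> xs)) (drop l (permute_list \<sigma> xs))))))
         = cls (Prel H M N) 0}"

definition symHom :: "('k::field, 'h::ring_1) hopf \<Rightarrow> ('h, 'm::ab_group_add) gmod \<Rightarrow> int \<Rightarrow> (nat \<Rightarrow> ('k, 'h, 'm) pmap) set" where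
  "symHom H M p = (\<Pi>\<^sub>E k\<in>{1..}. {\<phi> \<in> polyHom H M p k. graded_symmetric H M k \<phi>})"

text \<open>
  The defining formula of the diamond product involves Koszul signs and so makes sense for
  homogeneous arguments; in general each argument \<open>w\<close> is split into its components and the
  formula is extended additively.
\<close>

definition diamond :: "('k::field, 'h::ring_1) hopf \<Rightarrow> ('h, 'm::ab_group_add) gmod \<Rightarrow> nat \<Rightarrow> nat \<Rightarrow>
    ('k, 'h, 'm) pmap \<Rightarrow> ('k, 'h, 'm) pmap \<Rightarrow> ('k, 'h, 'm) pmap" where
  "diamond H M k l \<phi> \<psi> = (\<lambda>t\<in>Mpow H M (k + l - 1). cls (Prel H M (k + l - 1))
     (lin (\<lambda>ws. \<Sum>ds\<in>{ds. list_all2 (\<lambda>w d. d \<in> Poly_Mapping.keys (components M w)) ws ds}.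
        let us = map2 (\<lambda>w d. Poly_Mapping.lookup (components M w) d) ws ds in
        \<Sum>\<sigma>\<in>shuffles l (k - 1).
          fscale (koszul ds \<sigma>)
            (rep (reslot H M (k + l - 1) \<sigma>
              (pcompose H M \<phi> \<psi> (take l (permute_list \<sigma> us)) (drop l (permute_list \<sigma> us))))))
      (rep t)))"

definition bracket :: "('k::field, 'h::ring_1) hopf \<Rightarrow> ('h, 'm::ab_group_add) gmod \<Rightarrow> int \<Rightarrow> int \<Rightarrow>
    (nat \<Rightarrow> ('k, 'h, 'm) pmap) \<Rightarrow> (nat \<Rightarrow> ('k, 'h, 'm) pmap) \<Rightarrow> (nat \<Rightarrow> ('k, 'h, 'm) pmap)" where
  "bracket H M p q \<eta> \<zeta> = (\<lambda>N\<in>{1..}. \<lambda>t\<in>Mpow H M N. cls (Prel H M N)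
     (\<Sum>(k, l)\<in>{(k, l). 1 \<le> k \<and> 1 \<le> l \<and> k + l = N + 1}.
        rep (diamond H M k l (\<eta> k) (\<zeta> l) t)
        - fscale ((-1) powi (p * q)) (rep (diamond H M l k (\<zeta> l) (\<eta> k) t))))"

definition symHom_zero :: "('k::field, 'h::ring_1) hopf \<Rightarrow> ('h, 'm::ab_group_add) gmod \<Rightarrow> (nat \<Rightarrow> ('k, 'h, 'm) pmap)" where
  "symHom_zero H M = (\<lambda>N\<in>{1..}. \<lambda>t\<in>Mpow H M N. cls (Prel H M N) 0)"

definition maurer_cartan :: "('k::field, 'h::ring_1) hopf \<Rightarrow> ('h, 'm::ab_group_add) gmod \<Rightarrow> (nat \<Rightarrow> ('k, 'h, 'm) pmap) set" where
  "maurer_cartan H M = {\<eta> \<in> symHom H M (-1). bracket H M (-1) (-1) \<eta> \<eta> = symHom_zero H M}"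

end

theory Submission
  imports Defs
begin

text \<open>
  Let \<open>\<theta>\<close> be the parity involution, \<open>\<theta>(x) = (-1)\<^sup>n x\<close> on the degree \<open>n\<close> component; it is \<open>H\<close>-linear.
  Precomposing a polylinear map in \<open>k\<close> arguments with \<open>\<theta>\<close> to the power \<open>k - 1 - i\<close> in slot \<open>i\<close>
  is an involution on polylinear maps, and on homogeneous arguments it multiplies by
  the sign in the theorem.  The degree conditions on the two sides agree because the shift changes
  source and target degrees by \<open>k\<close> and \<open>1\<close>.  Comparing Koszul signs for degrees \<open>d\<close> and \<open>d + 1\<close>, one
  adjacent transposition at a time, exchanges skew-symmetry with symmetry and turns the L-infinity
  relations into the vanishing of the sum of all \<open>\<eta>\<^sub>k \<diamond> \<eta>\<^sub>l\<close>, which is half of the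
  bracket of \<open>\<eta>\<close> with itself.

  The formulas choose representatives of cosets, so everything rests on compatibility with
  the defining relations: composition needs the iterated coproduct to be
  multiplicative, moving slots needs it to be invariant under permutations.
\<close>

section \<open>Linear extensions and congruence modulo relations\<close>

text \<open>The exponent \<open>k - 1 - i\<close> is that of the decalage isomorphism: when
  \<open>k\<close> suspensions of odd degree are moved past \<open>k\<close> arguments, the argument
  in position \<open>i\<close> is passed by the \<open>k - 1 - i\<close> suspensions of later
  positions. Such a sign makes sense only on homogeneous tensors, whereas a polylinear map is a
  function on all cosets of the tensor power; hence it is realised by an operator defined on every
  vector.

  L[-1] has the same carrier, tensor powers and relations as L. Transport along the twist is
  therefore an involution of one and the same set of families, and a single equivalence, stated
  before any symmetry is imposed, gives both directions of the bijection.

  The assumption that 2 is nonzero excludes characteristic 2, where every degree -1 element brackets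
  to zero with itself and the Maurer-Cartan equation would lose its content.

  Multilinearity of the diamond product is not immediate: its sum runs over the degrees that occur
  in the arguments, and these vary with the arguments. It has to be compared with a sum over a fixed
  finite set of degrees.\<close>

lemma lin_superset:
  assumes "finite A" "Poly_Mapping.keys f \<subseteq> A"
  shows "lin F f = (\<Sum>x\<in>A. fscale (Poly_Mapping.lookup f x) (F x))"
  unfolding lin_ext_def using assms
  by (intro sum.mono_neutral_left) (auto simp: in_keys_iff)

lemma lin_zero [simp]: "lin F 0 = 0"
  by (simp add: lin_ext_def)

lemma lin_gen [simp]: "lin F (gen x) = F x"
  by (simp add: lin_ext_def)

lemma lin_add: "lin F (f + g) = lin F f + lin F g"
proof -
  let ?A = "Poly_Mapping.keys f \<union> Poly_Mapping.keys g"
  have "lin F h = (\<Sum>x\<in>?A. fscale (Poly_Mapping.lookup h x) (F x))"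
    if "Poly_Mapping.keys h \<subseteq> ?A" for h
    using that by (intro lin_superset) auto
  then show ?thesis
    using Poly_Mapping.keys_add[of f g]
    by (simp add: lookup_add free.scale_left_distrib sum.distrib)
qed

lemma keys_fscale: "Poly_Mapping.keys (fscale c f) \<subseteq> Poly_Mapping.keys f"
  by (auto simp: in_keys_iff lookup_fscale)

lemma lin_fscale: "lin F (fscale c f) = fscale c (lin F f)"
proof -
  have "lin F (fscale c f)
      = (\<Sum>x\<in>Poly_Mapping.keys f. fscale (Poly_Mapping.lookup (fscale c f) x) (F x))"
    by (intro lin_superset) (auto dest: keys_fscale[THEN subsetD])
  then show ?thesis
    by (simp add: lin_ext_def lookup_fscale free.scale_sum_right)
qed

lemma lin_uminus: "lin F (- f) = - lin F f"
  using lin_fscale[of F "-1" f] by simp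

lemma lin_diff: "lin F (f - g) = lin F f - lin F g"
  using lin_add[of F f "- g"] by (simp add: lin_uminus)

lemma lin_sum: "lin F (\<Sum>i\<in>I. f i) = (\<Sum>i\<in>I. lin F (f i))"
  by (induction I rule: infinite_finite_induct) (simp_all add: lin_add)

lemma lin_cong: "(\<And>x. x \<in> Poly_Mapping.keys f \<Longrightarrow> F x = G x) \<Longrightarrow> lin F f = lin G f"
  unfolding lin_ext_def by (intro sum.cong) auto

lemma lin_lin: "lin F (lin G f) = lin (\<lambda>x. lin F (G x)) f"
  by (simp add: lin_ext_def[of _ G f] lin_ext_def[of _ "\<lambda>x. lin F (G x)" f] lin_sum lin_fscale)

lemma lin_fun_add: "lin (\<lambda>x. F x + G x) f = lin F f + lin G f"
  by (simp add: lin_ext_def free.scale_right_distrib sum.distrib)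

lemma lin_fun_fscale: "lin (\<lambda>x. fscale c (F x)) f = fscale c (lin F f)"
  by (simp add: lin_ext_def free.scale_sum_right mult.commute)

lemma lin_fun_sum: "lin (\<lambda>x. \<Sum>i\<in>I. F i x) f = (\<Sum>i\<in>I. lin (F i) f)"
  by (simp add: lin_ext_def free.scale_sum_right) (rule sum.swap)

lemma lin_gen_ident: "lin gen f = f"
proof (rule poly_mapping_eqI)
  fix k
  have "Poly_Mapping.lookup (lin gen f) k
      = (\<Sum>x\<in>Poly_Mapping.keys f. Poly_Mapping.lookup f x * (if x = k then 1 else 0))"
    by (simp add: lin_ext_def lookup_sum lookup_fscale lookup_single when_def)
  also have "\<dots> = Poly_Mapping.lookup f k"
    by (simp add: if_distrib in_keys_iff cong: if_cong)
  finally show "Poly_Mapping.lookup (lin gen f) k = Poly_Mapping.lookup f k" .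
qed

lemma lin_id: "(\<And>x. x \<in> Poly_Mapping.keys f \<Longrightarrow> F x = gen x) \<Longrightarrow> lin F f = f"
  using lin_cong[of f F gen] lin_gen_ident[of f] by simp

lemma lin_swap: "lin (\<lambda>x. lin (\<lambda>y. F x y) g) f = lin (\<lambda>y. lin (\<lambda>x. F x y) f) g"
  by (simp add: lin_ext_def free.scale_sum_right mult.commute) (rule sum.swap)

lemma keys_sum_subset: "Poly_Mapping.keys (\<Sum>i\<in>I. f i) \<subseteq> (\<Union>i\<in>I. Poly_Mapping.keys (f i))"
proof (induction I rule: infinite_finite_induct)
  case (insert i I)
  then show ?case using Poly_Mapping.keys_add[of "f i" "sum f I"] by auto
qed auto

lemma keys_lin:
  "Poly_Mapping.keys (lin F f) \<subseteq> (\<Union>x\<in>Poly_Mapping.keys f. Poly_Mapping.keys (F x))"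
  unfolding lin_ext_def by (rule order_trans[OF keys_sum_subset]) (intro UN_mono order_refl keys_fscale)

lemma keys_linE:
  assumes "y \<in> Poly_Mapping.keys (lin F f)"
  obtains x where "x \<in> Poly_Mapping.keys f" "y \<in> Poly_Mapping.keys (F x)"
  using assms keys_lin[of F f] by auto

text \<open>Equality of the cosets \<open>cls R f\<close> and \<open>cls R g\<close>, in a form
  suited to sums, scalings and chains of transitivity. What \<open>rep\<close> returns on a coset is
  known only up to this relation.\<close>

definition eqv :: "('x \<Rightarrow>\<^sub>0 'k::field) set \<Rightarrow> ('x \<Rightarrow>\<^sub>0 'k) \<Rightarrow> ('x \<Rightarrow>\<^sub>0 'k) \<Rightarrow> bool" where
  "eqv R f g \<longleftrightarrow> f - g \<in> free.span R"

lemma eqv_refl [simp, intro]: "eqv R f f"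
  by (simp add: eqv_def free.span_zero)

lemma eqv_sym: "eqv R f g \<Longrightarrow> eqv R g f"
  using free.span_neg[of "f - g" R] by (simp add: eqv_def)

lemma eqv_trans [trans]: "eqv R f g \<Longrightarrow> eqv R g h \<Longrightarrow> eqv R f h"
  using free.span_add[of "f - g" R "g - h"] by (simp add: eqv_def)

lemma eqv_add: "eqv R f g \<Longrightarrow> eqv R f' g' \<Longrightarrow> eqv R (f + f') (g + g')"
  using free.span_add[of "f - g" R "f' - g'"] by (simp add: eqv_def algebra_simps)

lemma eqv_fscale: "eqv R f g \<Longrightarrow> eqv R (fscale c f) (fscale c g)"
  using free.span_scale[of "f - g" R c] by (simp add: eqv_def free.scale_right_diff_distrib)

lemma eqv_diff: "eqv R f g \<Longrightarrow> eqv R f' g' \<Longrightarrow> eqv R (f - f') (g - g')"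
  using free.span_diff[of "f - g" R "f' - g'"] by (simp add: eqv_def algebra_simps)

lemma eqv_sum: "(\<And>i. i \<in> I \<Longrightarrow> eqv R (f i) (g i)) \<Longrightarrow> eqv R (\<Sum>i\<in>I. f i) (\<Sum>i\<in>I. g i)"
  by (induction I rule: infinite_finite_induct) (auto intro: eqv_add)

lemma eqv_lin: "(\<And>x. x \<in> Poly_Mapping.keys f \<Longrightarrow> eqv R (F x) (G x)) \<Longrightarrow> eqv R (lin F f) (lin G f)"
  unfolding lin_ext_def by (intro eqv_sum eqv_fscale)

text \<open>Universal property of the quotient by the span of \<open>R\<close>. Its instances
  \<open>multilin_eqv\<close> and \<open>balanced_eqv\<close> treat tensor powers and tensor
  products over \<open>H\<close>.\<close>

lemma eqv_lin_map:
  assumes "\<And>r. r \<in> R \<Longrightarrow> lin F r \<in> free.span R'" and "eqv R f g"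
  shows "eqv R' (lin F f) (lin F g)"
proof -
  have "lin F u \<in> free.span R'" if "u \<in> free.span R" for u
    using that
  proof (induction rule: free.span_induct_alt)
    case base
    then show ?case by (simp add: free.span_zero)
  next
    case (step c x y)
    then show ?case
      by (simp add: lin_add lin_fscale free.span_add free.span_scale assms(1))
  qed
  with assms(2) show ?thesis
    by (simp add: eqv_def flip: lin_diff)
qed

lemma cls_eq_iff: "cls R f = cls R g \<longleftrightarrow> eqv R f g"
proof
  have "f \<in> cls R f" by (simp add: cls_def free.span_zero)
  moreover assume "cls R f = cls R g"
  ultimately have "f \<in> cls R g" by simp
  then show "eqv R f g" by (simp add: cls_def eqv_def)
next
  assume "eqv R f g"
  then show "cls R f = cls R g"
    unfolding cls_def eqv_def[symmetric] by (auto intro: eqv_trans eqv_sym)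
qed

lemma cls_eqI: "eqv R f g \<Longrightarrow> cls R f = cls R g"
  by (simp add: cls_eq_iff)

lemma rep_cls: "eqv R (rep (cls R f)) f"
proof -
  have "f \<in> cls R f" by (simp add: cls_def free.span_zero)
  then have "rep (cls R f) \<in> cls R f" unfolding rep_def by (rule someI)
  then show ?thesis by (simp add: cls_def eqv_def)
qed

lemma cls_rep_cls [simp]: "cls R (rep (cls R f)) = cls R f"
  by (simp add: cls_eq_iff rep_cls)

text \<open>\<open>rep\<close> may choose any element of a coset, so the lengths of the lists in it
  have to be recovered from the relations: since these are supported in \<open>A\<close>, so is
  everything in their span.\<close>

lemma eqv_keys:
  assumes "eqv R f g" "\<And>r. r \<in> R \<Longrightarrow> Poly_Mapping.keys r \<subseteq> A" "Poly_Mapping.keys g \<subseteq> A"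
  shows "Poly_Mapping.keys f \<subseteq> A"
proof -
  have "Poly_Mapping.keys u \<subseteq> A" if "u \<in> free.span R" for u
    using that
  proof (induction rule: free.span_induct_alt)
    case (step c x y)
    then show ?case
      using Poly_Mapping.keys_add[of "fscale c x" y] keys_fscale[of c x] assms(2)[of x] by blast
  qed simp
  then have "Poly_Mapping.keys ((f - g) + g) \<subseteq> A"
    using assms(1,3) Poly_Mapping.keys_add[of "f - g" g] unfolding eqv_def by blast
  then show ?thesis by simp
qed

subsection \<open>Multilinear maps\<close>

text \<open>Linearity in each slot holds only modulo \<open>R\<close>, because the values of
  interest are chosen representatives. Slots are addressed by list update, which keeps all other
  entries fixed.\<close>

definition multilin :: "('k::field \<Rightarrow> 'x \<Rightarrow> 'x::ab_group_add) \<Rightarrow> nat \<Rightarrow> ('y \<Rightarrow>\<^sub>0 'k) set \<Rightarrow>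
    ('x list \<Rightarrow> ('y \<Rightarrow>\<^sub>0 'k)) \<Rightarrow> bool" where
  "multilin s n R F \<longleftrightarrow>
     (\<forall>xs i x y. length xs = n \<and> i < n \<longrightarrow>
        eqv R (F (xs[i := x + y])) (F (xs[i := x]) + F (xs[i := y]))) \<and>
     (\<forall>xs i c x. length xs = n \<and> i < n \<longrightarrow>
        eqv R (F (xs[i := s c x])) (fscale c (F (xs[i := x]))))"

lemma multilinI:
  assumes "\<And>xs i x y. length xs = n \<Longrightarrow> i < n \<Longrightarrow>
      eqv R (F (xs[i := x + y])) (F (xs[i := x]) + F (xs[i := y]))"
    and "\<And>xs i c x. length xs = n \<Longrightarrow> i < n \<Longrightarrow>
      eqv R (F (xs[i := s c x])) (fscale c (F (xs[i := x])))"
  shows "multilin s n R F"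
  using assms by (auto simp: multilin_def)

lemma multilin_addD:
  "multilin s n R F \<Longrightarrow> length xs = n \<Longrightarrow> i < n \<Longrightarrow>
     eqv R (F (xs[i := x + y])) (F (xs[i := x]) + F (xs[i := y]))"
  by (auto simp: multilin_def)

lemma multilin_scaleD:
  "multilin s n R F \<Longrightarrow> length xs = n \<Longrightarrow> i < n \<Longrightarrow>
     eqv R (F (xs[i := s c x])) (fscale c (F (xs[i := x])))"
  by (auto simp: multilin_def)

lemma multilin_zero:
  assumes "multilin s n R F" "length xs = n" "i < n" "xs ! i = 0"
  shows "eqv R (F xs) 0"
proof -
  have "eqv R (F (xs[i := 0 + 0])) (F (xs[i := 0]) + F (xs[i := 0]))"
    using assms(1-3) by (rule multilin_addD)
  moreover have "xs[i := 0] = xs" using assms(4) by (metis list_update_id)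
  ultimately have "eqv R (F xs) (F xs + F xs)" by simp
  then have "- (F xs) \<in> free.span R" by (simp add: eqv_def)
  then show ?thesis using free.span_neg by (fastforce simp: eqv_def)
qed

lemma multilin_gen:
  fixes s :: "'k::field \<Rightarrow> 'x \<Rightarrow> 'x::ab_group_add"
  shows "multilin s n (tensor_rel s n) gen"
proof (rule multilinI)
  fix xs :: "'x list" and i x y assume "length xs = n" "i < n"
  then have "gen (xs[i := x + y]) - gen (xs[i := x]) - gen (xs[i := y]) \<in> tensor_rel s n"
    unfolding tensor_rel_def by blast
  then show "eqv (tensor_rel s n) (gen (xs[i := x + y])) (gen (xs[i := x]) + gen (xs[i := y]))"
    by (simp add: eqv_def diff_diff_eq free.span_base)
next
  fix xs :: "'x list" and i c x assume "length xs = n" "i < n"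
  then have "gen (xs[i := s c x]) - fscale c (gen (xs[i := x])) \<in> tensor_rel s n"
    unfolding tensor_rel_def by blast
  then show "eqv (tensor_rel s n) (gen (xs[i := s c x])) (fscale c (gen (xs[i := x])))"
    by (simp add: eqv_def free.span_base)
qed

text \<open>Universal property of the tensor power: the two clauses of \<open>multilin\<close> say
  that the linear extension of \<open>F\<close> sends the two families in \<open>tensor_rel\<close>
  into the span of \<open>R\<close>.\<close>

lemma multilin_eqv:
  assumes "multilin s n R F" "eqv (tensor_rel s n) f g"
  shows "eqv R (lin F f) (lin F g)"
proof (rule eqv_lin_map[OF _ assms(2)])
  fix r assume "r \<in> tensor_rel s n"
  then consider
      xs i x y where "length xs = n" "i < n"
        "r = gen (xs[i := x + y]) - gen (xs[i := x]) - gen (xs[i := y])"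
    | xs i c x where "length xs = n" "i < n"
        "r = gen (xs[i := s c x]) - fscale c (gen (xs[i := x]))"
    unfolding tensor_rel_def by blast
  then show "lin F r \<in> free.span R"
  proof cases
    case 1
    then show ?thesis
      using multilin_addD[OF assms(1), of xs i x y]
      by (simp add: lin_diff lin_add eqv_def diff_diff_eq)
  next
    case 2
    then show ?thesis
      using multilin_scaleD[OF assms(1), of xs i c x]
      by (simp add: lin_diff lin_fscale eqv_def)
  qed
qed

lemma multilin_cong:
  fixes s :: "'k::field \<Rightarrow> 'x \<Rightarrow> 'x::ab_group_add"
  assumes "multilin s n R F" "\<And>xs. length xs = n \<Longrightarrow> eqv R (F xs) (G xs)"
  shows "multilin s n R G"
proof (rule multilinI)
  fix xs :: "'x list" and i x y assume *: "length xs = n" "i < n"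
  have "eqv R (G (xs[i := x + y])) (F (xs[i := x + y]))"
    using * by (intro eqv_sym[OF assms(2)]) simp
  also have "eqv R \<dots> (F (xs[i := x]) + F (xs[i := y]))"
    using assms(1) * by (rule multilin_addD)
  also have "eqv R \<dots> (G (xs[i := x]) + G (xs[i := y]))"
    using * by (intro eqv_add assms(2)) simp_all
  finally show "eqv R (G (xs[i := x + y])) (G (xs[i := x]) + G (xs[i := y]))" .
next
  fix xs :: "'x list" and i c x assume *: "length xs = n" "i < n"
  have "eqv R (G (xs[i := s c x])) (F (xs[i := s c x]))"
    using * by (intro eqv_sym[OF assms(2)]) simp
  also have "eqv R \<dots> (fscale c (F (xs[i := x])))"
    using assms(1) * by (rule multilin_scaleD)
  also have "eqv R \<dots> (fscale c (G (xs[i := x])))"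
    using * by (intro eqv_fscale assms(2)) simp
  finally show "eqv R (G (xs[i := s c x])) (fscale c (G (xs[i := x])))" .
qed

lemma multilin_sum:
  fixes s :: "'k::field \<Rightarrow> 'x \<Rightarrow> 'x::ab_group_add"
  assumes "\<And>i. i \<in> I \<Longrightarrow> multilin s n R (F i)"
  shows "multilin s n R (\<lambda>xs. \<Sum>i\<in>I. F i xs)"
proof (rule multilinI)
  fix xs :: "'x list" and i x y assume *: "length xs = n" "i < n"
  show "eqv R (\<Sum>j\<in>I. F j (xs[i := x + y])) ((\<Sum>j\<in>I. F j (xs[i := x])) + (\<Sum>j\<in>I. F j (xs[i := y])))"
    unfolding sum.distrib[symmetric] using assms * by (intro eqv_sum multilin_addD)
next
  fix xs :: "'x list" and i c x assume *: "length xs = n" "i < n"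
  show "eqv R (\<Sum>j\<in>I. F j (xs[i := s c x])) (fscale c (\<Sum>j\<in>I. F j (xs[i := x])))"
    unfolding free.scale_sum_right using assms * by (intro eqv_sum multilin_scaleD)
qed

lemma multilin_fscale:
  fixes s :: "'k::field \<Rightarrow> 'x \<Rightarrow> 'x::ab_group_add"
  assumes "multilin s n R F"
  shows "multilin s n R (\<lambda>xs. fscale c (F xs))"
proof (rule multilinI)
  fix xs :: "'x list" and i x y assume *: "length xs = n" "i < n"
  show "eqv R (fscale c (F (xs[i := x + y]))) (fscale c (F (xs[i := x])) + fscale c (F (xs[i := y])))"
    unfolding free.scale_right_distrib[symmetric] using assms * by (intro eqv_fscale multilin_addD)
next
  fix xs :: "'x list" and i d x assume *: "length xs = n" "i < n"
  have "eqv R (fscale c (F (xs[i := s d x]))) (fscale c (fscale d (F (xs[i := x]))))"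
    using assms * by (intro eqv_fscale multilin_scaleD)
  then show "eqv R (fscale c (F (xs[i := s d x]))) (fscale d (fscale c (F (xs[i := x]))))"
    by (simp add: mult.commute)
qed

lemma multilin_lin_fun:
  assumes "\<And>y. y \<in> Poly_Mapping.keys f \<Longrightarrow> multilin s n R (\<lambda>xs. F xs y)"
  shows "multilin s n R (\<lambda>xs. lin (F xs) f)"
  unfolding lin_ext_def using assms by (intro multilin_sum multilin_fscale)

text \<open>Each slot \<open>i\<close> of the argument feeds exactly one slot \<open>j\<close> of
  \<open>h xs\<close>, through a linear map \<open>f i\<close>. Inserting fixed entries, permuting,
  and applying maps slot by slot all have this shape.\<close>

lemma multilin_comp:
  fixes s :: "'k::field \<Rightarrow> 'x \<Rightarrow> 'x::ab_group_add"
    and t :: "'k \<Rightarrow> 'z \<Rightarrow> 'z::ab_group_add"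
  assumes "multilin s n R G"
    and "\<And>xs. length xs = m \<Longrightarrow> length (h xs) = n"
    and "\<And>xs i x. length xs = m \<Longrightarrow> i < m \<Longrightarrow>
       (\<exists>j. j < n \<and> (\<forall>x. h (xs[i := x]) = (h xs)[j := f i x])) "
    and "\<And>i x y. f i (x + y) = f i x + f i y"
    and "\<And>i c x. f i (t c x) = s c (f i x)"
  shows "multilin t m R (\<lambda>xs. G (h xs))"
proof (rule multilinI)
  fix xs :: "'z list" and i x y assume *: "length xs = m" "i < m"
  then obtain j where j: "j < n" "\<And>x. h (xs[i := x]) = (h xs)[j := f i x]"
    using assms(3) by blast
  then show "eqv R (G (h (xs[i := x + y]))) (G (h (xs[i := x])) + G (h (xs[i := y])))"
    using multilin_addD[OF assms(1) assms(2)[OF *(1)] j(1)] assms(4) by simp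
next
  fix xs :: "'z list" and i c x assume *: "length xs = m" "i < m"
  then obtain j where j: "j < n" "\<And>x. h (xs[i := x]) = (h xs)[j := f i x]"
    using assms(3) by blast
  then show "eqv R (G (h (xs[i := t c x]))) (fscale c (G (h (xs[i := x]))))"
    using multilin_scaleD[OF assms(1) assms(2)[OF *(1)] j(1)] assms(5) by simp
qed

section \<open>Lengths of the lists occurring in representatives\<close>

lemma keys_diff_subset: "Poly_Mapping.keys (f - g) \<subseteq> Poly_Mapping.keys f \<union> Poly_Mapping.keys g"
  by (auto simp: in_keys_iff lookup_minus)

lemma tensor_rel_keys: "r \<in> tensor_rel s n \<Longrightarrow> Poly_Mapping.keys r \<subseteq> {xs. length xs = n}"
  unfolding tensor_rel_def
  by (auto dest!: keys_diff_subset[THEN subsetD] keys_fscale[THEN subsetD])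

lemma eqv_tensor_rel_keys:
  assumes "eqv (tensor_rel s n) f g" "\<And>xs. xs \<in> Poly_Mapping.keys g \<Longrightarrow> length xs = n"
    and "xs \<in> Poly_Mapping.keys f"
  shows "length xs = n"
proof -
  have "Poly_Mapping.keys f \<subseteq> {xs. length xs = n}"
    by (rule eqv_keys[OF assms(1)]) (auto dest: assms(2) tensor_rel_keys[THEN subsetD])
  then show ?thesis using assms(3) by auto
qed

lemma tensor_powerE:
  assumes "t \<in> tensor_power s n"
  obtains "t = cls (tensor_rel s n) (rep t)" "\<And>xs. xs \<in> Poly_Mapping.keys (rep t) \<Longrightarrow> length xs = n"
proof -
  obtain f where f: "t = cls (tensor_rel s n) f" "\<And>xs. xs \<in> Poly_Mapping.keys f \<Longrightarrow> length xs = n"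
    using assms unfolding tensor_power_def by auto
  then have "t = cls (tensor_rel s n) (rep t)" by simp
  moreover have "length xs = n" if "xs \<in> Poly_Mapping.keys (rep t)" for xs
    using rep_cls f(2) that[unfolded f(1)] by (rule eqv_tensor_rel_keys)
  ultimately show ?thesis by (rule that)
qed

lemma tensor_power_keys: "t \<in> tensor_power s n \<Longrightarrow> xs \<in> Poly_Mapping.keys (rep t) \<Longrightarrow> length xs = n"
  by (erule tensor_powerE)

lemma tensor_power_cls_rep: "t \<in> tensor_power s n \<Longrightarrow> cls (tensor_rel s n) (rep t) = t"
  by (erule tensor_powerE) (rule sym)

lemma tensor_powerI:
  "(\<And>xs. xs \<in> Poly_Mapping.keys f \<Longrightarrow> length xs = n) \<Longrightarrow> cls (tensor_rel s n) f \<in> tensor_power s n"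
  by (auto simp: tensor_power_def)

section \<open>Adjacent transpositions and signs\<close>

text \<open>A transposition of distant positions is a product of adjacent ones by repeated
  conjugation: (a, c+1) = (c, c+1)(a, c)(c, c+1). Multiplication on the right makes each step
  exchange two neighbouring positions of the permuted list, where signs and coproducts can be
  computed directly.\<close>

lemma permutes_adjacent_induct [consumes 1, case_names id adjacent]:
  assumes "\<sigma> permutes {..<n}"
    and "P id"
    and step: "\<And>\<sigma> p. \<sigma> permutes {..<n} \<Longrightarrow> Suc p < n \<Longrightarrow> P \<sigma> \<Longrightarrow> P (\<sigma> \<circ> transpose p (Suc p))"
  shows "P \<sigma>"
proof -
  have perm: "\<rho> \<circ> transpose a b permutes {..<n}" if "\<rho> permutes {..<n}" "a < n" "b < n" for \<rho> a b
    using that by (intro permutes_compose permutes_swap_id) auto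
  have swap_closed: "P (\<rho> \<circ> transpose a b)" if "\<rho> permutes {..<n}" "P \<rho>" "a < b" "b < n" for \<rho> a b
    using that
  proof (induction b arbitrary: \<rho>)
    case (Suc c)
    show ?case
    proof (cases "a = c")
      case True
      then show ?thesis using Suc.prems step[of \<rho> c] by blast
    next
      case False
      let ?t = "transpose c (Suc c)"
      have "P (\<rho> \<circ> ?t \<circ> transpose a c)"
        using Suc.prems False by (intro Suc.IH step perm) auto
      then have "P (\<rho> \<circ> ?t \<circ> transpose a c \<circ> ?t)"
        using Suc.prems False by (intro step perm) auto
      moreover have "?t \<circ> transpose a c \<circ> ?t = transpose a (Suc c)"
        using Suc.prems False by (auto simp: fun_eq_iff transpose_def)
      ultimately show ?thesis by (metis comp_assoc)
    qed
  qed simp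
  show ?thesis
    using finite_lessThan[of n] assms(1)
  proof (induction rule: permutes_rev_induct)
    case id
    then show ?case by (rule assms(2))
  next
    case (swap a b \<rho>)
    then consider "a < b" | "b < a" by linarith
    then show ?case
      using swap swap_closed[of \<rho> a b] swap_closed[of \<rho> b a]
      unfolding lessThan_iff by cases (metis transpose_commute)+
  qed
qed

section \<open>Koszul signs and the sign of the shift\<close>

lemma minus_one_powi: "((-1) powi k :: 'k::field) = (if even k then 1 else -1)"
  by (cases "even k") (auto simp: power_int_def even_nat_iff split: if_splits)

lemma minus_one_powi_add: "((-1) powi (a + b) :: 'k::field) = (-1) powi a * (-1) powi b"
  by (simp add: minus_one_powi)

lemma minus_one_powi_square [simp]: "(-1) powi a * ((-1) powi a :: 'k::field) = 1"
  by (simp add: minus_one_powi)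

text \<open>Exchanging positions \<open>p\<close> and \<open>Suc p\<close> changes the inversion
  status of that one pair and merely permutes the other pairs. The factor of the exceptional pair
  switches between 1 and a sign whose square is 1, so both directions are multiplication by that
  sign.\<close>

lemma koszul_adjacent:
  assumes \<sigma>: "\<sigma> permutes {..<length ds}" and p: "Suc p < length ds"
  shows "(koszul ds (\<sigma> \<circ> transpose p (Suc p)) :: 'k::field)
    = koszul ds \<sigma> * (-1) powi (ds ! \<sigma> p * ds ! \<sigma> (Suc p))"
proof -
  let ?n = "length ds" and ?t = "transpose p (Suc p)"
  let ?X = "{(i, j). i < j \<and> j < ?n}"
  let ?A = "?X - {(p, Suc p)}"
  \<comment> \<open>Giving non-inversions the factor 1 makes the index set of the product
    independent of the permutation.\<close>
  define c :: "(nat \<Rightarrow> nat) \<Rightarrow> nat \<times> nat \<Rightarrow> 'k" where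
    "c = (\<lambda>\<rho> (i, j). if \<rho> j < \<rho> i then (-1) powi (ds ! \<rho> i * ds ! \<rho> j) else 1)"
  have fin: "finite ?X"
    by (rule finite_subset[of _ "{..<?n} \<times> {..<?n}"]) auto
  have koszul: "koszul ds \<rho> = c \<rho> (p, Suc p) * (\<Prod>x\<in>?A. c \<rho> x)" for \<rho>
  proof -
    have "koszul ds \<rho> = (\<Prod>x\<in>?X. c \<rho> x)"
      unfolding koszul_def by (rule prod.mono_neutral_cong_left[OF fin]) (auto simp: c_def split: if_splits)
    then show ?thesis using fin p by (subst (asm) prod.remove[of _ "(p, Suc p)"]) auto
  qed
  \<comment> \<open>The adjacent transposition preserves the order of every pair
    \<open>i < j\<close> other than \<open>(p, Suc p)\<close>.\<close>
  have "bij_betw (map_prod ?t ?t) ?A ?A"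
    by (rule bij_betw_byWitness[of _ "map_prod ?t ?t"]) (use p in \<open>auto simp: transpose_def split: if_splits\<close>)
  then have "(\<Prod>x\<in>?A. c \<sigma> (map_prod ?t ?t x)) = (\<Prod>x\<in>?A. c \<sigma> x)"
    by (rule prod.reindex_bij_betw)
  moreover have "c (\<sigma> \<circ> ?t) x = c \<sigma> (map_prod ?t ?t x)" for x
    unfolding c_def by (cases x) auto
  ultimately have "(\<Prod>x\<in>?A. c (\<sigma> \<circ> ?t) x) = (\<Prod>x\<in>?A. c \<sigma> x)"
    by simp
  moreover have "\<sigma> p \<noteq> \<sigma> (Suc p)"
    using permutes_inj[OF \<sigma>] by (metis injD n_not_Suc_n)
  then have "c (\<sigma> \<circ> ?t) (p, Suc p) = c \<sigma> (p, Suc p) * (-1) powi (ds ! \<sigma> p * ds ! \<sigma> (Suc p))"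
    by (auto simp: c_def mult.commute)
  ultimately show ?thesis by (simp add: koszul mult_ac)
qed

text \<open>The decalage sign. Positions start at 0, so the last argument has weight 0 and the first
  has weight \<open>length ds - 1\<close>.\<close>

definition shift_sign :: "int list \<Rightarrow> 'k::field" where
  "shift_sign ds = (-1) powi (\<Sum>i<length ds. int (length ds - 1 - i) * ds ! i)"

text \<open>Neighbouring entries have weights that differ by 1, so exchanging them changes the
  exponent by the difference of the two degrees, which has the parity of their sum.\<close>

lemma shift_sign_adjacent:
  assumes p: "Suc p < length ds"
  shows "(shift_sign (permute_list (transpose p (Suc p)) ds) :: 'k::field)
    = shift_sign ds * (-1) powi (ds ! p + ds ! Suc p)"
proof -
  let ?n = "length ds" and ?t = "transpose p (Suc p)"
  have t: "?t permutes {..<?n}" using p by (intro permutes_swap_id) auto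
  let ?A = "{..<?n} - {p, Suc p}"
  have split: "(\<Sum>i<?n. f i) = f p + f (Suc p) + (\<Sum>i\<in>?A. f i)" for f :: "nat \<Rightarrow> int"
    using p by (subst sum.subset_diff[of "{p, Suc p}"]) auto
  have "(\<Sum>i<?n. int (?n - 1 - i) * permute_list ?t ds ! i)
      = (\<Sum>i<?n. int (?n - 1 - i) * ds ! ?t i)"
    using t by (intro sum.cong) (simp_all add: permute_list_nth)
  also have "\<dots> = int (?n - 1 - p) * ds ! Suc p + int (?n - 1 - Suc p) * ds ! p
      + (\<Sum>i\<in>?A. int (?n - 1 - i) * ds ! ?t i)"
    by (simp only: split transpose_apply_first transpose_apply_second)
  also have "(\<Sum>i\<in>?A. int (?n - 1 - i) * ds ! ?t i) = (\<Sum>i\<in>?A. int (?n - 1 - i) * ds ! i)"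
    by (intro sum.cong) (auto simp: transpose_def)
  also have "int (?n - 1 - p) * ds ! Suc p + int (?n - 1 - Suc p) * ds ! p
        + (\<Sum>i\<in>?A. int (?n - 1 - i) * ds ! i)
      = (\<Sum>i<?n. int (?n - 1 - i) * ds ! i) + ds ! Suc p - ds ! p"
  proof -
    have "int (?n - 1 - p) = int (?n - 1 - Suc p) + 1" using p by linarith
    then show ?thesis by (simp only: split) (simp only: algebra_simps mult_1)
  qed
  finally show ?thesis
    by (simp add: shift_sign_def minus_one_powi)
qed

text \<open>The one identity behind both the exchange of symmetry with skew-symmetry and the
  comparison of shuffle signs. \<open>permute_list \<sigma> ds\<close> lists the degrees in the
  order in which the permuted term receives its arguments.\<close>

lemma koszul_shift:
  assumes "\<sigma> permutes {..<length ds}"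
  shows "koszul (map ((+) 1) ds) \<sigma> * shift_sign (permute_list \<sigma> ds)
    = (of_int (sign \<sigma>) * koszul ds \<sigma> * shift_sign ds :: 'k::field)"
  using assms
proof (induction rule: permutes_adjacent_induct)
  case id
  have "koszul es id = (1 :: 'k)" for es
    unfolding koszul_def by (rule prod.neutral) auto
  then show ?case unfolding id_def by simp
next
  case (adjacent \<sigma> p)
  let ?t = "transpose p (Suc p)"
  let ?a = "ds ! \<sigma> p" and ?b = "ds ! \<sigma> (Suc p)"
  have t: "?t permutes {..<length ds}" using adjacent by (intro permutes_swap_id) auto
  have lt: "\<sigma> p < length ds" "\<sigma> (Suc p) < length ds"
    using adjacent permutes_in_image[OF adjacent(1)] by auto
  have "sign (\<sigma> \<circ> ?t) = sign \<sigma> * sign ?t"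
    using adjacent(1) permutation_permutes finite_lessThan
    by (intro sign_compose permutation_swap_id) auto
  then have sgn: "sign (\<sigma> \<circ> ?t) = - sign \<sigma>" by (simp add: sign_swap_id)
  have "shift_sign (permute_list (\<sigma> \<circ> ?t) ds)
      = (shift_sign (permute_list \<sigma> ds) * (-1) powi (?a + ?b) :: 'k)"
    using adjacent permute_list_nth[OF adjacent(1)]
    by (simp add: permute_list_compose[OF t] shift_sign_adjacent)
  moreover have "koszul (map ((+) 1) ds) (\<sigma> \<circ> ?t)
      = (koszul (map ((+) 1) ds) \<sigma> * (-1) powi ((1 + ?a) * (1 + ?b)) :: 'k)"
    using adjacent lt by (subst koszul_adjacent) auto
  ultimately have "koszul (map ((+) 1) ds) (\<sigma> \<circ> ?t) * shift_sign (permute_list (\<sigma> \<circ> ?t) ds)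
      = (koszul (map ((+) 1) ds) \<sigma> * shift_sign (permute_list \<sigma> ds))
        * ((-1) powi ((1 + ?a) * (1 + ?b)) * (-1) powi (?a + ?b) :: 'k)"
    by (simp only: mult_ac)
  \<comment> \<open>Modulo 2, (1 + a)(1 + b) + a + b equals ab + 1: each adjacent transposition
    leaves the unshifted Koszul factor and one extra -1, which is its signature.\<close>
  also have "(-1) powi ((1 + ?a) * (1 + ?b)) * (-1) powi (?a + ?b) = (- ((-1) powi (?a * ?b)) :: 'k)"
    by (simp add: minus_one_powi)
  finally show ?case
    unfolding koszul_adjacent[OF adjacent(1,2)] sgn adjacent.IH by simp
qed

lemma shift_sign_square [simp]: "shift_sign ds * (shift_sign ds :: 'k::field) = 1"
  by (simp add: shift_sign_def)

text \<open>The factor \<open>(-1)\<^bsup>l (k - 1)\<^esup>\<close> of the L-infinity relations is produced here.\<close>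

lemma shift_sign_compose:
  assumes "length as = l" "length bs = k - 1" "1 \<le> k" "1 \<le> l"
  shows "shift_sign as * shift_sign ((sum_list as + int l - 2) # bs)
    = ((-1) ^ (l * (k - 1)) * shift_sign (as @ bs) :: 'k::field)"
proof -
  let ?e = "sum_list as + int l - 2"
  define m where "m = k - 1"
  have m: "length bs = m" using assms by (simp add: m_def)
  have "(\<Sum>i<length (?e # bs). int (length (?e # bs) - 1 - i) * (?e # bs) ! i)
      = int m * ?e + (\<Sum>i<m. int (m - Suc i) * bs ! i)"
    by (simp add: m sum.lessThan_Suc_shift del: sum.lessThan_Suc)
  moreover have "(\<Sum>i<length (as @ bs). int (length (as @ bs) - 1 - i) * (as @ bs) ! i)
      = (\<Sum>i<l. int (l + m - 1 - i) * as ! i) + (\<Sum>i<m. int (m - Suc i) * bs ! i)"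
  proof -
    have "(\<Sum>i<l + m. f i) = (\<Sum>i<l. f i) + (\<Sum>i<m. f (l + i))" for f :: "nat \<Rightarrow> int"
      by (induction m) auto
    then show ?thesis
      by (simp add: m assms(1) nth_append algebra_simps)
  qed
  moreover have "(\<Sum>i<l. int (l + m - 1 - i) * as ! i)
      = (\<Sum>i<l. int (l - 1 - i) * as ! i) + int m * sum_list as"
  proof -
    have "sum_list as = (\<Sum>i<l. as ! i)"
      using assms(1) by (simp add: sum_list_sum_nth atLeast0LessThan)
    moreover have "int (l + m - 1 - i) = int (l - 1 - i) + int m" if "i < l" for i
      using that by linarith
    ultimately show ?thesis
      by (simp add: sum_distrib_left flip: sum.distrib) (simp add: algebra_simps)
  qed
  moreover have "((-1) ^ (l * (k - 1)) :: 'k) = (-1) powi (int m * int l)"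
    by (simp add: m_def minus_one_powi minus_one_power_iff)
  \<comment> \<open>The inner value has degree \<open>?e\<close> and weight \<open>m\<close> in the
    outer list. Its part \<open>m * sum_list as\<close> accounts for the larger weights of the
    entries of \<open>as\<close> in \<open>as @ bs\<close>, the part \<open>m * l\<close> remains,
    and the term \<open>2 * m\<close> is even.\<close>
  ultimately show ?thesis
    using assms(1) by (simp add: shift_sign_def minus_one_powi)
qed

section \<open>Substituting lists into multilinear maps\<close>

lemma multilin_append:
  fixes s :: "'k::field \<Rightarrow> 'x \<Rightarrow> 'x::ab_group_add"
  assumes "multilin s (length as + n + length bs) R F"
  shows "multilin s n R (\<lambda>xs. F (as @ xs @ bs))"
  by (rule multilin_comp[OF assms, where f = "\<lambda>i x. x"])
    (auto simp: list_update_append intro!: exI[of _ "length as + i" for i])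

lemma multilin_map:
  fixes s :: "'k::field \<Rightarrow> 'x \<Rightarrow> 'x::ab_group_add"
    and t :: "'k \<Rightarrow> 'z \<Rightarrow> 'z::ab_group_add"
  assumes "multilin s n R F"
    and "\<And>i x y. f i (x + y) = f i x + f i y" "\<And>i c x. f i (t c x) = s c (f i x)"
  shows "multilin t n R (\<lambda>xs. F (map2 f [0..<n] xs))"
proof (rule multilin_comp[OF assms(1), where f = f])
  fix xs :: "'z list" and i x assume "length xs = n" "i < n"
  then show "\<exists>j<n. \<forall>x. map2 f [0..<n] (xs[i := x]) = (map2 f [0..<n] xs)[j := f i x]"
    by (intro exI[of _ i]) (auto intro!: nth_equalityI simp: nth_list_update)
qed (use assms in auto)

lemma map2_conv_upt:
  "length as = n \<Longrightarrow> length bs = n \<Longrightarrow> map2 f as bs = map2 (\<lambda>i. f (as ! i)) [0..<n] bs"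
  "length as = n \<Longrightarrow> length bs = n \<Longrightarrow> map2 f as bs = map2 (\<lambda>i x. f x (bs ! i)) [0..<n] as"
  by (auto intro!: nth_equalityI)

lemma multilin_permute:
  fixes s :: "'k::field \<Rightarrow> 'x \<Rightarrow> 'x::ab_group_add"
  assumes "multilin s n R F" "\<sigma> permutes {..<n}"
  shows "multilin s n R (\<lambda>xs. F (permute_list \<sigma> xs))"
proof (rule multilin_comp[OF assms(1), where f = "\<lambda>i x. x"])
  fix xs :: "'x list" and i x assume *: "length xs = n" "i < n"
  have "inv \<sigma> i < n" using permutes_in_image[OF permutes_inv[OF assms(2)], of i] * by simp
  moreover have "permute_list \<sigma> (xs[i := x]) = (permute_list \<sigma> xs)[inv \<sigma> i := x]" for x
    using * assms(2) permutes_in_image[OF assms(2)] permutes_inv_eq[OF assms(2)]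
    by (auto intro!: nth_equalityI simp: permute_list_nth nth_list_update permutes_inverses[OF assms(2)])
  ultimately show "\<exists>j<n. \<forall>x. permute_list \<sigma> (xs[i := x]) = (permute_list \<sigma> xs)[j := x]"
    by blast
qed auto

text \<open>Coproducts are applied to the first factor only, so linearity in the head and linearity
  in the tail come from different sources and are supplied separately.\<close>

lemma multilin_ConsI:
  fixes s :: "'k::field \<Rightarrow> 'x \<Rightarrow> 'x::ab_group_add"
  assumes "\<And>t x y. length t = n \<Longrightarrow> eqv R (F ((x + y) # t)) (F (x # t) + F (y # t))"
    and "\<And>t c x. length t = n \<Longrightarrow> eqv R (F (s c x # t)) (fscale c (F (x # t)))"
    and "\<And>h. multilin s n R (\<lambda>t. F (h # t))"
  shows "multilin s (Suc n) R F"
proof (rule multilinI)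
  fix xs :: "'x list" and i x y assume "length xs = Suc n" "i < Suc n"
  then show "eqv R (F (xs[i := x + y])) (F (xs[i := x]) + F (xs[i := y]))"
    using multilin_addD[OF assms(3)] assms(1) by (cases xs; cases i) auto
next
  fix xs :: "'x list" and i c x assume "length xs = Suc n" "i < Suc n"
  then show "eqv R (F (xs[i := s c x])) (fscale c (F (xs[i := x])))"
    using multilin_scaleD[OF assms(3)] assms(2) by (cases xs; cases i) auto
qed

section \<open>The iterated coproduct\<close>

lemma cop_first_gen [simp]:
  "cop_first H (gen hs) = lin (\<lambda>ds. gen (ds @ tl hs)) (cop H (hd hs))"
  by (simp add: cop_first_def)

locale cocommutative_hopf =
  fixes H :: "('k::field, 'h::ring_1) hopf"
  assumes hopf: "cocommutative_hopf_algebra H"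
begin

section \<open>The Hopf algebra axioms as congruences\<close>

lemma vector_space_H: "vector_space (hscale H)"
  using hopf unfolding cocommutative_hopf_algebra_def by (elim conjE) iprover

lemma hscale_hscale: "hscale H c (hscale H d x) = hscale H (c * d) x"
  using vector_space_H by (simp add: vector_space_def)

lemma hscale_mult_left: "hscale H c x * y = hscale H c (x * y)"
  using hopf unfolding cocommutative_hopf_algebra_def by (elim conjE) iprover

lemma hscale_mult_right: "x * hscale H c y = hscale H c (x * y)"
  using hopf unfolding cocommutative_hopf_algebra_def by (elim conjE) iprover

lemma comult_cop: "comult H x = cls (Hrel H 2) (cop H x)"
  and keys_cop: "hs \<in> Poly_Mapping.keys (cop H x) \<Longrightarrow> length hs = 2"
proof -
  have "comult H x \<in> tensor_power (hscale H) 2"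
    using hopf unfolding cocommutative_hopf_algebra_def by (elim conjE) iprover
  then show "comult H x = cls (Hrel H 2) (cop H x)"
    and "hs \<in> Poly_Mapping.keys (cop H x) \<Longrightarrow> length hs = 2"
    unfolding cop_def by (auto elim: tensor_powerE)
qed

lemma cop_add: "eqv (Hrel H 2) (cop H (x + y)) (cop H x + cop H y)"
  unfolding cls_eq_iff[symmetric] comult_cop[symmetric]
  using hopf unfolding cocommutative_hopf_algebra_def by (elim conjE) iprover

lemma cop_hscale: "eqv (Hrel H 2) (cop H (hscale H c x)) (fscale c (cop H x))"
  unfolding cls_eq_iff[symmetric] comult_cop[symmetric]
  using hopf unfolding cocommutative_hopf_algebra_def by (elim conjE) iprover

lemma cop_coassoc: "eqv (Hrel H 3) (cop_first H (cop H x)) (cop_last H (cop H x))"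
  unfolding cls_eq_iff[symmetric]
  using hopf unfolding cocommutative_hopf_algebra_def by (elim conjE) iprover

lemma cop_cocomm: "eqv (Hrel H 2) (lin (\<lambda>hs. gen (rev hs)) (cop H x)) (cop H x)"
  unfolding cls_eq_iff[symmetric] comult_cop[symmetric]
  using hopf unfolding cocommutative_hopf_algebra_def by (elim conjE) iprover

lemma cop_mult: "eqv (Hrel H 2) (cop H (x * y))
    (bilin (\<lambda>as bs. gen (map2 (*) as bs)) (cop H x) (cop H y))"
  unfolding cls_eq_iff[symmetric] comult_cop[symmetric]
  using hopf unfolding cocommutative_hopf_algebra_def by (elim conjE) iprover

lemma eqv_append_right:
  assumes "eqv (Hrel H m) f g" "length t = n" "k = m + n"
  shows "eqv (Hrel H k) (lin (\<lambda>ds. gen (ds @ t)) f) (lin (\<lambda>ds. gen (ds @ t)) g)"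
  using multilin_append[where as = "[]" and bs = t and n = m] multilin_gen[of "hscale H" k] assms
  by (intro multilin_eqv[OF _ assms(1)]) auto

text \<open>The head is linear because the coproduct is, the tail because it is carried along
  unchanged. This lets congruences pass through the recursion that defines
  \<open>coprod\<close>.\<close>

lemma multilin_cop_first: "multilin (hscale H) (Suc n) (Hrel H (Suc (Suc n))) (\<lambda>hs. cop_first H (gen hs))"
proof (rule multilin_ConsI)
  fix t :: "'h list" and x y assume "length t = n"
  then have *: "eqv (Hrel H 2) f g \<Longrightarrow> eqv (Hrel H (Suc (Suc n)))
      (lin (\<lambda>ds. gen (ds @ t)) f) (lin (\<lambda>ds. gen (ds @ t)) g)" for f g
    by (intro eqv_append_right) auto
  show "eqv (Hrel H (Suc (Suc n))) (cop_first H (gen ((x + y) # t)))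
      (cop_first H (gen (x # t)) + cop_first H (gen (y # t)))"
    using *[OF cop_add[of x y]] by (simp add: lin_add)
  show "eqv (Hrel H (Suc (Suc n))) (cop_first H (gen (hscale H c x # t)))
      (fscale c (cop_first H (gen (x # t))))" for c
    using *[OF cop_hscale[of c x]] by (simp add: lin_fscale)
next
  fix h
  have "multilin (hscale H) n (Hrel H (Suc (Suc n))) (\<lambda>t. gen (ds @ t))"
    if "ds \<in> Poly_Mapping.keys (cop H h)" for ds
    using multilin_append[where as = ds and bs = "[]" and n = n] keys_cop[OF that]
      multilin_gen[of "hscale H" "Suc (Suc n)"] by fastforce
  then show "multilin (hscale H) n (Hrel H (Suc (Suc n))) (\<lambda>t. cop_first H (gen (h # t)))"
    unfolding cop_first_gen list.sel by (intro multilin_lin_fun)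
qed

lemma eqv_cop_first:
  assumes "eqv (Hrel H (Suc n)) f g"
  shows "eqv (Hrel H (Suc (Suc n))) (cop_first H f) (cop_first H g)"
  using multilin_eqv[OF multilin_cop_first assms] by (simp add: cop_first_def)

lemma keys_coprod: "hs \<in> Poly_Mapping.keys (coprod H n h) \<Longrightarrow> length hs = Suc n"
proof (induction n arbitrary: hs)
  case (Suc n)
  from Suc.prems obtain es ds where "es \<in> Poly_Mapping.keys (coprod H n h)"
    "ds \<in> Poly_Mapping.keys (cop H (hd es))" "hs = ds @ tl es"
    by (auto simp: cop_first_def elim!: keys_linE)
  then show ?case using Suc.IH[of es] keys_cop[of ds] by simp
qed simp

lemma coprod_add: "eqv (Hrel H (Suc n)) (coprod H n (x + y)) (coprod H n x + coprod H n y)"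
proof (induction n)
  case 0
  show ?case using multilin_addD[OF multilin_gen, of "[0]" 1 0 "hscale H" x y] by simp
next
  case (Suc n)
  then show ?case using eqv_cop_first[OF Suc] by (simp add: cop_first_def lin_add)
qed

lemma coprod_hscale: "eqv (Hrel H (Suc n)) (coprod H n (hscale H c x)) (fscale c (coprod H n x))"
proof (induction n)
  case 0
  show ?case using multilin_scaleD[OF multilin_gen, of "[0]" 1 0 "hscale H" c x] by simp
next
  case (Suc n)
  then show ?case using eqv_cop_first[OF Suc] by (simp add: cop_first_def lin_fscale)
qed

text \<open>When the first factor of a factorwise product is expanded, \<open>cop_mult\<close>
  splits the coproduct of the product of the two heads, while the tails multiply as before.
  Induction then follows the recursion of \<open>coprod\<close>.\<close>

lemma coprod_mult: "eqv (Hrel H (Suc n)) (coprod H n (x * y))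
    (lin (\<lambda>as. lin (\<lambda>bs. gen (map2 (*) as bs)) (coprod H n y)) (coprod H n x))"
proof (induction n)
  case (Suc n)
  let ?X = "coprod H n x" and ?Y = "coprod H n y"
  have "eqv (Hrel H (Suc (Suc n))) (coprod H (Suc n) (x * y))
      (cop_first H (lin (\<lambda>as. lin (\<lambda>bs. gen (map2 (*) as bs)) ?Y) ?X))"
    using eqv_cop_first[OF Suc] by simp
  also have "\<dots> = lin (\<lambda>as. lin (\<lambda>bs. cop_first H (gen (map2 (*) as bs))) ?Y) ?X"
    by (simp add: cop_first_def lin_lin)
  also have "eqv (Hrel H (Suc (Suc n))) \<dots>
      (lin (\<lambda>as. lin (\<lambda>bs. lin (\<lambda>u. lin (\<lambda>v. gen (map2 (*) (u @ tl as) (v @ tl bs)))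
         (cop H (hd bs))) (cop H (hd as))) ?Y) ?X)"
  proof (intro eqv_lin)
    fix as bs assume "as \<in> Poly_Mapping.keys ?X" "bs \<in> Poly_Mapping.keys ?Y"
    then have len: "length as = Suc n" "length bs = Suc n" by (auto dest: keys_coprod)
    then obtain a as' b bs' where [simp]: "as = a # as'" "bs = b # bs'"
      by (metis length_Suc_conv)
    have "cop_first H (gen (map2 (*) as bs))
        = lin (\<lambda>ds. gen (ds @ map2 (*) as' bs')) (cop H (a * b))"
      by simp
    also have "eqv (Hrel H (Suc (Suc n))) \<dots> (lin (\<lambda>ds. gen (ds @ map2 (*) as' bs'))
        (bilin (\<lambda>as bs. gen (map2 (*) as bs)) (cop H a) (cop H b)))"
      using len by (intro eqv_append_right[OF cop_mult]) auto
    also have "\<dots> = lin (\<lambda>u. lin (\<lambda>v. gen (map2 (*) (u @ as') (v @ bs'))) (cop H b)) (cop H a)"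
      unfolding bilin_def lin_lin using keys_cop by (intro lin_cong) auto
    finally show "eqv (Hrel H (Suc (Suc n))) (cop_first H (gen (map2 (*) as bs)))
      (lin (\<lambda>u. lin (\<lambda>v. gen (map2 (*) (u @ tl as) (v @ tl bs))) (cop H (hd bs))) (cop H (hd as)))"
      by simp
  qed
  \<comment> \<open>The expansion of the head of \<open>as\<close> is moved outside the sum over
    \<open>bs\<close>, so that each pair of nested sums becomes an iterated coproduct with one more
    factor.\<close>
  also have "\<dots> = lin (\<lambda>as. lin (\<lambda>u. lin (\<lambda>bs. lin (\<lambda>v. gen (map2 (*) (u @ tl as) (v @ tl bs)))
         (cop H (hd bs))) ?Y) (cop H (hd as))) ?X"
    by (subst lin_swap) (rule refl)
  also have "\<dots> = lin (\<lambda>as. lin (\<lambda>bs. gen (map2 (*) as bs)) (coprod H (Suc n) y)) (coprod H (Suc n) x)"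
    by (simp add: cop_first_def lin_lin)
  finally show ?case .
qed simp

text \<open>An equality of formal sums, not only a congruence: \<open>coprod\<close> always expands
  the first factor, so expanding that factor \<open>m\<close> more times is \<open>m\<close> more
  steps of the same recursion.\<close>

lemma coprod_first_factor:
  "lin (\<lambda>fs. lin (\<lambda>ds. gen (ds @ tl fs)) (coprod H m (hd fs))) (coprod H n h) = coprod H (n + m) h"
proof (induction m)
  case 0
  show ?case
  proof (simp, rule lin_id)
    fix fs assume "fs \<in> Poly_Mapping.keys (coprod H n h)"
    then show "gen (hd fs # tl fs) = (gen fs :: _ \<Rightarrow>\<^sub>0 'k)" using keys_coprod[of fs] by (cases fs) auto
  qed
next
  case (Suc m)
  have "lin (\<lambda>ds. gen (ds @ t)) (coprod H (Suc m) a) = cop_first H (lin (\<lambda>ds. gen (ds @ t)) (coprod H m a))"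
    for t a
  proof -
    have "lin (\<lambda>x. lin (\<lambda>u. gen (u @ tl x @ t)) (cop H (hd x))) (coprod H m a)
        = lin (\<lambda>x. lin (\<lambda>ds. gen (ds @ tl (x @ t))) (cop H (hd (x @ t)))) (coprod H m a)"
    proof (intro lin_cong)
      fix x assume "x \<in> Poly_Mapping.keys (coprod H m a)"
      then have "x \<noteq> []" using keys_coprod by fastforce
      then show "lin (\<lambda>u. gen (u @ tl x @ t)) (cop H (hd x))
        = lin (\<lambda>ds. gen (ds @ tl (x @ t))) (cop H (hd (x @ t)))" by simp
    qed
    then show ?thesis by (simp add: cop_first_def lin_lin)
  qed
  then have "lin (\<lambda>fs. lin (\<lambda>ds. gen (ds @ tl fs)) (coprod H (Suc m) (hd fs))) (coprod H n h)
      = cop_first H (lin (\<lambda>fs. lin (\<lambda>ds. gen (ds @ tl fs)) (coprod H m (hd fs))) (coprod H n h))"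
    by (simp add: cop_first_def lin_lin)
  then show ?case by (simp add: Suc)
qed

text \<open>By coassociativity the second and third tensor factors also arise from one coproduct, so
  cocommutativity gives invariance under each adjacent transposition.\<close>

lemma coprod_adjacent:
  assumes "p < n"
  shows "eqv (Hrel H (Suc n)) (lin (\<lambda>hs. gen (permute_list (transpose p (Suc p)) hs)) (coprod H n h))
    (coprod H n h)"
  using assms
proof (induction n arbitrary: p)
  case (Suc n)
  have swap: "permute_list (transpose (length as) (Suc (length as))) (as @ [x, y] @ bs) = as @ [y, x] @ bs"
    for as bs :: "'h list" and x y
  proof -
    have "transpose (length as) (Suc (length as)) permutes {..<length (as @ [x, y] @ bs)}"
      by (rule permutes_swap_id) auto
    then show ?thesis
      by (intro nth_equalityI)
        (auto simp: permute_list_nth transpose_def nth_append nth_Cons' )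
  qed
  have two: "\<exists>x y. ds = [x, y]" if "ds \<in> Poly_Mapping.keys (cop H a)" for ds a
    using keys_cop[OF that] by (auto simp: numeral_2_eq_2 length_Suc_conv)
  \<comment> \<open>The last expansion replaces the first factor by two. For \<open>p = 0\<close>
    the two new factors are exchanged, for \<open>p = 1\<close> the second of them with an old one;
    otherwise both lie in the untouched tail, where before the expansion their positions were lower
    by one.\<close>
  consider "p = 0" | "p = 1" | q where "p = Suc q" "0 < q" by (cases p) auto
  then show ?case
  proof cases
    case 1
    have "lin (\<lambda>hs. gen (permute_list (transpose p (Suc p)) hs)) (coprod H (Suc n) h)
      = lin (\<lambda>hs. lin (\<lambda>ds. gen (ds @ tl hs)) (lin (\<lambda>ds. gen (rev ds)) (cop H (hd hs)))) (coprod H n h)"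
      unfolding coprod.simps cop_first_def lin_lin
    proof (intro lin_cong)
      fix hs ds assume "ds \<in> Poly_Mapping.keys (cop H (hd hs))"
      then obtain x y where "ds = [x, y]" using two by blast
      then show "lin (\<lambda>hs. gen (permute_list (transpose p (Suc p)) hs)) (gen (ds @ tl hs))
        = (lin (\<lambda>ds. gen (ds @ tl hs)) (gen (rev ds)) :: _ \<Rightarrow>\<^sub>0 'k)"
        using swap[of "[]"] 1 by simp
    qed
    also have "eqv (Hrel H (Suc (Suc n))) \<dots> (coprod H (Suc n) h)"
      unfolding coprod.simps cop_first_def
      by (intro eqv_lin eqv_append_right[OF cop_cocomm]) (auto dest: keys_coprod)
    finally show ?thesis .
  next
    case 2
    then obtain k where n: "n = Suc k" using Suc.prems by (cases n) auto
    let ?\<tau> = "\<lambda>hs. gen (permute_list (transpose p (Suc p)) hs) :: 'h list \<Rightarrow>\<^sub>0 'k"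
    \<comment> \<open>In Sweedler notation the first three factors are rewritten so that the second
      and third are the two halves of the coproduct of a single element; exchanging them is then
      cocommutativity.\<close>
    let ?last = "lin (\<lambda>hs. lin (\<lambda>zs. gen (zs @ tl hs)) (cop_last H (cop H (hd hs)))) (coprod H k h)"
    have tau: "multilin (hscale H) (Suc (Suc n)) (Hrel H (Suc (Suc n))) ?\<tau>"
      using 2 n by (intro multilin_permute multilin_gen permutes_swap_id) auto
    have last: "eqv (Hrel H (Suc (Suc n))) (coprod H (Suc n) h) ?last"
    proof -
      have "coprod H (Suc n) h
          = lin (\<lambda>hs. lin (\<lambda>zs. gen (zs @ tl hs)) (cop_first H (cop H (hd hs)))) (coprod H k h)"
        unfolding n coprod.simps cop_first_def lin_lin lin_gen
      proof (intro lin_cong)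
        fix hs ds assume "ds \<in> Poly_Mapping.keys (cop H (hd hs))"
        then obtain x y where "ds = [x, y]" using two by blast
        then show "lin (\<lambda>es. gen (es @ tl (ds @ tl hs))) (cop H (hd (ds @ tl hs)))
          = lin (\<lambda>x. gen ((x @ tl ds) @ tl hs)) (cop H (hd ds))" by simp
      qed
      also have "eqv (Hrel H (Suc (Suc n))) \<dots> ?last"
        by (intro eqv_lin eqv_append_right[OF cop_coassoc]) (auto dest: keys_coprod simp: n)
      finally show ?thesis .
    qed
    have "eqv (Hrel H (Suc (Suc n))) (lin ?\<tau> (coprod H (Suc n) h)) (lin ?\<tau> ?last)"
      by (rule multilin_eqv[OF tau last])
    also have "lin ?\<tau> ?last = lin (\<lambda>hs. lin (\<lambda>ds. lin (\<lambda>es. gen (butlast ds @ es @ tl hs))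
        (lin (\<lambda>es. gen (rev es)) (cop H (last ds)))) (cop H (hd hs))) (coprod H k h)"
      unfolding cop_last_def lin_lin lin_gen
    proof (intro lin_cong)
      fix hs ds es
      assume "ds \<in> Poly_Mapping.keys (cop H (hd hs))" "es \<in> Poly_Mapping.keys (cop H (last ds))"
      then obtain x y z w where "ds = [x, y]" "es = [z, w]" using two by meson
      then show "?\<tau> ((butlast ds @ es) @ tl hs) = gen (butlast ds @ rev es @ tl hs)"
        using swap[of "[x]" z w "tl hs"] 2 by simp
    qed
    also have "eqv (Hrel H (Suc (Suc n))) \<dots> ?last"
      unfolding cop_last_def lin_lin[of "\<lambda>zs. gen (zs @ tl _)"] lin_gen append_assoc
    proof (intro eqv_lin)
      fix hs ds
      assume "hs \<in> Poly_Mapping.keys (coprod H k h)" "ds \<in> Poly_Mapping.keys (cop H (hd hs))"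
      then have "length (butlast ds) + 2 + length (tl hs) = Suc (Suc n)"
        using keys_coprod keys_cop n by fastforce
      then have "multilin (hscale H) 2 (Hrel H (Suc (Suc n))) (\<lambda>es. gen (butlast ds @ es @ tl hs))"
        by (intro multilin_append) (simp only: multilin_gen)
      then show "eqv (Hrel H (Suc (Suc n)))
          (lin (\<lambda>es. gen (butlast ds @ es @ tl hs)) (lin (\<lambda>es. gen (rev es)) (cop H (last ds))))
          (lin (\<lambda>es. gen (butlast ds @ es @ tl hs)) (cop H (last ds)))"
        using cop_cocomm by (rule multilin_eqv)
    qed
    also have "eqv (Hrel H (Suc (Suc n))) ?last (coprod H (Suc n) h)"
      using last by (rule eqv_sym)
    finally show ?thesis .
  next
    case 3
    have "lin (\<lambda>hs. gen (permute_list (transpose p (Suc p)) hs)) (coprod H (Suc n) h)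
      = cop_first H (lin (\<lambda>hs. gen (permute_list (transpose q (Suc q)) hs)) (coprod H n h))"
      unfolding coprod.simps cop_first_def lin_lin lin_gen
    proof (intro lin_cong)
      fix hs assume "hs \<in> Poly_Mapping.keys (coprod H n h)"
      then have len: "length hs = Suc n" by (rule keys_coprod)
      \<comment> \<open>Positivity of \<open>q\<close> keeps the head of \<open>hs\<close>, the
        factor about to be expanded, out of the exchanged pair.\<close>
      obtain r where r: "q = Suc r" using 3 by (cases q) auto
      obtain as x y bs where hs: "hs = as @ [x, y] @ bs" "length as = q"
      proof
        show "hs = take q hs @ [hs ! q, hs ! Suc q] @ drop (Suc (Suc q)) hs"
          using len 3 Suc.prems by (simp add: Cons_nth_drop_Suc)
        show "length (take q hs) = q" using len 3 Suc.prems by simp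
      qed
      then obtain a as' where as: "as = a # as'" using r by (cases as) auto
      have "lin (\<lambda>ds. gen (permute_list (transpose p (Suc p)) (ds @ tl hs))) (cop H (hd hs))
        = lin (\<lambda>ds. gen (ds @ as' @ [y, x] @ bs)) (cop H a)"
        unfolding hs(1) as append_Cons list.sel
      proof (intro lin_cong)
        fix ds assume "ds \<in> Poly_Mapping.keys (cop H a)"
        then have "length (ds @ as') = p" using hs as 3 keys_cop[of ds a] by simp
        then show "gen (permute_list (transpose p (Suc p)) (ds @ as' @ x # y # [] @ bs))
          = (gen (ds @ as' @ y # x # [] @ bs) :: _ \<Rightarrow>\<^sub>0 'k)"
          using swap[of "ds @ as'" x y bs] by simp
      qed
      moreover have "permute_list (transpose q (Suc q)) hs = a # as' @ [y, x] @ bs"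
        using swap[of as x y bs] hs as by simp
      ultimately show "lin (\<lambda>ds. gen (permute_list (transpose p (Suc p)) (ds @ tl hs))) (cop H (hd hs))
        = lin (\<lambda>ds. gen (ds @ tl (permute_list (transpose q (Suc q)) hs)))
            (cop H (hd (permute_list (transpose q (Suc q)) hs)))"
        by simp
    qed
    also have "eqv (Hrel H (Suc (Suc n))) \<dots> (cop_first H (coprod H n h))"
      using Suc 3 by (intro eqv_cop_first) auto
    finally show ?thesis by simp
  qed
qed simp

lemma coprod_permute:
  assumes "\<sigma> permutes {..n}"
  shows "eqv (Hrel H (Suc n)) (lin (\<lambda>hs. gen (permute_list \<sigma> hs)) (coprod H n h)) (coprod H n h)"
proof -
  have "\<sigma> permutes {..<Suc n}" using assms by (simp add: lessThan_Suc_atMost)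
  then show ?thesis
  proof (induction rule: permutes_adjacent_induct)
    case id
    have "lin (\<lambda>hs. gen (permute_list id hs)) (coprod H n h) = coprod H n h"
      by (rule lin_id) (simp add: id_def)
    then show ?case by simp
  next
    case (adjacent \<sigma> p)
    let ?t = "transpose p (Suc p)"
    have t: "?t permutes {..<Suc n}" using adjacent by (intro permutes_swap_id) auto
    have "lin (\<lambda>hs. gen (permute_list (\<sigma> \<circ> ?t) hs)) (coprod H n h)
      = lin (\<lambda>hs. gen (permute_list ?t hs)) (lin (\<lambda>hs. gen (permute_list \<sigma> hs)) (coprod H n h))"
      unfolding lin_lin lin_gen using t
      by (intro lin_cong) (metis permute_list_compose keys_coprod)
    also have "eqv (Hrel H (Suc n)) \<dots> (lin (\<lambda>hs. gen (permute_list ?t hs)) (coprod H n h))"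
      using t by (intro multilin_eqv[OF _ adjacent.IH] multilin_permute multilin_gen)
    also have "eqv (Hrel H (Suc n)) \<dots> (coprod H n h)"
      using adjacent by (intro coprod_adjacent) auto
    finally show ?case .
  qed
qed

end

section \<open>Balanced maps\<close>

lemma multilin_post:
  fixes s :: "'k::field \<Rightarrow> 'x \<Rightarrow> 'x::ab_group_add"
  assumes "multilin s n R F" "\<And>f g. eqv R f g \<Longrightarrow> eqv R' (lin P f) (lin P g)"
  shows "multilin s n R' (\<lambda>xs. lin P (F xs))"
proof (rule multilinI)
  fix xs :: "'x list" and i x y assume "length xs = n" "i < n"
  then show "eqv R' (lin P (F (xs[i := x + y]))) (lin P (F (xs[i := x])) + lin P (F (xs[i := y])))"
    using assms(2)[OF multilin_addD[OF assms(1)]] by (simp add: lin_add)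
next
  fix xs :: "'x list" and i c x assume "length xs = n" "i < n"
  then show "eqv R' (lin P (F (xs[i := s c x]))) (fscale c (lin P (F (xs[i := x]))))"
    using assms(2)[OF multilin_scaleD[OF assms(1)]] by (simp add: lin_fscale)
qed

lemma multilin_take_drop:
  fixes s :: "'k::field \<Rightarrow> 'x \<Rightarrow> 'x::ab_group_add"
  assumes "\<And>bs. length bs = m \<Longrightarrow> multilin s l R (\<lambda>as. F as bs)"
    and "\<And>as. length as = l \<Longrightarrow> multilin s m R (F as)"
  shows "multilin s (l + m) R (\<lambda>xs. F (take l xs) (drop l xs))"
proof (rule multilinI)
  fix xs :: "'x list" and i x y assume "length xs = l + m" "i < l + m"
  then show "eqv R (F (take l (xs[i := x + y])) (drop l (xs[i := x + y])))
      (F (take l (xs[i := x])) (drop l (xs[i := x])) + F (take l (xs[i := y])) (drop l (xs[i := y])))"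
    using multilin_addD[OF assms(1), of "drop l xs" "take l xs" i x y]
      multilin_addD[OF assms(2), of "take l xs" "drop l xs" "i - l" x y]
    by (cases "i < l") (auto simp: take_update_swap drop_update_swap list_update_beyond not_less)
next
  fix xs :: "'x list" and i c x assume "length xs = l + m" "i < l + m"
  then show "eqv R (F (take l (xs[i := s c x])) (drop l (xs[i := s c x])))
      (fscale c (F (take l (xs[i := x])) (drop l (xs[i := x]))))"
    using multilin_scaleD[OF assms(1), of "drop l xs" "take l xs" i c x]
      multilin_scaleD[OF assms(2), of "take l xs" "drop l xs" "i - l" c x]
    by (cases "i < l") (auto simp: take_update_swap drop_update_swap list_update_beyond not_less)
qed

lemma map2_mult_assoc: "map2 (*) (map2 (*) as bs) cs = map2 (*) as (map2 (*) bs cs)"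
  for as bs cs :: "'h::ring_1 list"
  by (auto intro!: nth_equalityI simp: mult.assoc)

locale pseudo_module = cocommutative_hopf H
  for H :: "('k::field, 'h::ring_1) hopf" +
  fixes M :: "('h, 'm::ab_group_add) gmod"
  assumes graded_module: "graded_left_module M"
begin

lemma act_add: "act M h (x + y) = act M h x + act M h y"
  and act_add_left: "act M (g + h) x = act M g x + act M h x"
  and act_mult: "act M (g * h) x = act M g (act M h x)"
  and act_one [simp]: "act M 1 x = x"
  and grade_zero: "0 \<in> grade M n"
  and grade_add: "x \<in> grade M n \<Longrightarrow> y \<in> grade M n \<Longrightarrow> x + y \<in> grade M n"
  and grade_act: "x \<in> grade M n \<Longrightarrow> act M h x \<in> grade M n"
  and ex1_decomp: "\<exists>!c. is_decomp M x c"
  using graded_module unfolding graded_left_module_def by simp_all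

lemma mscale_add: "mscale H M c (x + y) = mscale H M c x + mscale H M c y"
  by (simp add: mscale_def act_add)

lemma act_hscale: "act M (hscale H c h) x = mscale H M c (act M h x)"
  by (simp add: mscale_def hscale_mult_left flip: act_mult)

lemma act_mscale: "act M h (mscale H M c x) = mscale H M c (act M h x)"
  by (simp add: mscale_def hscale_mult_left hscale_mult_right flip: act_mult)

text \<open>The conditions under which \<open>F\<close> descends to the tensor product over
  \<open>H\<close>. The last clause moves \<open>h\<close> across the tensor sign;
  \<open>coprod H (n - 1)\<close> has \<open>n\<close> factors when \<open>n\<close> is
  positive.\<close>

definition balanced :: "nat \<Rightarrow> ('y \<Rightarrow>\<^sub>0 'k) set \<Rightarrow> ('h list \<times> 'm \<Rightarrow> ('y \<Rightarrow>\<^sub>0 'k)) \<Rightarrow> bool" where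
  "balanced n R F \<longleftrightarrow>
     (\<forall>m. multilin (hscale H) n R (\<lambda>hs. F (hs, m))) \<and>
     (\<forall>hs x y. length hs = n \<longrightarrow> eqv R (F (hs, x + y)) (F (hs, x) + F (hs, y))) \<and>
     (\<forall>hs c x. length hs = n \<longrightarrow> eqv R (F (hs, mscale H M c x)) (fscale c (F (hs, x)))) \<and>
     (\<forall>hs h m. length hs = n \<longrightarrow>
        eqv R (lin (\<lambda>ds. F (map2 (*) hs ds, m)) (coprod H (n - 1) h)) (F (hs, act M h m)))"

lemma balancedI:
  assumes "\<And>m. multilin (hscale H) n R (\<lambda>hs. F (hs, m))"
    and "\<And>hs x y. length hs = n \<Longrightarrow> eqv R (F (hs, x + y)) (F (hs, x) + F (hs, y))"
    and "\<And>hs c x. length hs = n \<Longrightarrow> eqv R (F (hs, mscale H M c x)) (fscale c (F (hs, x)))"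
    and "\<And>hs h m. length hs = n \<Longrightarrow>
        eqv R (lin (\<lambda>ds. F (map2 (*) hs ds, m)) (coprod H (n - 1) h)) (F (hs, act M h m))"
  shows "balanced n R F"
  unfolding balanced_def using assms by auto

lemma balancedD:
  assumes "balanced n R F"
  shows "multilin (hscale H) n R (\<lambda>hs. F (hs, m))"
    and "length hs = n \<Longrightarrow> eqv R (F (hs, x + y)) (F (hs, x) + F (hs, y))"
    and "length hs = n \<Longrightarrow> eqv R (F (hs, mscale H M c x)) (fscale c (F (hs, x)))"
    and "length hs = n \<Longrightarrow>
        eqv R (lin (\<lambda>ds. F (map2 (*) hs ds, m)) (coprod H (n - 1) h)) (F (hs, act M h m))"
  using assms unfolding balanced_def by auto

text \<open>Universal property of \<open>Ptens\<close>, with one case for each family in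
  \<open>Prel\<close>. Composition and permutation of slots are proved balanced in order to evaluate
  them on an arbitrary representative.\<close>

lemma balanced_eqv:
  assumes F: "balanced n R F" and "eqv (Prel H M n) f g"
  shows "eqv R (lin F f) (lin F g)"
proof (rule eqv_lin_map[OF _ assms(2)])
  fix r assume "r \<in> Prel H M n"
  then consider
      hs i a b m where "length hs = n" "i < n"
        "r = gen (hs[i := a + b], m) - gen (hs[i := a], m) - gen (hs[i := b], m)"
    | hs i c a m where "length hs = n" "i < n"
        "r = gen (hs[i := hscale H c a], m) - fscale c (gen (hs[i := a], m))"
    | hs x y where "length hs = n" "r = gen (hs, x + y) - gen (hs, x) - gen (hs, y)"
    | hs c x where "length hs = n" "r = gen (hs, mscale H M c x) - fscale c (gen (hs, x))"
    | hs h m where "length hs = n"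
        "r = lin (\<lambda>ds. gen (map2 (*) hs ds, m)) (coprod H (n - 1) h) - gen (hs, act M h m)"
    unfolding Prel_def by blast
  then show "lin F r \<in> free.span R"
  proof cases
    case 1
    then show ?thesis
      using multilin_addD[OF balancedD(1)[OF F, of m], of hs i a b]
      by (simp add: eqv_def lin_diff diff_diff_eq lin_add)
  next
    case 2
    then show ?thesis
      using multilin_scaleD[OF balancedD(1)[OF F, of m], of hs i c a]
      by (simp add: eqv_def lin_diff lin_fscale)
  next
    case 3
    then show ?thesis
      using balancedD(2)[OF F, of hs x y] by (simp add: eqv_def lin_diff diff_diff_eq lin_add)
  next
    case 4
    then show ?thesis
      using balancedD(3)[OF F, of hs c x] by (simp add: eqv_def lin_diff lin_fscale)
  next
    case 5
    then show ?thesis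
      using balancedD(4)[OF F, of hs m h] by (simp add: eqv_def lin_diff lin_lin)
  qed
qed

lemma balanced_gen: "balanced n (Prel H M n) gen"
proof (rule balancedI)
  fix m
  show "multilin (hscale H) n (Prel H M n) (\<lambda>hs. gen (hs, m))"
  proof (rule multilinI)
    fix hs :: "'h list" and i a b assume "length hs = n" "i < n"
    then have "gen (hs[i := a + b], m) - gen (hs[i := a], m) - gen (hs[i := b], m) \<in> Prel H M n"
      unfolding Prel_def by blast
    then show "eqv (Prel H M n) (gen (hs[i := a + b], m)) (gen (hs[i := a], m) + gen (hs[i := b], m))"
      by (simp add: eqv_def diff_diff_eq free.span_base)
  next
    fix hs :: "'h list" and i c a assume "length hs = n" "i < n"
    then have "gen (hs[i := hscale H c a], m) - fscale c (gen (hs[i := a], m)) \<in> Prel H M n"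
      unfolding Prel_def by blast
    then show "eqv (Prel H M n) (gen (hs[i := hscale H c a], m)) (fscale c (gen (hs[i := a], m)))"
      by (simp add: eqv_def free.span_base)
  qed
next
  fix hs :: "'h list" and x y assume "length hs = n"
  then have "gen (hs, x + y) - gen (hs, x) - gen (hs, y) \<in> Prel H M n"
    unfolding Prel_def by blast
  then show "eqv (Prel H M n) (gen (hs, x + y)) (gen (hs, x) + gen (hs, y))"
    by (simp add: eqv_def diff_diff_eq free.span_base)
next
  fix hs :: "'h list" and c x assume "length hs = n"
  then have "gen (hs, mscale H M c x) - fscale c (gen (hs, x)) \<in> Prel H M n"
    unfolding Prel_def by blast
  then show "eqv (Prel H M n) (gen (hs, mscale H M c x)) (fscale c (gen (hs, x)))"
    by (simp add: eqv_def free.span_base)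
next
  fix hs :: "'h list" and h m assume "length hs = n"
  then have "lin (\<lambda>ds. gen (map2 (*) hs ds, m)) (coprod H (n - 1) h) - gen (hs, act M h m) \<in> Prel H M n"
    unfolding Prel_def by blast
  then show "eqv (Prel H M n) (lin (\<lambda>ds. gen (map2 (*) hs ds, m)) (coprod H (n - 1) h)) (gen (hs, act M h m))"
    by (simp add: eqv_def free.span_base)
qed

lemma multilin_gen_pair: "multilin (hscale H) n (Prel H M n) (\<lambda>hs. gen (hs, m))"
  using balanced_gen by (rule balancedD)

lemma multilin_mult_right:
  assumes "multilin (hscale H) n R F" "length hs = n"
  shows "multilin (hscale H) n R (\<lambda>ds. F (map2 (*) hs ds))"
proof -
  have "multilin (hscale H) n R (\<lambda>ds. F (map2 (\<lambda>i. (*) (hs ! i)) [0..<n] ds))"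
    by (rule multilin_map[OF assms(1)]) (simp_all add: algebra_simps hscale_mult_right)
  then show ?thesis
    by (rule multilin_cong, subst map2_conv_upt(1)[OF assms(2)]) auto
qed

lemma multilin_mult_left:
  assumes "multilin (hscale H) n R F" "length hs = n"
  shows "multilin (hscale H) n R (\<lambda>ds. F (map2 (*) ds hs))"
proof -
  have "multilin (hscale H) n R (\<lambda>ds. F (map2 (\<lambda>i x. x * (hs ! i)) [0..<n] ds))"
    by (rule multilin_map[OF assms(1)]) (simp_all add: algebra_simps hscale_mult_left)
  then show ?thesis
    by (rule multilin_cong, subst map2_conv_upt(2)[OF _ assms(2)]) auto
qed

lemma Prel_keys:
  assumes "r \<in> Prel H M n"
  shows "Poly_Mapping.keys r \<subseteq> {(hs, m). length hs = n}"
\<comment> \<open>For \<open>n = 0\<close> the truncated subtraction leaves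
  \<open>coprod H 0\<close>, whose lists have length 1, but \<open>map2\<close> cuts them down to
  the empty list \<open>hs\<close>.\<close>
proof (cases "n = 0")
  case True
  then show ?thesis using assms unfolding Prel_def
    by (auto dest!: keys_diff_subset[THEN subsetD] keys_fscale[THEN subsetD] elim!: keys_linE)
next
  case False
  then show ?thesis using assms unfolding Prel_def
    by (auto dest!: keys_diff_subset[THEN subsetD] keys_fscale[THEN subsetD] keys_coprod elim!: keys_linE)
qed

lemma eqv_Prel_keys:
  assumes "eqv (Prel H M n) f g" "\<And>hs m. (hs, m) \<in> Poly_Mapping.keys g \<Longrightarrow> length hs = n"
    and "(hs, m) \<in> Poly_Mapping.keys f"
  shows "length hs = n"
proof -
  have "Poly_Mapping.keys f \<subseteq> {(hs, m). length hs = n}"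
    by (rule eqv_keys[OF assms(1)]) (auto dest: assms(2) Prel_keys[THEN subsetD])
  then show ?thesis using assms(3) by auto
qed

lemma Ptens_rep:
  assumes "t \<in> Ptens H M n"
  shows "t = cls (Prel H M n) (rep t)"
    and "(hs, m) \<in> Poly_Mapping.keys (rep t) \<Longrightarrow> length hs = n"
proof -
  obtain f where f: "t = cls (Prel H M n) f" "\<And>hs m. (hs, m) \<in> Poly_Mapping.keys f \<Longrightarrow> length hs = n"
    using assms unfolding Ptens_def by auto
  show "t = cls (Prel H M n) (rep t)" using f by simp
  show "length hs = n" if "(hs, m) \<in> Poly_Mapping.keys (rep t)"
    using rep_cls f(2) that[unfolded f(1)] by (rule eqv_Prel_keys)
qed

section \<open>Polylinear maps\<close>

lemma multilin_act:
  assumes "multilin (mscale H M) n R F" "length hs = n"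
  shows "multilin (mscale H M) n R (\<lambda>xs. F (map2 (act M) hs xs))"
proof -
  have "multilin (mscale H M) n R (\<lambda>xs. F (map2 (\<lambda>i. act M (hs ! i)) [0..<n] xs))"
    by (rule multilin_map[OF assms(1)]) (simp_all add: act_add act_mscale)
  then show ?thesis
    by (rule multilin_cong, subst map2_conv_upt(1)[OF assms(2)]) auto
qed

lemma multilin_act_left:
  assumes "multilin (mscale H M) n R F" "length xs = n"
  shows "multilin (hscale H) n R (\<lambda>hs. F (map2 (act M) hs xs))"
proof -
  have "multilin (hscale H) n R (\<lambda>hs. F (map2 (\<lambda>i h. act M h (xs ! i)) [0..<n] hs))"
    by (rule multilin_map[OF assms(1)]) (simp_all add: act_add_left act_hscale)
  then show ?thesis
    by (rule multilin_cong, subst map2_conv_upt(2)[OF _ assms(2)]) auto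
qed

context
  fixes \<phi> p n
  assumes \<phi>: "\<phi> \<in> polyHom H M p n"
begin

lemma polyHom_Ptens: "t \<in> Mpow H M n \<Longrightarrow> \<phi> t \<in> Ptens H M n"
  using \<phi> unfolding polyHom_def mem_Collect_eq by (elim conjE) (rule PiE_mem)

lemma polyHom_addD: "s \<in> Mpow H M n \<Longrightarrow> t \<in> Mpow H M n \<Longrightarrow>
    \<phi> (cls (Mrel H M n) (rep s + rep t)) = cls (Prel H M n) (rep (\<phi> s) + rep (\<phi> t))"
  using \<phi> by (simp add: polyHom_def)

lemma polyHom_actD: "a \<in> tensor_power (hscale H) n \<Longrightarrow> t \<in> Mpow H M n \<Longrightarrow>
    \<phi> (cls (Mrel H M n) (bilin (\<lambda>hs xs. gen (map2 (act M) hs xs)) (rep a) (rep t))) =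
    cls (Prel H M n) (bilin (\<lambda>hs (gs, m). gen (map2 (*) hs gs, m)) (rep a) (rep (\<phi> t)))"
  using \<phi> by (simp add: polyHom_def)

lemma polyHom_gradeD: "t \<in> Mpow_grade H M n d \<Longrightarrow> \<phi> t \<in> Ptens_grade H M n (d + p)"
  using \<phi> by (simp add: polyHom_def)

lemma polyHom_add:
  assumes "\<And>xs. xs \<in> Poly_Mapping.keys f \<Longrightarrow> length xs = n"
    and "\<And>xs. xs \<in> Poly_Mapping.keys g \<Longrightarrow> length xs = n"
  shows "\<phi> (cls (Mrel H M n) (f + g))
    = cls (Prel H M n) (rep (\<phi> (cls (Mrel H M n) f)) + rep (\<phi> (cls (Mrel H M n) g)))"
proof -
  let ?s = "cls (Mrel H M n) f" and ?t = "cls (Mrel H M n) g"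
  have "?s \<in> Mpow H M n" "?t \<in> Mpow H M n" using assms by (auto intro: tensor_powerI)
  then have "\<phi> (cls (Mrel H M n) (rep ?s + rep ?t)) = cls (Prel H M n) (rep (\<phi> ?s) + rep (\<phi> ?t))"
    by (rule polyHom_addD)
  moreover have "cls (Mrel H M n) (rep ?s + rep ?t) = cls (Mrel H M n) (f + g)"
    by (intro cls_eqI eqv_add rep_cls)
  ultimately show ?thesis by simp
qed

text \<open>\<open>polyHom\<close> demands linearity only for the representatives chosen by
  \<open>rep\<close>. Both actions respect the relations in either argument, which frees the
  identity from that choice.\<close>

lemma polyHom_act:
  assumes a: "\<And>xs. xs \<in> Poly_Mapping.keys a \<Longrightarrow> length xs = n"
    and f: "\<And>xs. xs \<in> Poly_Mapping.keys f \<Longrightarrow> length xs = n"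
  shows "\<phi> (cls (Mrel H M n) (bilin (\<lambda>hs xs. gen (map2 (act M) hs xs)) a f))
    = cls (Prel H M n) (bilin (\<lambda>hs (gs, m). gen (map2 (*) hs gs, m)) a (rep (\<phi> (cls (Mrel H M n) f))))"
proof -
  let ?a = "cls (Hrel H n) a" and ?t = "cls (Mrel H M n) f"
  have a': "?a \<in> tensor_power (hscale H) n" and t: "?t \<in> Mpow H M n"
    using assms by (auto intro: tensor_powerI)
  have "\<phi> (cls (Mrel H M n) (bilin (\<lambda>hs xs. gen (map2 (act M) hs xs)) (rep ?a) (rep ?t)))
      = cls (Prel H M n) (bilin (\<lambda>hs (gs, m). gen (map2 (*) hs gs, m)) (rep ?a) (rep (\<phi> ?t)))"
    using a' t by (rule polyHom_actD)
  moreover have "eqv (Mrel H M n) (bilin (\<lambda>hs xs. gen (map2 (act M) hs xs)) (rep ?a) (rep ?t))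
      (bilin (\<lambda>hs xs. gen (map2 (act M) hs xs)) a f)"
  proof -
    have "eqv (Mrel H M n) (bilin (\<lambda>hs xs. gen (map2 (act M) hs xs)) (rep ?a) (rep ?t))
      (bilin (\<lambda>hs xs. gen (map2 (act M) hs xs)) (rep ?a) f)"
      unfolding bilin_def using a'
      by (intro eqv_lin multilin_eqv[OF _ rep_cls] multilin_act multilin_gen) (auto elim: tensor_powerE)
    also have "eqv (Mrel H M n) \<dots> (bilin (\<lambda>hs xs. gen (map2 (act M) hs xs)) a f)"
      unfolding bilin_def
      by (intro multilin_eqv[OF _ rep_cls] multilin_lin_fun multilin_act_left multilin_gen f)
    finally show ?thesis .
  qed
  moreover have "eqv (Prel H M n) (bilin (\<lambda>hs (gs, m). gen (map2 (*) hs gs, m)) (rep ?a) (rep (\<phi> ?t)))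
      (bilin (\<lambda>hs (gs, m). gen (map2 (*) hs gs, m)) a (rep (\<phi> ?t)))"
    unfolding bilin_def
  proof (intro multilin_eqv[OF _ rep_cls] multilin_lin_fun)
    fix y assume "y \<in> Poly_Mapping.keys (rep (\<phi> ?t))"
    then show "multilin (hscale H) n (Prel H M n) (\<lambda>hs. case y of (gs, m) \<Rightarrow> gen (map2 (*) hs gs, m))"
      using Ptens_rep(2)[OF polyHom_Ptens[OF t]]
      by (cases y) (auto intro!: multilin_mult_left multilin_gen_pair)
  qed
  ultimately show ?thesis by (simp flip: cls_eq_iff)
qed

text \<open>Homogeneity over the base field comes from linearity over the tensor power of
  \<open>H\<close>, applied to the scalar multiple \<open>?a\<close> of the tensor with all factors
  1.\<close>

lemma polyHom_fscale:
  assumes f: "\<And>xs. xs \<in> Poly_Mapping.keys f \<Longrightarrow> length xs = n"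
  shows "\<phi> (cls (Mrel H M n) (fscale c f)) = cls (Prel H M n) (fscale c (rep (\<phi> (cls (Mrel H M n) f))))"
proof -
  let ?t = "cls (Mrel H M n) f"
  let ?a = "fscale c (gen (replicate n (1::'h))) :: 'h list \<Rightarrow>\<^sub>0 'k"
  have "bilin (\<lambda>hs xs. gen (map2 (act M) hs xs)) ?a f
      = fscale c (lin (\<lambda>xs. gen (map2 (act M) (replicate n 1) xs)) f)"
    by (simp add: bilin_def lin_fscale)
  also have "lin (\<lambda>xs. gen (map2 (act M) (replicate n 1) xs)) f = f"
    by (rule lin_id) (auto dest!: f intro!: arg_cong[of _ _ gen] nth_equalityI)
  finally have 1: "bilin (\<lambda>hs xs. gen (map2 (act M) hs xs)) ?a f = fscale c f" .
  have "bilin (\<lambda>hs (gs, m). gen (map2 (*) hs gs, m)) ?a (rep (\<phi> ?t))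
      = fscale c (lin (\<lambda>(gs, m). gen (map2 (*) (replicate n 1) gs, m)) (rep (\<phi> ?t)))"
    by (simp add: bilin_def lin_fscale)
  also have "lin (\<lambda>(gs, m). gen (map2 (*) (replicate n 1) gs, m)) (rep (\<phi> ?t)) = rep (\<phi> ?t)"
  proof (rule lin_id)
    fix y assume "y \<in> Poly_Mapping.keys (rep (\<phi> ?t))"
    moreover have "?t \<in> Mpow H M n" using f by (rule tensor_powerI)
    ultimately show "(case y of (gs, m) \<Rightarrow> gen (map2 (*) (replicate n 1) gs, m)) = (gen y :: _ \<Rightarrow>\<^sub>0 'k)"
      using Ptens_rep(2)[OF polyHom_Ptens, of ?t]
      by (cases y) (auto intro!: arg_cong[of _ _ gen] nth_equalityI)
  qed
  finally have 2: "bilin (\<lambda>hs (gs, m). gen (map2 (*) hs gs, m)) ?a (rep (\<phi> ?t)) = fscale c (rep (\<phi> ?t))" .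
  have "length xs = n" if "xs \<in> Poly_Mapping.keys ?a" for xs
    using subsetD[OF keys_fscale that] by simp
  then have "\<phi> (cls (Mrel H M n) (bilin (\<lambda>hs xs. gen (map2 (act M) hs xs)) ?a f))
    = cls (Prel H M n) (bilin (\<lambda>hs (gs, m). gen (map2 (*) hs gs, m)) ?a (rep (\<phi> ?t)))"
    using f by (rule polyHom_act)
  then show ?thesis unfolding 1 2 .
qed

lemma polyHom_eqv:
  assumes "eqv (Mrel H M n) f g"
  shows "eqv (Prel H M n) (rep (\<phi> (cls (Mrel H M n) f))) (rep (\<phi> (cls (Mrel H M n) g)))"
  using assms by (simp flip: cls_eq_iff)

lemma polyHom_lin:
  assumes f: "\<And>xs. xs \<in> Poly_Mapping.keys f \<Longrightarrow> length xs = n"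
  shows "eqv (Prel H M n) (rep (\<phi> (cls (Mrel H M n) f))) (lin (\<lambda>xs. rep (\<phi> (pure H M xs))) f)"
proof -
  let ?L = "lin (\<lambda>xs. rep (\<phi> (pure H M xs)))"
  \<comment> \<open>Induction runs over subsets of the support of \<open>f\<close>, so every partial
    sum consists of lists of length \<open>n\<close>, as additivity of \<open>\<phi>\<close>
    requires.\<close>
  define sub where "sub I = (\<Sum>xs\<in>I. fscale (Poly_Mapping.lookup f xs) (gen xs))" for I
  have keys: "length xs = n" if "I \<subseteq> Poly_Mapping.keys f" "xs \<in> Poly_Mapping.keys (sub I)" for I xs
    using that f keys_sum_subset[of "\<lambda>xs. fscale (Poly_Mapping.lookup f xs) (gen xs)" I]
      keys_fscale[of "Poly_Mapping.lookup f _" "gen _"]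
    unfolding sub_def by fastforce
  have "eqv (Prel H M n) (rep (\<phi> (cls (Mrel H M n) (sub I)))) (?L (sub I))"
    if "finite I" "I \<subseteq> Poly_Mapping.keys f" for I
    using that
  proof (induction I rule: finite_induct)
    case empty
    \<comment> \<open>That \<open>\<phi>\<close> maps zero to zero is homogeneity with the scalar
      0.\<close>
    have "\<phi> (cls (Mrel H M n) (fscale 0 0)) = cls (Prel H M n) (fscale 0 (rep (\<phi> (cls (Mrel H M n) 0))))"
      by (intro polyHom_fscale) simp
    then show ?case using rep_cls[of "Prel H M n" 0] by (simp add: sub_def)
  next
    case (insert x I)
    let ?g = "fscale (Poly_Mapping.lookup f x) (gen x) :: 'm list \<Rightarrow>\<^sub>0 'k"
    have x: "length x = n" using insert f by auto
    have g: "length xs = n" if "xs \<in> Poly_Mapping.keys ?g" for xs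
      using subsetD[OF keys_fscale that] x by simp
    have "\<phi> (cls (Mrel H M n) (sub (insert x I)))
      = cls (Prel H M n) (rep (\<phi> (cls (Mrel H M n) ?g)) + rep (\<phi> (cls (Mrel H M n) (sub I))))"
      using insert keys g by (subst polyHom_add[symmetric]) (auto simp: sub_def)
    then have "eqv (Prel H M n) (rep (\<phi> (cls (Mrel H M n) (sub (insert x I)))))
       (rep (\<phi> (cls (Mrel H M n) ?g)) + rep (\<phi> (cls (Mrel H M n) (sub I))))"
      using rep_cls by simp
    also have "eqv (Prel H M n) \<dots> (?L ?g + ?L (sub I))"
    proof (rule eqv_add)
      have "\<phi> (cls (Mrel H M n) ?g) = cls (Prel H M n) (?L ?g)"
        using x by (subst polyHom_fscale) (simp_all add: lin_fscale pure_def)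
      then show "eqv (Prel H M n) (rep (\<phi> (cls (Mrel H M n) ?g))) (?L ?g)"
        by (simp only: rep_cls)
      show "eqv (Prel H M n) (rep (\<phi> (cls (Mrel H M n) (sub I)))) (?L (sub I))"
        using insert by simp
    qed
    also have "\<dots> = ?L (sub (insert x I))"
      using insert by (simp add: sub_def lin_add)
    finally show ?case .
  qed
  moreover have "sub (Poly_Mapping.keys f) = f"
    using lin_gen_ident[of f] by (simp add: lin_ext_def sub_def)
  ultimately show ?thesis by (metis finite_keys order_refl)
qed

lemma multilin_polyHom: "multilin (mscale H M) n (Prel H M n) (\<lambda>xs. rep (\<phi> (pure H M xs)))"
proof (rule multilinI)
  fix xs :: "'m list" and i x y assume *: "length xs = n" "i < n"
  have "eqv (Prel H M n) (rep (\<phi> (cls (Mrel H M n) (gen (xs[i := x + y])))))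
     (rep (\<phi> (cls (Mrel H M n) (gen (xs[i := x]) + gen (xs[i := y])))))"
    using * Poly_Mapping.keys_add[of "gen (xs[i := x])" "gen (xs[i := y])"]
    by (intro polyHom_eqv multilin_addD[OF multilin_gen]) auto
  also have "eqv (Prel H M n) \<dots> (lin (\<lambda>xs. rep (\<phi> (pure H M xs))) (gen (xs[i := x]) + gen (xs[i := y])))"
    using * Poly_Mapping.keys_add[of "gen (xs[i := x])" "gen (xs[i := y])"]
    by (intro polyHom_lin) auto
  finally show "eqv (Prel H M n) (rep (\<phi> (pure H M (xs[i := x + y]))))
     (rep (\<phi> (pure H M (xs[i := x]))) + rep (\<phi> (pure H M (xs[i := y]))))"
    using * by (simp add: lin_add pure_def)
next
  fix xs :: "'m list" and i c x assume *: "length xs = n" "i < n"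
  have "eqv (Prel H M n) (rep (\<phi> (cls (Mrel H M n) (gen (xs[i := mscale H M c x])))))
     (rep (\<phi> (cls (Mrel H M n) (fscale c (gen (xs[i := x]))))))"
    using * keys_fscale[of c "gen (xs[i := x])"]
    by (intro polyHom_eqv multilin_scaleD[OF multilin_gen]) auto
  also have "eqv (Prel H M n) \<dots> (lin (\<lambda>xs. rep (\<phi> (pure H M xs))) (fscale c (gen (xs[i := x]))))"
    using * keys_fscale[of c "gen (xs[i := x])"] by (intro polyHom_lin) auto
  finally show "eqv (Prel H M n) (rep (\<phi> (pure H M (xs[i := mscale H M c x]))))
     (fscale c (rep (\<phi> (pure H M (xs[i := x])))))"
    using * by (simp add: lin_fscale pure_def)
qed

lemma polyHom_pure_act:
  assumes "length hs = n" "length xs = n"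
  shows "eqv (Prel H M n) (rep (\<phi> (pure H M (map2 (act M) hs xs))))
    (lin (\<lambda>(gs, m). gen (map2 (*) hs gs, m)) (rep (\<phi> (pure H M xs))))"
  using polyHom_act[of "gen hs" "gen xs"] assms rep_cls
  by (simp add: pure_def bilin_def)

lemma polyHom_pure:
  assumes "length xs = n"
  shows "\<phi> (pure H M xs) = cls (Prel H M n) (rep (\<phi> (pure H M xs)))"
    and "(hs, m) \<in> Poly_Mapping.keys (rep (\<phi> (pure H M xs))) \<Longrightarrow> length hs = n"
proof -
  have "pure H M xs \<in> Mpow H M n" using assms by (auto simp: pure_def intro: tensor_powerI)
  then show "\<phi> (pure H M xs) = cls (Prel H M n) (rep (\<phi> (pure H M xs)))"
    and "(hs, m) \<in> Poly_Mapping.keys (rep (\<phi> (pure H M xs))) \<Longrightarrow> length hs = n"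
    using Ptens_rep[OF polyHom_Ptens] by auto
qed

text \<open>The element chosen by \<open>rep\<close> need not be supported in one degree. Membership
  in \<open>Ptens_grade\<close> only provides some congruent \<open>f\<close> that is, and degree
  arguments have to pass through it.\<close>

lemma polyHom_homogeneous:
  assumes "length xs = n" "homogeneous M xs ds"
  obtains f where "eqv (Prel H M n) (rep (\<phi> (pure H M xs))) f"
    "\<And>hs m. (hs, m) \<in> Poly_Mapping.keys f \<Longrightarrow> length hs = n \<and> m \<in> grade M (sum_list ds + p)"
proof -
  have "pure H M xs \<in> Mpow_grade H M n (sum_list ds)"
    unfolding Mpow_grade_def pure_def using assms by (auto intro!: exI[of _ "gen xs"])
  then have "\<phi> (pure H M xs) \<in> Ptens_grade H M n (sum_list ds + p)"
    by (rule polyHom_gradeD)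
  then obtain f where f: "\<phi> (pure H M xs) = cls (Prel H M n) f"
    "\<forall>(hs, m)\<in>Poly_Mapping.keys f. length hs = n \<and> m \<in> grade M (sum_list ds + p)"
    unfolding Ptens_grade_def by auto
  show ?thesis
    by (rule that[of f]) (use f rep_cls in \<open>auto\<close>)
qed

end

end

section \<open>Composition of polylinear maps\<close>

context pseudo_module
begin

text \<open>The contribution of one pair of terms to the composition formula: the coproduct of the
  first factor of \<open>fs\<close> spreads over the \<open>l\<close> inner slots, and the remaining
  factors are appended. Currying allows linearity in \<open>hs\<close> and balancedness in
  \<open>(fs, e)\<close> to be treated separately.\<close>

definition graft :: "nat \<Rightarrow> 'h list \<Rightarrow> 'h list \<times> 'm \<Rightarrow> ('h list \<times> 'm \<Rightarrow>\<^sub>0 'k)" where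
  "graft l hs = (\<lambda>(fs, e). lin (\<lambda>ds. gen (map2 (*) hs ds @ tl fs, e)) (coprod H (l - 1) (hd fs)))"

lemma graft_Pair [simp]:
  "graft l hs (fs, e) = lin (\<lambda>ds. gen (map2 (*) hs ds @ tl fs, e)) (coprod H (l - 1) (hd fs))"
  by (simp add: graft_def)

lemma multilin_graft_head:
  assumes "length hs = l" "length t = m"
  shows "multilin (hscale H) l (Prel H M (l + m)) (\<lambda>ds. gen (map2 (*) hs ds @ t, e))"
proof -
  have "multilin (hscale H) l (Prel H M (l + m)) (\<lambda>ds. gen ([] @ ds @ t, e))"
    using assms by (intro multilin_append) (simp add: multilin_gen_pair)
  then show ?thesis
    using multilin_mult_right[of l "Prel H M (l + m)" "\<lambda>ds. gen (ds @ t, e)" hs] assms by simp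
qed

text \<open>Moving \<open>h\<close> across the tensor sign multiplies the head of \<open>fs\<close>
  by the first factor of the coproduct of \<open>h\<close>, and \<open>graft\<close> then expands
  this product. Multiplicativity of the iterated coproduct separates the two expansions.\<close>

lemma graft_balanced:
  assumes hs: "length hs = Suc l"
  shows "balanced (Suc m) (Prel H M (Suc l + m)) (graft (Suc l) hs)"
proof (rule balancedI)
  let ?R = "Prel H M (Suc l + m)"
  have head: "eqv ?R (lin (\<lambda>ds. gen (map2 (*) hs ds @ t, e)) f) (lin (\<lambda>ds. gen (map2 (*) hs ds @ t, e)) g)"
    if "length t = m" "eqv (Hrel H (Suc l)) f g" for t e f g
    using that hs by (intro multilin_eqv[OF multilin_graft_head]) auto
  fix e
  show "multilin (hscale H) (Suc m) ?R (\<lambda>fs. graft (Suc l) hs (fs, e))"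
  proof (rule multilin_ConsI)
    fix t :: "'h list" and x y c assume t: "length t = m"
    show "eqv ?R (graft (Suc l) hs ((x + y) # t, e)) (graft (Suc l) hs (x # t, e) + graft (Suc l) hs (y # t, e))"
      using head[OF t coprod_add[of l x y]] by (simp add: lin_add)
    show "eqv ?R (graft (Suc l) hs (hscale H c x # t, e)) (fscale c (graft (Suc l) hs (x # t, e)))"
      using head[OF t coprod_hscale[of l c x]] by (simp add: lin_fscale)
  next
    fix h
    have "multilin (hscale H) m ?R (\<lambda>t. gen (map2 (*) hs ds @ t, e))"
      if "ds \<in> Poly_Mapping.keys (coprod H l h)" for ds
      using multilin_append[where as = "map2 (*) hs ds" and bs = "[]" and n = m and F = "\<lambda>hs. gen (hs, e)"]
        hs keys_coprod[OF that] multilin_gen_pair[of "Suc l + m" e] by simp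
    then show "multilin (hscale H) m ?R (\<lambda>t. graft (Suc l) hs (h # t, e))"
      by (simp add: multilin_lin_fun)
  qed
next
  let ?R = "Prel H M (Suc l + m)"
  fix fs :: "'h list" and x y c assume fs: "length fs = Suc m"
  have len: "length (map2 (*) hs ds @ tl fs) = Suc l + m" if "ds \<in> Poly_Mapping.keys (coprod H l (hd fs))" for ds
    using keys_coprod[OF that] hs fs by simp
  show "eqv ?R (graft (Suc l) hs (fs, x + y)) (graft (Suc l) hs (fs, x) + graft (Suc l) hs (fs, y))"
    unfolding graft_Pair lin_fun_add[symmetric]
    using len by (intro eqv_lin balancedD(2)[OF balanced_gen]) simp
  show "eqv ?R (graft (Suc l) hs (fs, mscale H M c x)) (fscale c (graft (Suc l) hs (fs, x)))"
    unfolding graft_Pair lin_fun_fscale[symmetric]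
    using len by (intro eqv_lin balancedD(3)[OF balanced_gen]) simp
next
  let ?R = "Prel H M (Suc l + m)"
  fix fs :: "'h list" and h e assume fs: "length fs = Suc m"
  then obtain f ft where f: "fs = f # ft" "length ft = m" by (cases fs) auto
  let ?c = "coprod H m h"
  have "eqv ?R (lin (\<lambda>ds. graft (Suc l) hs (map2 (*) fs ds, e)) ?c)
    (lin (\<lambda>ds. lin (\<lambda>u. lin (\<lambda>v. gen (map2 (*) (map2 (*) hs u @ ft) (v @ tl ds), e))
       (coprod H l (hd ds))) (coprod H l f)) ?c)"
  proof (rule eqv_lin)
    fix ds assume "ds \<in> Poly_Mapping.keys ?c"
    then have "length ds = Suc m" by (rule keys_coprod)
    then obtain d dt where d: "ds = d # dt" "length dt = m" by (cases ds) auto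
    have "graft (Suc l) hs (map2 (*) fs ds, e)
      = lin (\<lambda>ds. gen (map2 (*) hs ds @ map2 (*) ft dt, e)) (coprod H l (f * d))"
      by (simp add: f d)
    also have "eqv ?R \<dots> (lin (\<lambda>ds. gen (map2 (*) hs ds @ map2 (*) ft dt, e))
        (lin (\<lambda>as. lin (\<lambda>bs. gen (map2 (*) as bs)) (coprod H l d)) (coprod H l f)))"
      using hs f d by (intro multilin_eqv[OF multilin_graft_head coprod_mult]) auto
    also have "\<dots> = lin (\<lambda>u. lin (\<lambda>v. gen (map2 (*) (map2 (*) hs u @ ft) (v @ tl ds), e))
       (coprod H l (hd ds))) (coprod H l f)"
      unfolding lin_lin lin_gen d list.sel
      using hs by (intro lin_cong) (simp add: map2_mult_assoc keys_coprod)
    finally show "eqv ?R (graft (Suc l) hs (map2 (*) fs ds, e))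
      (lin (\<lambda>u. lin (\<lambda>v. gen (map2 (*) (map2 (*) hs u @ ft) (v @ tl ds), e))
       (coprod H l (hd ds))) (coprod H l f))" .
  qed
  \<comment> \<open>All expansions of \<open>h\<close> are collected into one iterated coproduct
    with \<open>m + l + 1\<close> factors, one for each slot of the composite. The relation over
    \<open>H\<close> then moves \<open>h\<close> onto \<open>e\<close>.\<close>
  also have "\<dots> = lin (\<lambda>u. lin (\<lambda>w. gen (map2 (*) (map2 (*) hs u @ ft) w, e)) (coprod H (m + l) h)) (coprod H l f)"
    by (subst lin_swap) (simp add: lin_lin flip: coprod_first_factor)
  also have "eqv ?R \<dots> (lin (\<lambda>u. gen (map2 (*) hs u @ ft, act M h e)) (coprod H l f))"
    using hs f balancedD(4)[OF balanced_gen, of _ "Suc l + m" e h]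
    by (intro eqv_lin) (simp add: keys_coprod add.commute)
  finally show "eqv ?R (lin (\<lambda>ds. graft (Suc l) hs (map2 (*) fs ds, e)) (coprod H (Suc m - 1) h))
      (graft (Suc l) hs (fs, act M h e))"
    by (simp add: f)
qed

lemma multilin_graft:
  assumes "length fs = Suc m"
  shows "multilin (hscale H) (Suc l) (Prel H M (Suc l + m)) (\<lambda>hs. graft (Suc l) hs (fs, e))"
  unfolding graft_Pair
proof (rule multilin_lin_fun)
  fix ds assume "ds \<in> Poly_Mapping.keys (coprod H (Suc l - 1) (hd fs))"
  then have ds: "length ds = Suc l" using keys_coprod by fastforce
  have "multilin (hscale H) (Suc l) (Prel H M (Suc l + m)) (\<lambda>hs. gen ([] @ hs @ tl fs, e))"
    using assms by (intro multilin_append) (simp add: multilin_gen_pair)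
  then show "multilin (hscale H) (Suc l) (Prel H M (Suc l + m)) (\<lambda>hs. gen (map2 (*) hs ds @ tl fs, e))"
    using multilin_mult_left[of "Suc l" "Prel H M (Suc l + m)" "\<lambda>hs. gen (hs @ tl fs, e)" ds] ds by simp
qed

text \<open>Independence of the representative of the inner value. If \<open>h\<close> acts on
  \<open>e\<close>, linearity of \<open>\<phi>\<close> brings it out as left multiplication of the
  first factor, and \<open>coprod_mult\<close> turns it into right multiplication of
  \<open>hs\<close> by the iterated coproduct of \<open>h\<close>.\<close>

lemma compose_balanced:
  assumes \<phi>: "\<phi> \<in> polyHom H M p (Suc m)" and xs: "length xs = m"
  shows "balanced (Suc l) (Prel H M (Suc l + m))
    (\<lambda>(hs, e). lin (graft (Suc l) hs) (rep (\<phi> (pure H M (e # xs)))))"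
proof (rule balancedI; simp only: prod.case)
  let ?R = "Prel H M (Suc l + m)" and ?E = "\<lambda>e. rep (\<phi> (pure H M (e # xs)))"
  have keys: "length fs = Suc m" if "(fs, e') \<in> Poly_Mapping.keys (?E e)" for fs e e'
    using polyHom_pure(2)[OF \<phi> _ that] xs by simp
  fix e
  show "multilin (hscale H) (Suc l) ?R (\<lambda>hs. lin (graft (Suc l) hs) (?E e))"
  proof (rule multilin_lin_fun)
    fix y assume "y \<in> Poly_Mapping.keys (?E e)"
    then show "multilin (hscale H) (Suc l) ?R (\<lambda>hs. graft (Suc l) hs y)"
      using multilin_graft[OF keys] by (cases y) blast
  qed
next
  let ?R = "Prel H M (Suc l + m)" and ?E = "\<lambda>e. rep (\<phi> (pure H M (e # xs)))"
  fix hs :: "'h list" and x y c assume hs: "length hs = Suc l"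
  have "eqv (Prel H M (Suc m)) (?E (x + y)) (?E x + ?E y)"
    using multilin_addD[OF multilin_polyHom[OF \<phi>], of "0 # xs" 0 x y] xs by simp
  then show "eqv ?R (lin (graft (Suc l) hs) (?E (x + y))) (lin (graft (Suc l) hs) (?E x) + lin (graft (Suc l) hs) (?E y))"
    using balanced_eqv[OF graft_balanced[OF hs]] by (simp flip: lin_add)
  have "eqv (Prel H M (Suc m)) (?E (mscale H M c x)) (fscale c (?E x))"
    using multilin_scaleD[OF multilin_polyHom[OF \<phi>], of "0 # xs" 0 c x] xs by simp
  then show "eqv ?R (lin (graft (Suc l) hs) (?E (mscale H M c x))) (fscale c (lin (graft (Suc l) hs) (?E x)))"
    using balanced_eqv[OF graft_balanced[OF hs]] by (simp flip: lin_fscale)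
next
  let ?R = "Prel H M (Suc l + m)" and ?E = "\<lambda>e. rep (\<phi> (pure H M (e # xs)))"
  fix hs :: "'h list" and h :: 'h and e assume hs: "length hs = Suc l"
  \<comment> \<open>Units in the other slots make the tensor act by \<open>h\<close> on the first
    argument alone.\<close>
  let ?hs = "h # replicate m 1"
  have "map2 (act M) ?hs (e # xs) = act M h e # xs"
    using xs by (auto intro!: nth_equalityI)
  then have "eqv (Prel H M (Suc m)) (?E (act M h e)) (lin (\<lambda>(gs, m). gen (map2 (*) ?hs gs, m)) (?E e))"
    using polyHom_pure_act[OF \<phi>, of ?hs "e # xs"] xs by simp
  then have "eqv ?R (lin (graft (Suc l) hs) (?E (act M h e)))
      (lin (graft (Suc l) hs) (lin (\<lambda>(gs, m). gen (map2 (*) ?hs gs, m)) (?E e)))"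
    by (rule balanced_eqv[OF graft_balanced[OF hs]])
  also have "\<dots> = lin (\<lambda>(gs, e'). graft (Suc l) hs (map2 (*) ?hs gs, e')) (?E e)"
    unfolding lin_lin by (rule lin_cong) (auto simp only: split: prod.splits intro: lin_gen)
  also have "eqv ?R \<dots> (lin (\<lambda>y. lin (\<lambda>ds. graft (Suc l) (map2 (*) hs ds) y) (coprod H l h)) (?E e))"
  proof (rule eqv_lin)
    fix y assume y: "y \<in> Poly_Mapping.keys (?E e)"
    obtain gs e' where y': "y = (gs, e')" by (cases y)
    then have "length gs = Suc m" using polyHom_pure(2)[OF \<phi>, of "e # xs" gs e'] xs y by simp
    then obtain g gt where g: "gs = g # gt" "length gt = m" by (cases gs) auto
    have "map2 (*) (replicate m 1) gt = gt" using g by (auto intro!: nth_equalityI)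
    then have "graft (Suc l) hs (map2 (*) ?hs gs, e')
        = lin (\<lambda>ds. gen (map2 (*) hs ds @ gt, e')) (coprod H l (h * g))"
      by (simp add: g)
    also have "eqv ?R \<dots> (lin (\<lambda>ds. gen (map2 (*) hs ds @ gt, e'))
        (lin (\<lambda>as. lin (\<lambda>bs. gen (map2 (*) as bs)) (coprod H l g)) (coprod H l h)))"
      using hs g by (intro multilin_eqv[OF multilin_graft_head coprod_mult]) auto
    also have "\<dots> = lin (\<lambda>ds. graft (Suc l) (map2 (*) hs ds) y) (coprod H l h)"
      by (simp add: lin_lin y' g map2_mult_assoc)
    finally show "eqv ?R (case y of (gs, e') \<Rightarrow> graft (Suc l) hs (map2 (*) ?hs gs, e'))
        (lin (\<lambda>ds. graft (Suc l) (map2 (*) hs ds) y) (coprod H l h))"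
      by (simp add: y')
  qed
  also have "\<dots> = lin (\<lambda>ds. lin (graft (Suc l) (map2 (*) hs ds)) (?E e)) (coprod H l h)"
    by (rule lin_swap)
  finally show "eqv ?R (lin (\<lambda>ds. lin (graft (Suc l) (map2 (*) hs ds)) (?E e)) (coprod H (Suc l - 1) h))
      (lin (graft (Suc l) hs) (?E (act M h e)))"
    by (auto intro: eqv_sym)
qed

definition compose_rep :: "('k, 'h, 'm) pmap \<Rightarrow> ('k, 'h, 'm) pmap \<Rightarrow> 'm list \<Rightarrow> 'm list \<Rightarrow> ('h list \<times> 'm \<Rightarrow>\<^sub>0 'k)" where
  "compose_rep \<phi> \<psi> ys xs = lin (\<lambda>(hs, e). lin (graft (length ys) hs) (rep (\<phi> (pure H M (e # xs)))))
     (rep (\<psi> (pure H M ys)))"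

lemma pcompose_eq: "pcompose H M \<phi> \<psi> ys xs = cls (Prel H M (length ys + length xs)) (compose_rep \<phi> \<psi> ys xs)"
  by (simp add: pcompose_def compose_rep_def graft_def)

text \<open>Linearity in the inner arguments passes through \<open>compose_balanced\<close>, in the
  outer ones through \<open>graft_balanced\<close>. Joining both blocks into one list gives the form
  in which shuffles can act.\<close>

lemma multilin_compose:
  assumes \<phi>: "\<phi> \<in> polyHom H M p (Suc m)" and \<psi>: "\<psi> \<in> polyHom H M q (Suc l)"
  shows "multilin (mscale H M) (Suc l + m) (Prel H M (Suc l + m))
    (\<lambda>zs. compose_rep \<phi> \<psi> (take (Suc l) zs) (drop (Suc l) zs))"
proof (rule multilin_take_drop)
  fix xs :: "'m list" assume "length xs = m"
  then have "multilin (mscale H M) (Suc l) (Prel H M (Suc l + m))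
     (\<lambda>ys. lin (\<lambda>(hs, e). lin (graft (Suc l) hs) (rep (\<phi> (pure H M (e # xs))))) (rep (\<psi> (pure H M ys))))"
    by (intro multilin_post[OF multilin_polyHom[OF \<psi>]] balanced_eqv[OF compose_balanced[OF \<phi>]])
  then show "multilin (mscale H M) (Suc l) (Prel H M (Suc l + m)) (\<lambda>ys. compose_rep \<phi> \<psi> ys xs)"
    by (rule multilin_cong) (simp add: compose_rep_def)
next
  fix ys :: "'m list" assume ys: "length ys = Suc l"
  show "multilin (mscale H M) m (Prel H M (Suc l + m)) (compose_rep \<phi> \<psi> ys)"
    unfolding compose_rep_def ys
  proof (rule multilin_lin_fun)
    fix y assume y: "y \<in> Poly_Mapping.keys (rep (\<psi> (pure H M ys)))"
    obtain hs e where y': "y = (hs, e)" by (cases y)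
    then have hs: "length hs = Suc l" using polyHom_pure(2)[OF \<psi> ys] y by blast
    have "multilin (mscale H M) m (Prel H M (Suc m)) (\<lambda>xs. rep (\<phi> (pure H M ([e] @ xs @ []))))"
      using multilin_polyHom[OF \<phi>] by (intro multilin_append) simp
    then show "multilin (mscale H M) m (Prel H M (Suc l + m))
        (\<lambda>xs. case y of (hs, e) \<Rightarrow> lin (graft (Suc l) hs) (rep (\<phi> (pure H M (e # xs)))))"
      unfolding y' prod.case using hs
      by (intro multilin_post balanced_eqv[OF graft_balanced]) simp_all
  qed
qed

section \<open>Permutation of the slots\<close>

definition perm_slots :: "(nat \<Rightarrow> nat) \<Rightarrow> 'h list \<times> 'm \<Rightarrow> ('h list \<times> 'm \<Rightarrow>\<^sub>0 'k)" where
  "perm_slots \<sigma> = (\<lambda>(hs, m). gen (permute_list (inv \<sigma>) hs, m))"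

lemma reslot_eq: "reslot H M n \<sigma> T = cls (Prel H M n) (lin (perm_slots \<sigma>) (rep T))"
  by (simp add: reslot_def perm_slots_def)

text \<open>Permuting factors commutes with factorwise multiplication, so the relation over
  \<open>H\<close> is carried to the same relation with a permuted coproduct;
  \<open>coprod_permute\<close> removes that permutation.\<close>

lemma perm_slots_balanced:
  assumes \<sigma>: "\<sigma> permutes {..<n}" and "1 \<le> n"
  shows "balanced n (Prel H M n) (perm_slots \<sigma>)"
  unfolding perm_slots_def
proof (rule balancedI; simp only: prod.case)
  have inv: "inv \<sigma> permutes {..<n}" using \<sigma> by (rule permutes_inv)
  show "multilin (hscale H) n (Prel H M n) (\<lambda>hs. gen (permute_list (inv \<sigma>) hs, m))" for m
    using multilin_gen_pair inv by (rule multilin_permute)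
  fix hs :: "'h list" and x y c h and m :: 'm assume hs: "length hs = n"
  show "eqv (Prel H M n) (gen (permute_list (inv \<sigma>) hs, x + y))
      (gen (permute_list (inv \<sigma>) hs, x) + gen (permute_list (inv \<sigma>) hs, y))"
    using hs by (intro balancedD[OF balanced_gen]) simp
  show "eqv (Prel H M n) (gen (permute_list (inv \<sigma>) hs, mscale H M c x))
      (fscale c (gen (permute_list (inv \<sigma>) hs, x)))"
    using hs by (intro balancedD[OF balanced_gen]) simp
  let ?c = "coprod H (n - 1) h" and ?F = "\<lambda>ds. gen (map2 (*) (permute_list (inv \<sigma>) hs) ds, m) :: _ \<Rightarrow>\<^sub>0 'k"
  have "lin (\<lambda>ds. gen (permute_list (inv \<sigma>) (map2 (*) hs ds), m)) ?c
      = lin ?F (lin (\<lambda>ds. gen (permute_list (inv \<sigma>) ds)) ?c)"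
    unfolding lin_lin lin_gen
  proof (rule lin_cong)
    fix ds assume "ds \<in> Poly_Mapping.keys ?c"
    then have "length ds = n" using keys_coprod assms(2) by fastforce
    then have "permute_list (inv \<sigma>) (map2 (*) hs ds)
        = map2 (*) (permute_list (inv \<sigma>) hs) (permute_list (inv \<sigma>) ds)"
      using hs inv by (simp add: permute_list_map permute_list_zip[OF inv])
    then show "gen (permute_list (inv \<sigma>) (map2 (*) hs ds), m) = ?F (permute_list (inv \<sigma>) ds)" by simp
  qed
  also have "eqv (Prel H M n) \<dots> (lin ?F ?c)"
  proof (rule multilin_eqv)
    show "multilin (hscale H) n (Prel H M n) ?F"
      using multilin_gen_pair hs by (intro multilin_mult_right) simp_all
    have "{..n - 1} = {..<n}" using assms(2) by auto
    then show "eqv (Hrel H n) (lin (\<lambda>ds. gen (permute_list (inv \<sigma>) ds)) ?c) ?c"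
      using coprod_permute[of "inv \<sigma>" "n - 1" h] inv assms(2) by simp
  qed
  also have "eqv (Prel H M n) \<dots> (gen (permute_list (inv \<sigma>) hs, act M h m))"
    using hs by (intro balancedD[OF balanced_gen]) simp
  finally show "eqv (Prel H M n) (lin (\<lambda>ds. gen (permute_list (inv \<sigma>) (map2 (*) hs ds), m)) ?c)
      (gen (permute_list (inv \<sigma>) hs, act M h m))" .
qed

lemma eqv_reslot:
  assumes "\<sigma> permutes {..<n}" "1 \<le> n" "eqv (Prel H M n) (rep T) f"
  shows "eqv (Prel H M n) (rep (reslot H M n \<sigma> T)) (lin (perm_slots \<sigma>) f)"
  unfolding reslot_eq using rep_cls balanced_eqv[OF perm_slots_balanced[OF assms(1,2)] assms(3)]
  by (rule eqv_trans)

section \<open>The diamond product\<close>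

lemma decomp_components: "is_decomp M x (components M x)"
  unfolding components_def using ex1_decomp by (rule theI')

lemma components_eqI: "is_decomp M x c \<Longrightarrow> components M x = c"
  using ex1_decomp decomp_components by blast

abbreviation component :: "'m \<Rightarrow> int \<Rightarrow> 'm" where
  "component x \<equiv> Poly_Mapping.lookup (components M x)"

lemma component_grade: "component x n \<in> grade M n"
  using decomp_components by (simp add: is_decomp_def)

lemma component_sum:
  assumes "finite A" "Poly_Mapping.keys (components M x) \<subseteq> A"
  shows "x = (\<Sum>n\<in>A. component x n)"
proof -
  have "x = (\<Sum>n\<in>Poly_Mapping.keys (components M x). component x n)"
    using decomp_components[of x] by (simp add: is_decomp_def)
  also have "\<dots> = (\<Sum>n\<in>A. component x n)"
    using assms by (intro sum.mono_neutral_left) (auto simp: in_keys_iff)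
  finally show ?thesis .
qed

lemma components_add: "components M (x + y) = components M x + components M y"
proof (rule components_eqI)
  let ?A = "Poly_Mapping.keys (components M x) \<union> Poly_Mapping.keys (components M y)"
  have "(\<Sum>n\<in>Poly_Mapping.keys (components M x + components M y). component x n + component y n)
      = (\<Sum>n\<in>?A. component x n + component y n)"
    using Poly_Mapping.keys_add[of "components M x" "components M y"]
    by (intro sum.mono_neutral_left) (auto simp: in_keys_iff lookup_add)
  also have "\<dots> = x + y"
    using component_sum[of ?A x] component_sum[of ?A y] by (simp add: sum.distrib)
  finally show "is_decomp M (x + y) (components M x + components M y)"
    by (simp add: is_decomp_def lookup_add grade_add component_grade)
qed

lemma act_zero [simp]: "act M h 0 = 0"
  using act_add[of h 0 0] by simp

lemma act_sum: "act M h (\<Sum>i\<in>I. f i) = (\<Sum>i\<in>I. act M h (f i))"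
  by (induction I rule: infinite_finite_induct) (simp_all add: act_add)

lemma components_act: "components M (act M h x) = Poly_Mapping.map (act M h) (components M x)"
proof (rule components_eqI)
  let ?c = "Poly_Mapping.map (act M h) (components M x)"
  have lookup: "Poly_Mapping.lookup ?c n = act M h (component x n)" for n
    by (simp add: Poly_Mapping.map.rep_eq when_def)
  have "act M h x = (\<Sum>n\<in>Poly_Mapping.keys (components M x). act M h (component x n))"
    using component_sum[of "Poly_Mapping.keys (components M x)" x] by (simp flip: act_sum)
  also have "\<dots> = (\<Sum>n\<in>Poly_Mapping.keys ?c. act M h (component x n))"
    by (intro sum.mono_neutral_right) (auto simp: in_keys_iff lookup)
  finally show "is_decomp M (act M h x) ?c"
    by (simp add: is_decomp_def lookup grade_act component_grade)
qed

lemma component_add: "component (x + y) n = component x n + component y n"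
  by (simp add: components_add lookup_add)

lemma component_act: "component (act M h x) n = act M h (component x n)"
  by (simp add: components_act Poly_Mapping.map.rep_eq when_def)

lemma component_mscale: "component (mscale H M c x) n = mscale H M c (component x n)"
  by (simp add: mscale_def component_act)

lemma components_homogeneous:
  assumes "x \<in> grade M n"
  shows "components M x = Poly_Mapping.single n x"
  by (rule components_eqI) (use assms grade_zero in \<open>auto simp: is_decomp_def lookup_single when_def\<close>)

text \<open>The degrees are a separate argument: the zero vector is homogeneous of every degree, and
  for fixed \<open>ds\<close> the Koszul sign is constant, which makes the expression multilinear in
  \<open>us\<close>.\<close>

definition diamond_term :: "nat \<Rightarrow> nat \<Rightarrow> ('k, 'h, 'm) pmap \<Rightarrow> ('k, 'h, 'm) pmap \<Rightarrow> int list \<Rightarrow> 'm list \<Rightarrow>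
    ('h list \<times> 'm \<Rightarrow>\<^sub>0 'k)" where
  "diamond_term k l \<phi> \<psi> ds us = (\<Sum>\<sigma>\<in>shuffles l (k - 1). fscale (koszul ds \<sigma>)
     (rep (reslot H M (k + l - 1) \<sigma>
        (pcompose H M \<phi> \<psi> (take l (permute_list \<sigma> us)) (drop l (permute_list \<sigma> us))))))"

definition diamond_sum :: "nat \<Rightarrow> nat \<Rightarrow> ('k, 'h, 'm) pmap \<Rightarrow> ('k, 'h, 'm) pmap \<Rightarrow> 'm list \<Rightarrow>
    ('h list \<times> 'm \<Rightarrow>\<^sub>0 'k)" where
  "diamond_sum k l \<phi> \<psi> ws =
     (\<Sum>ds\<in>{ds. list_all2 (\<lambda>w d. d \<in> Poly_Mapping.keys (components M w)) ws ds}.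
        diamond_term k l \<phi> \<psi> ds (map2 component ws ds))"

lemma diamond_eq:
  assumes "t \<in> Mpow H M (k + l - 1)"
  shows "diamond H M k l \<phi> \<psi> t = cls (Prel H M (k + l - 1)) (lin (diamond_sum k l \<phi> \<psi>) (rep t))"
  unfolding diamond_def restrict_apply'[OF assms] diamond_sum_def[abs_def] diamond_term_def Let_def ..

context
  fixes \<phi> \<psi> :: "('k, 'h, 'm) pmap" and p q k l N
  assumes \<phi>: "\<phi> \<in> polyHom H M p k" and \<psi>: "\<psi> \<in> polyHom H M q l"
    and pos: "1 \<le> k" "1 \<le> l" and N: "k + l = N + 1"
begin

lemma eqv_pcompose_rep:
  assumes "length us = N"
  shows "eqv (Prel H M N) (rep (pcompose H M \<phi> \<psi> (take l us) (drop l us)))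
    (compose_rep \<phi> \<psi> (take l us) (drop l us))"
proof -
  have "length (take l us) + length (drop l us) = N" using assms pos N by simp
  then show ?thesis unfolding pcompose_eq by (metis rep_cls)
qed

lemma multilin_diamond_term: "multilin (mscale H M) N (Prel H M N) (diamond_term k l \<phi> \<psi> ds)"
  unfolding diamond_term_def[abs_def]
proof (intro multilin_sum multilin_fscale)
  fix \<sigma> assume "\<sigma> \<in> shuffles l (k - 1)"
  moreover have "l + (k - 1) = N" using pos N by simp
  ultimately have \<sigma>: "\<sigma> permutes {..<N}" by (simp add: shuffles_def)
  have "multilin (mscale H M) N (Prel H M N) (\<lambda>us. compose_rep \<phi> \<psi> (take l us) (drop l us))"
  proof -
    have *: "Suc (k - 1) = k" "Suc (l - 1) = l" "l + (k - 1) = N" using pos N by auto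
    show ?thesis using multilin_compose[of \<phi> p "k - 1" \<psi> q "l - 1", unfolded *, OF \<phi> \<psi>] .
  qed
  then have "multilin (mscale H M) N (Prel H M N)
      (\<lambda>us. lin (perm_slots \<sigma>) (compose_rep \<phi> \<psi> (take l (permute_list \<sigma> us)) (drop l (permute_list \<sigma> us))))"
    using pos N by (intro multilin_post[OF multilin_permute[OF _ \<sigma>]] balanced_eqv[OF perm_slots_balanced[OF \<sigma>]]) auto
  then show "multilin (mscale H M) N (Prel H M N) (\<lambda>us. rep (reslot H M (k + l - 1) \<sigma>
        (pcompose H M \<phi> \<psi> (take l (permute_list \<sigma> us)) (drop l (permute_list \<sigma> us)))))"
    by (rule multilin_cong) (use \<sigma> pos N in \<open>simp add: eqv_sym[OF eqv_reslot] eqv_pcompose_rep\<close>)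
qed

text \<open>The index set of \<open>diamond_sum\<close> varies with \<open>ws\<close>. Over a fixed
  finite box the additional terms each have a zero component as an argument, so multilinearity makes
  them vanish.\<close>

lemma diamond_sum_box:
  assumes "length ws = N" "finite K" "\<And>w. w \<in> set ws \<Longrightarrow> Poly_Mapping.keys (components M w) \<subseteq> K"
  shows "eqv (Prel H M N) (diamond_sum k l \<phi> \<psi> ws)
    (\<Sum>ds\<in>{ds. set ds \<subseteq> K \<and> length ds = N}. diamond_term k l \<phi> \<psi> ds (map2 component ws ds))"
proof -
  let ?B = "{ds. set ds \<subseteq> K \<and> length ds = N}"
  let ?A = "{ds. list_all2 (\<lambda>w d. d \<in> Poly_Mapping.keys (components M w)) ws ds}"
  let ?D = "\<lambda>ds. diamond_term k l \<phi> \<psi> ds (map2 component ws ds)"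
  have fin: "finite ?B" using assms(2) by (rule finite_lists_length_eq)
  have sub: "?A \<subseteq> ?B"
    using assms(1,3) by (fastforce simp: list_all2_conv_all_nth in_set_conv_nth)
  have "(\<Sum>ds\<in>?B. ?D ds) = (\<Sum>ds\<in>?B - ?A. ?D ds) + (\<Sum>ds\<in>?A. ?D ds)"
    using sub fin by (rule sum.subset_diff)
  also have "eqv (Prel H M N) \<dots> ((\<Sum>ds\<in>?B - ?A. 0) + (\<Sum>ds\<in>?A. ?D ds))"
  proof (intro eqv_add eqv_sum eqv_refl)
    fix ds assume "ds \<in> ?B - ?A"
    then obtain i where "i < N" "length ds = N" "ds ! i \<notin> Poly_Mapping.keys (components M (ws ! i))"
      using assms(1) by (auto simp: list_all2_conv_all_nth)
    then show "eqv (Prel H M N) (?D ds) 0"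
      using assms(1) by (intro multilin_zero[OF multilin_diamond_term, of _ i]) (auto simp: in_keys_iff)
  qed
  finally show ?thesis by (simp add: diamond_sum_def eqv_sym)
qed

lemma multilin_diamond_sum: "multilin (mscale H M) N (Prel H M N) (diamond_sum k l \<phi> \<psi>)"
proof -
  let ?S = "\<lambda>K ws. \<Sum>ds\<in>{ds. set ds \<subseteq> K \<and> length ds = N}. diamond_term k l \<phi> \<psi> ds (map2 component ws ds)"
  have box: "multilin (mscale H M) N (Prel H M N) (?S K)" for K
  proof (rule multilin_sum)
    fix ds assume "ds \<in> {ds. set ds \<subseteq> K \<and> length ds = N}"
    then have ds: "length ds = N" by simp
    have "multilin (mscale H M) N (Prel H M N)
      (\<lambda>ws. diamond_term k l \<phi> \<psi> ds (map2 (\<lambda>i x. component x (ds ! i)) [0..<N] ws))"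
      by (rule multilin_map[OF multilin_diamond_term]) (simp_all add: component_add component_mscale)
    then show "multilin (mscale H M) N (Prel H M N) (\<lambda>ws. diamond_term k l \<phi> \<psi> ds (map2 component ws ds))"
      by (rule multilin_cong, subst map2_conv_upt(2)[OF _ ds]) auto
  qed
  show ?thesis
  proof (rule multilinI)
    fix xs :: "'m list" and i x y assume *: "length xs = N" "i < N"
    \<comment> \<open>The box contains the degrees of all three lists, so that the three sums run
      over the same index set.\<close>
    let ?W = "set (xs[i := x + y]) \<union> set (xs[i := x]) \<union> set (xs[i := y])"
    let ?K = "\<Union>w\<in>?W. Poly_Mapping.keys (components M w)"
    have K: "eqv (Prel H M N) (diamond_sum k l \<phi> \<psi> ws) (?S ?K ws)" if "length ws = N" "set ws \<subseteq> ?W" for ws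
      using that by (intro diamond_sum_box) auto
    have "eqv (Prel H M N) (diamond_sum k l \<phi> \<psi> (xs[i := x + y])) (?S ?K (xs[i := x + y]))"
      by (rule K) (use * in auto)
    also have "eqv (Prel H M N) \<dots> (?S ?K (xs[i := x]) + ?S ?K (xs[i := y]))"
      using box * by (rule multilin_addD)
    also have "eqv (Prel H M N) \<dots> (diamond_sum k l \<phi> \<psi> (xs[i := x]) + diamond_sum k l \<phi> \<psi> (xs[i := y]))"
      by (intro eqv_add eqv_sym[OF K]) (use * in auto)
    finally show "eqv (Prel H M N) (diamond_sum k l \<phi> \<psi> (xs[i := x + y]))
        (diamond_sum k l \<phi> \<psi> (xs[i := x]) + diamond_sum k l \<phi> \<psi> (xs[i := y]))" .
  next
    fix xs :: "'m list" and i c x assume *: "length xs = N" "i < N"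
    let ?W = "set (xs[i := mscale H M c x]) \<union> set (xs[i := x])"
    let ?K = "\<Union>w\<in>?W. Poly_Mapping.keys (components M w)"
    have K: "eqv (Prel H M N) (diamond_sum k l \<phi> \<psi> ws) (?S ?K ws)" if "length ws = N" "set ws \<subseteq> ?W" for ws
      using that by (intro diamond_sum_box) auto
    have "eqv (Prel H M N) (diamond_sum k l \<phi> \<psi> (xs[i := mscale H M c x])) (?S ?K (xs[i := mscale H M c x]))"
      by (rule K) (use * in auto)
    also have "eqv (Prel H M N) \<dots> (fscale c (?S ?K (xs[i := x])))"
      using box * by (rule multilin_scaleD)
    also have "eqv (Prel H M N) \<dots> (fscale c (diamond_sum k l \<phi> \<psi> (xs[i := x])))"
      by (intro eqv_fscale eqv_sym[OF K]) (use * in auto)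
    finally show "eqv (Prel H M N) (diamond_sum k l \<phi> \<psi> (xs[i := mscale H M c x]))
        (fscale c (diamond_sum k l \<phi> \<psi> (xs[i := x])))" .
  qed
qed

lemma diamond_sum_homogeneous:
  assumes "length xs = N" "homogeneous M xs ds"
  shows "eqv (Prel H M N) (diamond_sum k l \<phi> \<psi> xs) (diamond_term k l \<phi> \<psi> ds xs)"
\<comment> \<open>The zero vector has no components, so \<open>ds\<close> cannot be recovered from a
  list containing it; both sides are then congruent to zero. Otherwise \<open>ds\<close> is the only
  list of degrees that occurs.\<close>
proof (cases "0 \<in> set xs")
  case True
  then obtain i where i: "i < N" "xs ! i = 0" using assms(1) by (metis in_set_conv_nth)
  have "eqv (Prel H M N) (diamond_sum k l \<phi> \<psi> xs) 0"
    using multilin_diamond_sum assms(1) i by (rule multilin_zero)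
  moreover have "eqv (Prel H M N) (diamond_term k l \<phi> \<psi> ds xs) 0"
    using multilin_diamond_term assms(1) i by (rule multilin_zero)
  ultimately show ?thesis by (blast intro: eqv_trans eqv_sym)
next
  case False
  have len: "length ds = length xs" using assms(2) by (simp add: homogeneous_def list_all2_lengthD)
  have comp: "components M (xs ! i) = Poly_Mapping.single (ds ! i) (xs ! i)" "xs ! i \<noteq> 0"
    if "i < length xs" for i
    using assms(2) that False nth_mem[of i xs] by (auto simp: homogeneous_def list_all2_conv_all_nth simp del: nth_mem intro: components_homogeneous)
  have "{es. list_all2 (\<lambda>w d. d \<in> Poly_Mapping.keys (components M w)) xs es} = {ds}"
    using len by (auto simp: list_all2_conv_all_nth comp intro!: nth_equalityI)
  moreover have "map2 component xs ds = xs"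
    using len by (auto intro!: nth_equalityI simp: comp)
  ultimately show ?thesis by (simp add: diamond_sum_def)
qed

end

end

section \<open>Maurer-Cartan elements on homogeneous arguments\<close>

lemma restrict_eq_iff: "(\<lambda>x\<in>A. f x) = (\<lambda>x\<in>A. g x) \<longleftrightarrow> (\<forall>x\<in>A. f x = g x)"
  by (metis restrict_apply' restrict_ext)

lemma eqv_fscale_iff:
  assumes "c \<noteq> 0"
  shows "eqv R (fscale c f) (fscale c g) \<longleftrightarrow> eqv R f g"
proof
  assume "eqv R (fscale c f) (fscale c g)"
  then have "eqv R (fscale (inverse c) (fscale c f)) (fscale (inverse c) (fscale c g))"
    by (rule eqv_fscale)
  then show "eqv R f g" using assms by simp
qed (rule eqv_fscale)

lemma eqv_cong_left: "eqv R f g \<Longrightarrow> eqv R f h \<longleftrightarrow> eqv R g h"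
  by (blast intro: eqv_trans eqv_sym)

context pseudo_module
begin

text \<open>Links an equation between functions on whole tensor powers to identities on homogeneous
  lists, the form of the L-infinity relations. Invertibility of 2 removes the factor in the bracket,
  and multilinearity together with decomposition into components removes the restriction to
  homogeneous arguments.\<close>

lemma bracket_eq_zero_iff:
  assumes \<eta>: "\<And>k. 1 \<le> k \<Longrightarrow> \<eta> k \<in> polyHom H M (-1) k" and two: "(2::'k) \<noteq> 0"
  shows "bracket H M (-1) (-1) \<eta> \<eta> = symHom_zero H M \<longleftrightarrow>
    (\<forall>N\<ge>1. \<forall>xs ds. length xs = N \<and> homogeneous M xs ds \<longrightarrow>
       eqv (Prel H M N) (\<Sum>(k, l)\<in>{(k, l). 1 \<le> k \<and> 1 \<le> l \<and> k + l = N + 1}.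
         diamond_term k l (\<eta> k) (\<eta> l) ds xs) 0)"
    (is "_ \<longleftrightarrow> (\<forall>N\<ge>1. ?hom N)")
proof -
  define P where "P N = {(k, l). 1 \<le> k \<and> 1 \<le> l \<and> k + l = N + (1::nat)}" for N
  define D where "D N ws = (\<Sum>(k, l)\<in>P N. diamond_sum k l (\<eta> k) (\<eta> l) ws)" for N ws
  have bracket: "eqv (Prel H M N) (\<Sum>(k, l)\<in>P N. rep (diamond H M k l (\<eta> k) (\<eta> l) t)
        - fscale ((-1) powi ((-1) * (-1))) (rep (diamond H M l k (\<eta> l) (\<eta> k) t)))
      (fscale 2 (lin (D N) (rep t)))" if t: "t \<in> Mpow H M N" for N t
  proof -
    define d where "d = (\<lambda>(k, l). lin (diamond_sum k l (\<eta> k) (\<eta> l)) (rep t))"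
    have "eqv (Prel H M N) (\<Sum>(k, l)\<in>P N. rep (diamond H M k l (\<eta> k) (\<eta> l) t)
        - fscale ((-1) powi ((-1) * (-1))) (rep (diamond H M l k (\<eta> l) (\<eta> k) t)))
      (\<Sum>(k, l)\<in>P N. d (k, l) - fscale ((-1) powi ((-1) * (-1))) (d (l, k)))"
    proof (rule eqv_sum)
      fix x assume "x \<in> P N"
      then obtain k l where x: "x = (k, l)" "k + l - 1 = N" "l + k - 1 = N" by (auto simp: P_def)
      have "eqv (Prel H M N) (rep (diamond H M a b (\<eta> a) (\<eta> b) t)) (d (a, b))" if "a + b - 1 = N" for a b
        using t that rep_cls by (simp add: diamond_eq d_def)
      then show "eqv (Prel H M N) (case x of (k, l) \<Rightarrow> rep (diamond H M k l (\<eta> k) (\<eta> l) t)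
          - fscale ((-1) powi ((-1) * (-1))) (rep (diamond H M l k (\<eta> l) (\<eta> k) t)))
        (case x of (k, l) \<Rightarrow> d (k, l) - fscale ((-1) powi ((-1) * (-1))) (d (l, k)))"
        using x unfolding x(1) prod.case by (intro eqv_diff eqv_fscale) auto
    qed
    \<comment> \<open>For degrees -1 and -1 the sign in the bracket is -1, so the difference is a
      sum. Exchanging \<open>k\<close> and \<open>l\<close> is a bijection of \<open>P N\<close>,
      hence both halves agree.\<close>
    also have "\<dots> = (\<Sum>x\<in>P N. d x) + (\<Sum>x\<in>P N. d (prod.swap x))"
      by (simp add: case_prod_beta sum.distrib prod.swap_def)
    also have "(\<Sum>x\<in>P N. d (prod.swap x)) = (\<Sum>x\<in>P N. d x)"
      by (rule sum.reindex_bij_betw, rule bij_betw_byWitness[of _ prod.swap]) (auto simp: P_def)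
    also have "(\<Sum>x\<in>P N. d x) + (\<Sum>x\<in>P N. d x) = fscale 2 (lin (D N) (rep t))"
      using free.scale_left_distrib[of 1 1 "\<Sum>x\<in>P N. d x"]
      by (simp add: D_def[abs_def] d_def case_prod_beta lin_fun_sum)
    finally show ?thesis .
  qed
  have "bracket H M (-1) (-1) \<eta> \<eta> = symHom_zero H M \<longleftrightarrow>
      (\<forall>N\<ge>1. \<forall>t\<in>Mpow H M N. eqv (Prel H M N) (lin (D N) (rep t)) 0)"
  proof -
    have "bracket H M (-1) (-1) \<eta> \<eta> = symHom_zero H M \<longleftrightarrow>
      (\<forall>N\<in>{1..}. \<forall>t\<in>Mpow H M N. eqv (Prel H M N)
         (\<Sum>(k, l)\<in>P N. rep (diamond H M k l (\<eta> k) (\<eta> l) t)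
          - fscale ((-1) powi ((-1) * (-1))) (rep (diamond H M l k (\<eta> l) (\<eta> k) t))) 0)"
      unfolding bracket_def symHom_zero_def restrict_eq_iff cls_eq_iff P_def ..
    also have "\<dots> \<longleftrightarrow> (\<forall>N\<in>{1..}. \<forall>t\<in>Mpow H M N. eqv (Prel H M N) (fscale 2 (lin (D N) (rep t))) (fscale 2 0))"
      unfolding free.scale_zero_right by (intro ball_cong refl eqv_cong_left bracket)
    also have "\<dots> \<longleftrightarrow> (\<forall>N\<ge>1. \<forall>t\<in>Mpow H M N. eqv (Prel H M N) (lin (D N) (rep t)) 0)"
      unfolding eqv_fscale_iff[OF two] by auto
    finally show ?thesis .
  qed
  also have "\<dots> \<longleftrightarrow> (\<forall>N\<ge>1. ?hom N)"
  proof (intro all_cong)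
    fix N :: nat assume "1 \<le> N"
    have multi: "multilin (mscale H M) N (Prel H M N) (D N)"
      unfolding D_def[abs_def]
    proof (rule multilin_sum)
      fix x assume "x \<in> P N"
      then obtain k l where "x = (k, l)" "1 \<le> k" "1 \<le> l" "k + l = N + 1" by (auto simp: P_def)
      then show "multilin (mscale H M) N (Prel H M N) (\<lambda>ws. case x of (k, l) \<Rightarrow> diamond_sum k l (\<eta> k) (\<eta> l) ws)"
        using multilin_diamond_sum[OF \<eta> \<eta>] by simp
    qed
    have D_hom: "eqv (Prel H M N) (D N xs) (\<Sum>(k, l)\<in>P N. diamond_term k l (\<eta> k) (\<eta> l) ds xs)"
      if "length xs = N" "homogeneous M xs ds" for xs ds
      unfolding D_def
    proof (rule eqv_sum)
      fix x assume "x \<in> P N"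
      then obtain k l where "x = (k, l)" "1 \<le> k" "1 \<le> l" "k + l = N + 1" by (auto simp: P_def)
      then show "eqv (Prel H M N) (case x of (k, l) \<Rightarrow> diamond_sum k l (\<eta> k) (\<eta> l) xs)
          (case x of (k, l) \<Rightarrow> diamond_term k l (\<eta> k) (\<eta> l) ds xs)"
        using diamond_sum_homogeneous[OF \<eta> \<eta> _ _ _ that] by simp
    qed
    show "(\<forall>t\<in>Mpow H M N. eqv (Prel H M N) (lin (D N) (rep t)) 0) \<longleftrightarrow> ?hom N"
    proof
      assume *: "\<forall>t\<in>Mpow H M N. eqv (Prel H M N) (lin (D N) (rep t)) 0"
      show "?hom N"
      proof (intro allI impI)
        fix xs ds assume xs: "length xs = N \<and> homogeneous M xs ds"
        then have "pure H M xs \<in> Mpow H M N" by (auto simp: pure_def intro: tensor_powerI)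
        with * have "eqv (Prel H M N) (lin (D N) (rep (pure H M xs))) 0" by blast
        moreover have "eqv (Prel H M N) (lin (D N) (rep (pure H M xs))) (lin (D N) (gen xs))"
          using xs rep_cls by (intro multilin_eqv[OF multi]) (auto simp: pure_def)
        ultimately have "eqv (Prel H M N) (D N xs) 0" by (auto intro: eqv_trans eqv_sym)
        then show "eqv (Prel H M N) (\<Sum>(k, l)\<in>{(k, l). 1 \<le> k \<and> 1 \<le> l \<and> k + l = N + 1}.
            diamond_term k l (\<eta> k) (\<eta> l) ds xs) 0"
          using D_hom[of xs ds] xs unfolding P_def by (auto intro: eqv_trans eqv_sym)
      qed
    next
      assume hom: "?hom N"
      \<comment> \<open>By definition \<open>diamond_sum\<close> already splits an arbitrary list
        into homogeneous ones; exchanging the order of summation exposes the hypothesis for each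
        choice of degrees.\<close>
      have D0: "eqv (Prel H M N) (D N ws) 0" if ws: "length ws = N" for ws
      proof -
        have "eqv (Prel H M N) (D N ws) (\<Sum>x\<in>P N.
          \<Sum>ds\<in>{ds. list_all2 (\<lambda>w d. d \<in> Poly_Mapping.keys (components M w)) ws ds}.
            case x of (k, l) \<Rightarrow> diamond_term k l (\<eta> k) (\<eta> l) ds (map2 component ws ds))"
          by (simp add: D_def diamond_sum_def case_prod_beta)
        also have "\<dots> = (\<Sum>ds\<in>{ds. list_all2 (\<lambda>w d. d \<in> Poly_Mapping.keys (components M w)) ws ds}.
            \<Sum>(k, l)\<in>P N. diamond_term k l (\<eta> k) (\<eta> l) ds (map2 component ws ds))"
          by (rule sum.swap)
        also have "eqv (Prel H M N) \<dots>
          (\<Sum>ds\<in>{ds. list_all2 (\<lambda>w d. d \<in> Poly_Mapping.keys (components M w)) ws ds}. 0)"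
        proof (rule eqv_sum)
          fix ds assume "ds \<in> {ds. list_all2 (\<lambda>w d. d \<in> Poly_Mapping.keys (components M w)) ws ds}"
          then have "length (map2 component ws ds) = N" "homogeneous M (map2 component ws ds) ds"
            using ws by (auto simp: homogeneous_def list_all2_conv_all_nth component_grade)
          then show "eqv (Prel H M N) (\<Sum>(k, l)\<in>P N. diamond_term k l (\<eta> k) (\<eta> l) ds (map2 component ws ds)) 0"
            using hom unfolding P_def by blast
        qed
        finally show ?thesis by simp
      qed
      show "\<forall>t\<in>Mpow H M N. eqv (Prel H M N) (lin (D N) (rep t)) 0"
      proof
        fix t assume "t \<in> Mpow H M N"
        then have "eqv (Prel H M N) (lin (D N) (rep t)) (lin (\<lambda>_. 0) (rep t))"
          by (intro eqv_lin D0) (auto elim: tensor_powerE)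
        then show "eqv (Prel H M N) (lin (D N) (rep t)) 0" by (simp add: lin_ext_def)
      qed
    qed
  qed
  finally show ?thesis .
qed

section \<open>The sign twist\<close>

lemma mscale_mscale: "mscale H M c (mscale H M d x) = mscale H M (c * d) x"
  by (simp add: mscale_def hscale_mult_left hscale_hscale flip: act_mult)

lemma mscale_one [simp]: "mscale H M 1 x = x"
  using vector_space_H by (simp add: mscale_def vector_space_def)

lemma mscale_zero [simp]: "mscale H M c 0 = 0"
  by (simp add: mscale_def)

section \<open>The parity involution and its slotwise powers\<close>

definition parity :: "'m \<Rightarrow> 'm" where
  "parity x = (\<Sum>n\<in>Poly_Mapping.keys (components M x). mscale H M ((-1) powi n) (component x n))"

lemma parity_superset:
  assumes "finite A" "Poly_Mapping.keys (components M x) \<subseteq> A"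
  shows "parity x = (\<Sum>n\<in>A. mscale H M ((-1) powi n) (component x n))"
  unfolding parity_def using assms by (intro sum.mono_neutral_left) (auto simp: in_keys_iff)

lemma parity_add: "parity (x + y) = parity x + parity y"
proof -
  let ?A = "Poly_Mapping.keys (components M x) \<union> Poly_Mapping.keys (components M y)"
  have "parity (x + y) = (\<Sum>n\<in>?A. mscale H M ((-1) powi n) (component (x + y) n))"
    using Poly_Mapping.keys_add[of "components M x" "components M y"]
    by (intro parity_superset) (auto simp: components_add)
  also have "\<dots> = parity x + parity y"
    by (simp add: parity_superset[of ?A] component_add mscale_add sum.distrib)
  finally show ?thesis .
qed

lemma parity_act: "parity (act M h x) = act M h (parity x)"
proof -
  have "parity (act M h x) = (\<Sum>n\<in>Poly_Mapping.keys (components M x).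
      mscale H M ((-1) powi n) (component (act M h x) n))"
    by (rule parity_superset) (auto simp: components_act in_keys_iff Poly_Mapping.map.rep_eq when_def)
  then show ?thesis by (simp add: parity_def act_sum component_act act_mscale)
qed

lemma parity_mscale: "parity (mscale H M c x) = mscale H M c (parity x)"
  by (simp add: mscale_def parity_act)

lemma parity_homogeneous: "x \<in> grade M n \<Longrightarrow> parity x = mscale H M ((-1) powi n) x"
  by (cases "x = 0") (simp_all add: parity_def components_homogeneous)

lemma parity_sum: "parity (\<Sum>i\<in>I. f i) = (\<Sum>i\<in>I. parity (f i))"
proof (induction I rule: infinite_finite_induct)
  case empty
  show ?case using parity_add[of 0 0] by simp
qed (use parity_add[of 0 0] in \<open>simp_all add: parity_add\<close>)

lemma mscale_grade: "x \<in> grade M n \<Longrightarrow> mscale H M c x \<in> grade M n"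
  by (simp add: mscale_def grade_act)

lemma parity_grade: "x \<in> grade M n \<Longrightarrow> parity x \<in> grade M n"
  by (simp add: parity_homogeneous mscale_grade)

lemma parity_parity [simp]: "parity (parity x) = x"
proof -
  have "parity (parity x) = (\<Sum>n\<in>Poly_Mapping.keys (components M x). component x n)"
    by (simp add: parity_def[of x] parity_sum parity_homogeneous[OF mscale_grade[OF component_grade]]
        mscale_mscale)
  then show ?thesis using component_sum[of "Poly_Mapping.keys (components M x)" x] by simp
qed

text \<open>The power \<open>n - 1 - i\<close> of \<open>parity\<close>, reduced by the fact that
  \<open>parity\<close> is an involution.\<close>

definition slot_twist :: "nat \<Rightarrow> nat \<Rightarrow> 'm \<Rightarrow> 'm" where
  "slot_twist n i x = (if odd (n - 1 - i) then parity x else x)"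

definition twist :: "nat \<Rightarrow> ('m list \<Rightarrow>\<^sub>0 'k) \<Rightarrow> ('m list \<Rightarrow>\<^sub>0 'k)" where
  "twist n = lin (\<lambda>xs. gen (map2 (slot_twist n) [0..<n] xs))"

lemma twist_gen [simp]: "twist n (gen xs) = gen (map2 (slot_twist n) [0..<n] xs)"
  by (simp add: twist_def)

lemma eqv_twist: "eqv (Mrel H M n) f g \<Longrightarrow> eqv (Mrel H M n) (twist n f) (twist n g)"
  unfolding twist_def
  by (rule multilin_eqv[OF multilin_map[OF multilin_gen]])
    (simp_all add: slot_twist_def parity_add parity_mscale)

lemma keys_twist:
  assumes "\<And>xs. xs \<in> Poly_Mapping.keys f \<Longrightarrow> length xs = n" "xs \<in> Poly_Mapping.keys (twist n f)"
  shows "length xs = n"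
  using assms(2) unfolding twist_def by (auto elim!: keys_linE dest: assms(1))

lemma twist_twist:
  assumes "\<And>xs. xs \<in> Poly_Mapping.keys f \<Longrightarrow> length xs = n"
  shows "twist n (twist n f) = f"
  unfolding twist_def lin_lin lin_gen
proof (rule lin_id)
  fix xs assume "xs \<in> Poly_Mapping.keys f"
  then have "length xs = n" by (rule assms)
  then have "map2 (slot_twist n) [0..<n] (map2 (slot_twist n) [0..<n] xs) = xs"
    by (intro nth_equalityI) (auto simp: slot_twist_def)
  then show "gen (map2 (slot_twist n) [0..<n] (map2 (slot_twist n) [0..<n] xs)) = (gen xs :: _ \<Rightarrow>\<^sub>0 'k)"
    by simp
qed

lemma twist_bilin:
  assumes "\<And>hs. hs \<in> Poly_Mapping.keys a \<Longrightarrow> length hs = n" "\<And>xs. xs \<in> Poly_Mapping.keys f \<Longrightarrow> length xs = n"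
  shows "twist n (bilin (\<lambda>hs xs. gen (map2 (act M) hs xs)) a f)
    = bilin (\<lambda>hs xs. gen (map2 (act M) hs xs)) a (twist n f)"
  unfolding twist_def bilin_def lin_lin lin_gen
proof (intro lin_cong)
  fix hs xs assume "hs \<in> Poly_Mapping.keys a" "xs \<in> Poly_Mapping.keys f"
  then have "length hs = n" "length xs = n" using assms by auto
  then have "map2 (slot_twist n) [0..<n] (map2 (act M) hs xs) = map2 (act M) hs (map2 (slot_twist n) [0..<n] xs)"
    by (intro nth_equalityI) (auto simp: slot_twist_def parity_act)
  then show "gen (map2 (slot_twist n) [0..<n] (map2 (act M) hs xs))
    = (gen (map2 (act M) hs (map2 (slot_twist n) [0..<n] xs)) :: _ \<Rightarrow>\<^sub>0 'k)" by simp
qed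

text \<open>The prefix \<open>as\<close> is arbitrary so that an entry already scaled can join it,
  which lets the induction proceed along the list.\<close>

lemma multilin_mscale_all:
  assumes F: "multilin (mscale H M) n R F" and "length cs = length bs" "length as + length bs = n"
  shows "eqv R (F (as @ map2 (mscale H M) cs bs)) (fscale (prod_list cs) (F (as @ bs)))"
  using assms(2,3)
proof (induction cs bs arbitrary: as rule: list_induct2)
  case (Cons c cs b bs)
  have "eqv R (F ((as @ [mscale H M c b]) @ map2 (mscale H M) cs bs))
      (fscale (prod_list cs) (F ((as @ [mscale H M c b]) @ bs)))"
    using Cons by (intro Cons.IH) simp
  also have "eqv R \<dots> (fscale (prod_list cs) (fscale c (F (as @ b # bs))))"
    using multilin_scaleD[OF F, of "as @ b # bs" "length as" c b] Cons.prems
    by (intro eqv_fscale) simp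
  finally show ?case by (simp add: mult.commute)
qed simp

text \<open>On an entry of degree \<open>d\<close> the power of \<open>parity\<close> in slot
  \<open>i\<close> is the scalar -1 to the power \<open>(n - 1 - i) * d\<close>; pulling all these
  scalars out of the tensor multiplies them to the decalage sign.\<close>

lemma twist_homogeneous:
  assumes xs: "length xs = n" "homogeneous M xs ds"
  shows "eqv (Mrel H M n) (twist n (gen xs)) (fscale (shift_sign ds) (gen xs))"
proof -
  let ?s = "\<lambda>i. (-1) powi (int (n - 1 - i) * ds ! i) :: 'k"
  have ds: "length ds = n" using assms by (simp add: homogeneous_def list_all2_lengthD)
  have "slot_twist n i (xs ! i) = mscale H M (?s i) (xs ! i)" if "i < n" for i
  proof -
    have "xs ! i \<in> grade M (ds ! i)" using assms that by (simp add: homogeneous_def list_all2_conv_all_nth)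
    then show ?thesis by (simp add: slot_twist_def parity_homogeneous minus_one_powi)
  qed
  then have "map2 (slot_twist n) [0..<n] xs = map2 (mscale H M) (map ?s [0..<n]) xs"
    using xs by (intro nth_equalityI) auto
  moreover have "prod_list (map ?s [0..<n]) = shift_sign ds"
  proof -
    have "prod_list (map (\<lambda>i. (-1) powi g i :: 'k) [0..<m]) = (-1) powi (\<Sum>i<m. g i)" for m and g :: "nat \<Rightarrow> int"
      by (induction m) (simp_all add: minus_one_powi_add)
    then show ?thesis by (simp add: shift_sign_def ds)
  qed
  ultimately show ?thesis
    using multilin_mscale_all[OF multilin_gen, of "map ?s [0..<n]" xs "[]" n] xs by simp
qed

text \<open>Precomposition with the twist, restricted to the tensor power because elements of
  \<open>polyHom\<close> are extensional. By \<open>eqv_twist\<close> the choice of representative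
  is immaterial.\<close>

definition transport :: "nat \<Rightarrow> ('k, 'h, 'm) pmap \<Rightarrow> ('k, 'h, 'm) pmap" where
  "transport n \<phi> = (\<lambda>t\<in>Mpow H M n. \<phi> (cls (Mrel H M n) (twist n (rep t))))"

lemma transport_cls:
  assumes "\<And>xs. xs \<in> Poly_Mapping.keys f \<Longrightarrow> length xs = n"
  shows "transport n \<phi> (cls (Mrel H M n) f) = \<phi> (cls (Mrel H M n) (twist n f))"
proof -
  have "cls (Mrel H M n) f \<in> Mpow H M n" using assms by (rule tensor_powerI)
  moreover have "cls (Mrel H M n) (twist n (rep (cls (Mrel H M n) f))) = cls (Mrel H M n) (twist n f)"
    by (intro cls_eqI eqv_twist rep_cls)
  ultimately show ?thesis by (simp add: transport_def)
qed

lemma transport_apply: "t \<in> Mpow H M n \<Longrightarrow> transport n \<phi> t = \<phi> (cls (Mrel H M n) (twist n (rep t)))"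
  by (simp add: transport_def)

text \<open>\<open>parity\<close> is additive, commutes with the action of \<open>H\<close> and
  preserves degrees, so precomposition inherits all the conditions with the same degree
  \<open>p\<close>.\<close>

lemma transport_polyHom:
  assumes \<phi>: "\<phi> \<in> polyHom H M p n"
  shows "transport n \<phi> \<in> polyHom H M p n"
  unfolding polyHom_def
proof (intro CollectI conjI ballI allI)
  show "transport n \<phi> \<in> Mpow H M n \<rightarrow>\<^sub>E Ptens H M n"
    unfolding transport_def
    by (intro restrict_PiE_iff[THEN iffD2] ballI polyHom_Ptens[OF \<phi>] tensor_powerI keys_twist[OF tensor_power_keys])
next
  fix s t assume st: "s \<in> Mpow H M n" "t \<in> Mpow H M n"
  note s = tensor_power_keys[OF st(1)] and t = tensor_power_keys[OF st(2)]
  have "length xs = n" if "xs \<in> Poly_Mapping.keys (rep s + rep t)" for xs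
    using that s t Poly_Mapping.keys_add[of "rep s" "rep t"] by blast
  then have "transport n \<phi> (cls (Mrel H M n) (rep s + rep t))
      = \<phi> (cls (Mrel H M n) (twist n (rep s) + twist n (rep t)))"
    by (simp add: transport_cls twist_def lin_add)
  also have "\<dots> = cls (Prel H M n) (rep (transport n \<phi> s) + rep (transport n \<phi> t))"
    unfolding st[THEN transport_apply] by (intro polyHom_add[OF \<phi>]) (erule keys_twist[rotated], erule s t)+
  finally show "transport n \<phi> (cls (Mrel H M n) (rep s + rep t))
    = cls (Prel H M n) (rep (transport n \<phi> s) + rep (transport n \<phi> t))" .
next
  fix a t assume at: "a \<in> tensor_power (hscale H) n" "t \<in> Mpow H M n"
  note a = tensor_power_keys[OF at(1)] and t = tensor_power_keys[OF at(2)]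
  have *: "length xs = n" if "xs \<in> Poly_Mapping.keys (bilin (\<lambda>hs xs. gen (map2 (act M) hs xs)) (rep a) (rep t))" for xs
    using that unfolding bilin_def by (auto elim!: keys_linE simp: a t)
  have twist_keys: "length xs = n" if "xs \<in> Poly_Mapping.keys (twist n (rep t))" for xs
    using t that by (rule keys_twist)
  have "transport n \<phi> (cls (Mrel H M n) (bilin (\<lambda>hs xs. gen (map2 (act M) hs xs)) (rep a) (rep t)))
      = \<phi> (cls (Mrel H M n) (bilin (\<lambda>hs xs. gen (map2 (act M) hs xs)) (rep a) (twist n (rep t))))"
    using a t * by (simp add: transport_cls twist_bilin)
  also have "\<dots> = cls (Prel H M n) (bilin (\<lambda>hs (gs, m). gen (map2 (*) hs gs, m)) (rep a)
      (rep (\<phi> (cls (Mrel H M n) (twist n (rep t))))))"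
    using a twist_keys by (rule polyHom_act[OF \<phi>])
  finally show "transport n \<phi> (cls (Mrel H M n) (bilin (\<lambda>hs xs. gen (map2 (act M) hs xs)) (rep a) (rep t)))
    = cls (Prel H M n) (bilin (\<lambda>hs (gs, m). gen (map2 (*) hs gs, m)) (rep a) (rep (transport n \<phi> t)))"
    unfolding transport_apply[OF at(2)] .
next
  fix d t assume "t \<in> Mpow_grade H M n d"
  then obtain f where f: "t = cls (Mrel H M n) f"
    "\<And>xs. xs \<in> Poly_Mapping.keys f \<Longrightarrow> length xs = n \<and> (\<exists>ds. homogeneous M xs ds \<and> sum_list ds = d)"
    unfolding Mpow_grade_def by blast
  have "length xs = n \<and> (\<exists>ds. homogeneous M xs ds \<and> sum_list ds = d)"
    if "xs \<in> Poly_Mapping.keys (twist n f)" for xs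
  proof -
    from that obtain ys where ys: "ys \<in> Poly_Mapping.keys f" "xs = map2 (slot_twist n) [0..<n] ys"
      unfolding twist_def by (auto elim!: keys_linE)
    with f(2) obtain ds where "length ys = n" "homogeneous M ys ds" "sum_list ds = d" by blast
    then show ?thesis
      using ys(2) by (auto simp: homogeneous_def list_all2_conv_all_nth slot_twist_def parity_grade
          intro!: exI[of _ ds])
  qed
  then have "cls (Mrel H M n) (twist n f) \<in> Mpow_grade H M n d" unfolding Mpow_grade_def by blast
  then show "transport n \<phi> t \<in> Ptens_grade H M n (d + p)"
    using f by (simp add: transport_cls polyHom_gradeD[OF \<phi>])
qed

lemma transport_transport:
  assumes \<phi>: "\<phi> \<in> polyHom H M p n"
  shows "transport n (transport n \<phi>) = \<phi>"
proof (rule PiE_ext)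
  show "transport n (transport n \<phi>) \<in> Mpow H M n \<rightarrow>\<^sub>E Ptens H M n"
    using transport_polyHom[OF transport_polyHom[OF \<phi>]] by (simp add: polyHom_def)
  show "\<phi> \<in> Mpow H M n \<rightarrow>\<^sub>E Ptens H M n" using \<phi> by (simp add: polyHom_def)
  fix t assume t: "t \<in> Mpow H M n"
  note keys = tensor_power_keys[OF t]
  have "length xs = n" if "xs \<in> Poly_Mapping.keys (twist n (rep t))" for xs
    using keys that by (rule keys_twist)
  then show "transport n (transport n \<phi>) t = \<phi> t"
    using keys by (simp add: transport_apply[OF t] transport_cls twist_twist tensor_power_cls_rep[OF t])
qed

lemma transport_pure:
  assumes \<phi>: "\<phi> \<in> polyHom H M p n" and xs: "length xs = n" "homogeneous M xs ds"
  shows "transport n \<phi> (pure H M xs) = cls (Prel H M n) (fscale (shift_sign ds) (rep (\<phi> (pure H M xs))))"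
proof -
  have "transport n \<phi> (pure H M xs) = \<phi> (cls (Mrel H M n) (twist n (gen xs)))"
    using xs transport_cls[of "gen xs" n \<phi>] by (simp add: pure_def del: twist_gen)
  also have "cls (Mrel H M n) (twist n (gen xs)) = cls (Mrel H M n) (fscale (shift_sign ds) (gen xs))"
    using xs by (intro cls_eqI twist_homogeneous)
  also have "\<phi> \<dots> = cls (Prel H M n) (fscale (shift_sign ds) (rep (\<phi> (pure H M xs))))"
    using xs by (subst polyHom_fscale[OF \<phi>]) (auto simp: pure_def)
  finally show ?thesis .
qed

lemma eqv_transport_pure:
  assumes "\<phi> \<in> polyHom H M p n" "length xs = n" "homogeneous M xs ds"
  shows "eqv (Prel H M n) (rep (transport n \<phi> (pure H M xs))) (fscale (shift_sign ds) (rep (\<phi> (pure H M xs))))"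
  unfolding transport_pure[OF assms] by (rule rep_cls)

text \<open>The inner map contributes the sign of its arguments. The outer map sees the inner value
  as its first argument, of degree \<open>sum_list as + q\<close>, followed by arguments of degrees
  \<open>bs\<close>.\<close>

lemma compose_transport:
  assumes \<phi>: "\<phi> \<in> polyHom H M p (Suc m)" and \<psi>: "\<psi> \<in> polyHom H M q (Suc l)"
    and ys: "length ys = Suc l" "homogeneous M ys as" and zs: "length zs = m" "homogeneous M zs bs"
  shows "eqv (Prel H M (Suc l + m)) (compose_rep (transport (Suc m) \<phi>) (transport (Suc l) \<psi>) ys zs)
    (fscale (shift_sign as * shift_sign ((sum_list as + q) # bs)) (compose_rep \<phi> \<psi> ys zs))"
proof -
  let ?R = "Prel H M (Suc l + m)"
  let ?C = "\<lambda>\<phi> (hs, e). lin (graft (Suc l) hs) (rep (\<phi> (pure H M (e # zs))))"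
  let ?s = "shift_sign as :: 'k" and ?t = "shift_sign ((sum_list as + q) # bs) :: 'k"
  \<comment> \<open>The outer sign depends on the degree of \<open>e\<close>, so the representative
    of the inner value has to be replaced by a homogeneous one.\<close>
  obtain f where f: "eqv (Prel H M (Suc l)) (rep (\<psi> (pure H M ys))) f"
    "\<And>hs m. (hs, m) \<in> Poly_Mapping.keys f \<Longrightarrow> length hs = Suc l \<and> m \<in> grade M (sum_list as + q)"
    using polyHom_homogeneous[OF \<psi> ys] by metis
  have bal: "balanced (Suc l) ?R (?C \<phi>)" "balanced (Suc l) ?R (?C (transport (Suc m) \<phi>))"
    using compose_balanced[OF \<phi> zs(1)] compose_balanced[OF transport_polyHom[OF \<phi>] zs(1)] by blast+
  have "eqv (Prel H M (Suc l)) (rep (transport (Suc l) \<psi> (pure H M ys))) (fscale ?s (rep (\<psi> (pure H M ys))))"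
    using \<psi> ys by (rule eqv_transport_pure)
  also have "eqv (Prel H M (Suc l)) \<dots> (fscale ?s f)"
    using f(1) by (rule eqv_fscale)
  finally have "eqv ?R (lin (?C (transport (Suc m) \<phi>)) (rep (transport (Suc l) \<psi> (pure H M ys))))
      (lin (?C (transport (Suc m) \<phi>)) (fscale ?s f))"
    by (rule balanced_eqv[OF bal(2)])
  also have "\<dots> = fscale ?s (lin (?C (transport (Suc m) \<phi>)) f)" by (rule lin_fscale)
  also have "eqv ?R \<dots> (fscale ?s (lin (\<lambda>y. fscale ?t (?C \<phi> y)) f))"
  proof (intro eqv_fscale eqv_lin)
    fix y assume "y \<in> Poly_Mapping.keys f"
    then obtain hs e where y: "y = (hs, e)" "length hs = Suc l" "e \<in> grade M (sum_list as + q)"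
      using f(2) by (cases y) auto
    have "eqv (Prel H M (Suc m)) (rep (transport (Suc m) \<phi> (pure H M (e # zs))))
        (fscale ?t (rep (\<phi> (pure H M (e # zs)))))"
      using y zs by (intro eqv_transport_pure[OF \<phi>]) (auto simp: homogeneous_def)
    then show "eqv ?R (?C (transport (Suc m) \<phi>) y) (fscale ?t (?C \<phi> y))"
      unfolding y(1) prod.case lin_fscale[symmetric] by (rule balanced_eqv[OF graft_balanced[OF y(2)]])
  qed
  also have "\<dots> = fscale (?s * ?t) (lin (?C \<phi>) f)" by (simp add: lin_fun_fscale)
  also have "eqv ?R \<dots> (fscale (?s * ?t) (lin (?C \<phi>) (rep (\<psi> (pure H M ys)))))"
    using f(1) by (intro eqv_fscale balanced_eqv[OF bal(1)]) (rule eqv_sym)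
  finally show ?thesis by (simp add: compose_rep_def ys)
qed

end

section \<open>The shifted module\<close>

lemma act_shift [simp]: "act (shift j M) = act M"
  by (simp add: shift_def)

lemma grade_shift [simp]: "grade (shift j M) n = grade M (n + j)"
  by (simp add: shift_def)

lemma mscale_shift [simp]: "mscale H (shift j M) = mscale H M"
  by (simp add: mscale_def fun_eq_iff)

lemma Prel_shift [simp]: "Prel H (shift j M) = Prel H M"
  by (simp add: Prel_def fun_eq_iff)

lemma pure_shift [simp]: "pure H (shift j M) = pure H M"
  by (simp add: pure_def fun_eq_iff)

lemma pcompose_shift [simp]: "pcompose H (shift j M) = pcompose H M"
  by (simp add: pcompose_def fun_eq_iff)

lemma reslot_shift [simp]: "reslot H (shift j M) = reslot H M"
  by (simp add: reslot_def fun_eq_iff)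

lemma homogeneous_shift: "homogeneous (shift (-1) M) xs (map ((+) 1) ds) \<longleftrightarrow> homogeneous M xs ds"
  by (simp add: homogeneous_def list_all2_map2)

lemma homogeneous_shiftE:
  assumes "homogeneous (shift (-1) M) xs es"
  obtains ds where "es = map ((+) 1) ds" "homogeneous M xs ds"
proof
  show "es = map ((+) 1) (map (\<lambda>d. d - 1) es)" by (simp add: comp_def)
  with assms show "homogeneous M xs (map (\<lambda>d. d - 1) es)" by (metis homogeneous_shift)
qed

lemma sum_list_map_Suc: "sum_list (map ((+) 1) ds) = sum_list ds + int (length ds)"
  by (induction ds) auto

lemma Mpow_grade_shift: "Mpow_grade H (shift (-1) M) n d = Mpow_grade H M n (d - int n)"
proof -
  have "(length xs = n \<and> (\<exists>es. homogeneous (shift (-1) M) xs es \<and> sum_list es = d))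
      \<longleftrightarrow> (length xs = n \<and> (\<exists>ds. homogeneous M xs ds \<and> sum_list ds = d - int n))" for xs
  proof (intro conj_cong refl iffI; elim exE conjE)
    fix es assume *: "length xs = n" "homogeneous (shift (-1) M) xs es" "sum_list es = d"
    from *(2) obtain ds where ds: "es = map ((+) 1) ds" "homogeneous M xs ds" by (rule homogeneous_shiftE)
    then have "length ds = n" using *(1) by (auto simp: homogeneous_def dest: list_all2_lengthD)
    then show "\<exists>ds. homogeneous M xs ds \<and> sum_list ds = d - int n"
      using * ds by (auto simp: sum_list_map_Suc)
  next
    fix ds assume *: "length xs = n" "homogeneous M xs ds" "sum_list ds = d - int n"
    then have "length ds = n" by (auto simp: homogeneous_def dest: list_all2_lengthD)
    then show "\<exists>es. homogeneous (shift (-1) M) xs es \<and> sum_list es = d"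
      using * by (intro exI[of _ "map ((+) 1) ds"]) (simp add: sum_list_map_Suc homogeneous_shift)
  qed
  then show ?thesis by (simp add: Mpow_grade_def)
qed

lemma Ptens_grade_shift: "Ptens_grade H (shift (-1) M) n d = Ptens_grade H M n (d - 1)"
  by (simp add: Ptens_grade_def)

text \<open>Source degree \<open>d\<close> in the shifted module is \<open>d - k\<close> in
  \<open>M\<close>, and target degree \<open>d - 1\<close> is \<open>d - 2\<close>; the difference
  is \<open>k - 2\<close>. As carrier and relations coincide, the two sets of maps are equal, not
  merely isomorphic.\<close>

lemma polyHom_shift: "polyHom H (shift (-1) M) (-1) k = polyHom H M (int k - 2) k"
proof -
  have "(\<forall>d. \<forall>t\<in>Mpow_grade H (shift (-1) M) k d. \<phi> t \<in> Ptens_grade H (shift (-1) M) k (d + -1))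
    \<longleftrightarrow> (\<forall>d. \<forall>t\<in>Mpow_grade H M k d. \<phi> t \<in> Ptens_grade H M k (d + (int k - 2)))" for \<phi>
  proof -
    have "(\<forall>d. P d) \<longleftrightarrow> (\<forall>d. P (d + int k))" for P
      by (metis diff_add_cancel)
    from this[of "\<lambda>d. \<forall>t\<in>Mpow_grade H M k (d - int k). \<phi> t \<in> Ptens_grade H M k (d + -1 - 1)"]
    show ?thesis by (simp add: Mpow_grade_shift Ptens_grade_shift algebra_simps)
  qed
  then show ?thesis by (simp add: polyHom_def Ptens_def)
qed

lemma is_decomp_shift: "is_decomp (shift j M) x c \<longleftrightarrow> is_decomp M x (Poly_Mapping.map_key (\<lambda>n. n - j) c)"
proof -
  let ?d = "Poly_Mapping.map_key (\<lambda>n. n - j) c"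
  have inj: "inj (\<lambda>n. n - j)" by (simp add: inj_def)
  have lookup: "Poly_Mapping.lookup ?d n = Poly_Mapping.lookup c (n - j)" for n
    using inj by (simp add: Poly_Mapping.map_key.rep_eq)
  have "(\<forall>n. Poly_Mapping.lookup c n \<in> grade M (n + j)) \<longleftrightarrow> (\<forall>n. Poly_Mapping.lookup ?d n \<in> grade M n)"
    unfolding lookup by (metis add_diff_cancel diff_add_cancel)
  moreover have "(\<Sum>n\<in>Poly_Mapping.keys ?d. Poly_Mapping.lookup ?d n)
      = (\<Sum>n\<in>Poly_Mapping.keys c. Poly_Mapping.lookup c n)"
    by (rule sum.reindex_bij_witness[of _ "\<lambda>n. n + j" "\<lambda>n. n - j"]) (auto simp: in_keys_iff lookup)
  ultimately show ?thesis by (simp add: is_decomp_def)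
qed

lemma graded_left_module_shift:
  assumes "graded_left_module M"
  shows "graded_left_module (shift j M)"
proof -
  have "\<exists>!c. is_decomp (shift j M) x c" for x
  proof -
    have ex1: "\<exists>!c. is_decomp M x c" using assms by (simp add: graded_left_module_def)
    have inj: "inj (\<lambda>n::int. n - i)" for i by (simp add: inj_def)
    \<comment> \<open>The second reindexing is written with \<open>n - (- i)\<close> so that this
      one identity, taken at \<open>j\<close> and at \<open>- j\<close>, serves both existence and
      uniqueness.\<close>
    have inv: "Poly_Mapping.map_key (\<lambda>n. n - i) (Poly_Mapping.map_key (\<lambda>n. n - (- i)) c) = c"
      for i :: int and c :: "int \<Rightarrow>\<^sub>0 'b"
      using inj[of i] inj[of "- i"] by (intro poly_mapping_eqI) (simp add: Poly_Mapping.map_key.rep_eq)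
    from ex1 obtain c where c: "is_decomp M x c" by blast
    show ?thesis
    proof (rule ex1I)
      show "is_decomp (shift j M) x (Poly_Mapping.map_key (\<lambda>n. n - (- j)) c)"
        unfolding is_decomp_shift inv using c .
      fix d assume "is_decomp (shift j M) x d"
      then have "Poly_Mapping.map_key (\<lambda>n. n - j) d = c"
        unfolding is_decomp_shift using c ex1 by blast
      then show "d = Poly_Mapping.map_key (\<lambda>n. n - (- j)) c"
        using inv[of "- j" d] by simp
    qed
  qed
  then show ?thesis using assms by (simp add: graded_left_module_def)
qed

section \<open>The correspondence\<close>

context pseudo_module
begin

lemma homogeneous_permute:
  assumes "\<sigma> permutes {..<length xs}" "homogeneous M xs ds"
  shows "homogeneous M (permute_list \<sigma> xs) (permute_list \<sigma> ds)"
  using assms permutes_in_image[OF assms(1)]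
  by (auto simp: homogeneous_def list_all2_conv_all_nth permute_list_nth)

text \<open>The left side of a symmetry equation acquires \<open>shift_sign ds\<close>, the right
  side the sign of the permuted degrees. By \<open>koszul_shift\<close> the equation for
  \<open>transport k \<phi>\<close> is \<open>shift_sign ds\<close> times the one for
  \<open>\<phi>\<close>, and this sign is invertible.\<close>

lemma graded_symmetric_transport:
  assumes \<phi>: "\<phi> \<in> polyHom H M p k" and k: "1 \<le> k"
  shows "graded_symmetric H (shift (-1) M) k (transport k \<phi>) \<longleftrightarrow> graded_skew_symmetric H M k \<phi>"
proof -
  let ?R = "Prel H M k"
  have main: "transport k \<phi> (pure H M xs) = cls ?R (fscale (koszul (map ((+) 1) ds) \<sigma>)
        (rep (reslot H M k \<sigma> (transport k \<phi> (pure H M (permute_list \<sigma> xs))))))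
    \<longleftrightarrow> \<phi> (pure H M xs) = cls ?R (fscale (of_int (sign \<sigma>) * koszul ds \<sigma>)
        (rep (reslot H M k \<sigma> (\<phi> (pure H M (permute_list \<sigma> xs))))))"
    if \<sigma>: "\<sigma> permutes {..<k}" and xs: "length xs = k" "homogeneous M xs ds" for \<sigma> xs ds
  proof -
    let ?s = "shift_sign ds :: 'k" and ?s' = "shift_sign (permute_list \<sigma> ds) :: 'k"
    let ?c = "of_int (sign \<sigma>) * koszul ds \<sigma> :: 'k" and ?c' = "koszul (map ((+) 1) ds) \<sigma> :: 'k"
    let ?A = "rep (\<phi> (pure H M xs))" and ?A' = "rep (transport k \<phi> (pure H M xs))"
    let ?T = "\<phi> (pure H M (permute_list \<sigma> xs))" and ?T' = "transport k \<phi> (pure H M (permute_list \<sigma> xs))"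
    let ?B = "rep (reslot H M k \<sigma> ?T)" and ?B' = "rep (reslot H M k \<sigma> ?T')"
    have len: "length ds = k" using xs by (simp add: homogeneous_def list_all2_lengthD)
    have perm: "length (permute_list \<sigma> xs) = k" "homogeneous M (permute_list \<sigma> xs) (permute_list \<sigma> ds)"
      using xs \<sigma> homogeneous_permute by auto
    have A': "eqv ?R ?A' (fscale ?s ?A)" using \<phi> xs by (rule eqv_transport_pure)
    have "eqv ?R ?B' (lin (perm_slots \<sigma>) (fscale ?s' (rep ?T)))"
      using \<sigma> k eqv_transport_pure[OF \<phi> perm] by (rule eqv_reslot)
    also have "\<dots> = fscale ?s' (lin (perm_slots \<sigma>) (rep ?T))" by (rule lin_fscale)
    also have "eqv ?R \<dots> (fscale ?s' ?B)"
      using \<sigma> k by (intro eqv_fscale eqv_sym[OF eqv_reslot]) auto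
    finally have "eqv ?R (fscale ?c' ?B') (fscale (?c' * ?s') ?B)"
      using eqv_fscale[of ?R ?B' "fscale ?s' ?B" ?c'] by simp
    moreover have "?c' * ?s' = ?s * ?c"
      using koszul_shift[of \<sigma> ds, where ?'k = 'k] \<sigma> len by (simp add: mult_ac)
    ultimately have B': "eqv ?R (fscale ?c' ?B') (fscale ?s (fscale ?c ?B))" by simp
    have "transport k \<phi> (pure H M xs) = cls ?R (fscale ?c' ?B') \<longleftrightarrow> eqv ?R ?A' (fscale ?c' ?B')"
      using polyHom_pure(1)[OF transport_polyHom[OF \<phi>] xs(1)] by (metis cls_eq_iff)
    also have "\<dots> \<longleftrightarrow> eqv ?R (fscale ?s ?A) (fscale ?s (fscale ?c ?B))"
      using A' B' by (blast intro: eqv_trans eqv_sym)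
    also have "\<dots> \<longleftrightarrow> eqv ?R ?A (fscale ?c ?B)"
      using shift_sign_square[of ds, where ?'k = 'k] by (intro eqv_fscale_iff) force
    also have "\<dots> \<longleftrightarrow> \<phi> (pure H M xs) = cls ?R (fscale ?c ?B)"
      using polyHom_pure(1)[OF \<phi> xs(1)] by (metis cls_eq_iff)
    finally show ?thesis .
  qed
  show ?thesis
    unfolding graded_symmetric_def graded_skew_symmetric_def pure_shift Prel_shift reslot_shift
  proof (intro iffI allI impI; elim conjE)
    fix \<sigma> xs ds
    assume *: "\<forall>\<sigma> xs ds. \<sigma> permutes {..<k} \<and> length xs = k \<and> homogeneous (shift (-1) M) xs ds \<longrightarrow>
      transport k \<phi> (pure H M xs) = cls ?R (fscale (koszul ds \<sigma>)
        (rep (reslot H M k \<sigma> (transport k \<phi> (pure H M (permute_list \<sigma> xs))))))"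
      and "\<sigma> permutes {..<k}" "length xs = k" "homogeneous M xs ds"
    then show "\<phi> (pure H M xs) = cls ?R (fscale (of_int (sign \<sigma>) * koszul ds \<sigma>)
        (rep (reslot H M k \<sigma> (\<phi> (pure H M (permute_list \<sigma> xs))))))"
      using main[of \<sigma> xs ds] homogeneous_shift[of M xs ds] by blast
  next
    fix \<sigma> xs es
    assume *: "\<forall>\<sigma> xs ds. \<sigma> permutes {..<k} \<and> length xs = k \<and> homogeneous M xs ds \<longrightarrow>
      \<phi> (pure H M xs) = cls ?R (fscale (of_int (sign \<sigma>) * koszul ds \<sigma>)
        (rep (reslot H M k \<sigma> (\<phi> (pure H M (permute_list \<sigma> xs))))))"
      and **: "\<sigma> permutes {..<k}" "length xs = k" "homogeneous (shift (-1) M) xs es"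
    from **(3) obtain ds where "es = map ((+) 1) ds" "homogeneous M xs ds" by (rule homogeneous_shiftE)
    then show "transport k \<phi> (pure H M xs) = cls ?R (fscale (koszul es \<sigma>)
        (rep (reslot H M k \<sigma> (transport k \<phi> (pure H M (permute_list \<sigma> xs))))))"
      using main[of \<sigma> xs ds] * ** by blast
  qed
qed

definition Linf_term :: "nat \<Rightarrow> nat \<Rightarrow> ('k, 'h, 'm) pmap \<Rightarrow> ('k, 'h, 'm) pmap \<Rightarrow> int list \<Rightarrow> 'm list \<Rightarrow>
    ('h list \<times> 'm \<Rightarrow>\<^sub>0 'k)" where
  "Linf_term k l \<phi> \<psi> ds xs = (\<Sum>\<sigma>\<in>shuffles l (k - 1).
     fscale (of_int (sign \<sigma>) * koszul ds \<sigma> * (-1) ^ (l * (k - 1)))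
       (rep (reslot H M (k + l - 1) \<sigma>
         (pcompose H M \<phi> \<psi> (take l (permute_list \<sigma> xs)) (drop l (permute_list \<sigma> xs))))))"

text \<open>For each shuffle the inner and outer signs combine, by
  \<open>shift_sign_compose\<close>, into the sign of the permuted degrees and the explicit power of
  -1. \<open>koszul_shift\<close> replaces the former by \<open>shift_sign ds\<close>, which does
  not depend on the shuffle and factors out.\<close>

lemma diamond_term_transport:
  assumes \<phi>: "\<phi> \<in> polyHom H M (int k - 2) k" and \<psi>: "\<psi> \<in> polyHom H M (int l - 2) l"
    and pos: "1 \<le> k" "1 \<le> l" "k + l = N + 1"
    and xs: "length xs = N" "homogeneous M xs ds"
  shows "eqv (Prel H M N) (diamond_term k l (transport k \<phi>) (transport l \<psi>) (map ((+) 1) ds) xs)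
    (fscale (shift_sign ds) (Linf_term k l \<phi> \<psi> ds xs))"
  unfolding diamond_term_def Linf_term_def free.scale_sum_right
proof (rule eqv_sum)
  let ?R = "Prel H M N"
  fix \<sigma> assume "\<sigma> \<in> shuffles l (k - 1)"
  moreover have N: "k + l - 1 = N" "l + (k - 1) = N" using pos by auto
  ultimately have \<sigma>: "\<sigma> permutes {..<N}" by (simp add: shuffles_def)
  define us es where "us = permute_list \<sigma> xs" and "es = permute_list \<sigma> ds"
  let ?ys = "take l us" and ?zs = "drop l us" and ?as = "take l es" and ?bs = "drop l es"
  let ?sg = "(-1) ^ (l * (k - 1)) :: 'k"
  let ?P = "pcompose H M \<phi> \<psi> ?ys ?zs" and ?P' = "pcompose H M (transport k \<phi>) (transport l \<psi>) ?ys ?zs"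
  let ?C = "compose_rep \<phi> \<psi> ?ys ?zs"
  have ds: "length ds = N" using xs by (simp add: homogeneous_def list_all2_lengthD)
  have hom: "homogeneous M us es"
    unfolding us_def es_def using \<sigma> xs by (intro homogeneous_permute) auto
  have len: "length us = N" "length es = N" by (simp_all add: us_def es_def xs ds)
  have N1: "1 \<le> N" using pos by simp
  have pos': "Suc (k - 1) = k" "Suc (l - 1) = l" using pos by auto
  have "eqv ?R (compose_rep (transport k \<phi>) (transport l \<psi>) ?ys ?zs)
      (fscale (shift_sign ?as * shift_sign ((sum_list ?as + (int l - 2)) # ?bs)) ?C)"
    using compose_transport[of \<phi> "int k - 2" "k - 1" \<psi> "int l - 2" "l - 1" ?ys ?as ?zs ?bs,
        unfolded pos' N(2), OF \<phi> \<psi>] hom len N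
    by (simp add: homogeneous_def list_all2_takeI list_all2_dropI)
  also have "shift_sign ?as * shift_sign ((sum_list ?as + (int l - 2)) # ?bs) = ?sg * shift_sign es"
    using shift_sign_compose[of ?as l ?bs k, where ?'k = 'k] len pos N by (simp add: algebra_simps)
  finally have comp: "eqv ?R (compose_rep (transport k \<phi>) (transport l \<psi>) ?ys ?zs)
      (fscale (?sg * shift_sign es) ?C)" .
  have "eqv ?R (rep ?P') (fscale (?sg * shift_sign es) ?C)"
    using eqv_pcompose_rep[OF transport_polyHom[OF \<phi>] transport_polyHom[OF \<psi>] pos len(1)] comp
    by (rule eqv_trans)
  then have "eqv ?R (rep (reslot H M N \<sigma> ?P')) (lin (perm_slots \<sigma>) (fscale (?sg * shift_sign es) ?C))"
    by (rule eqv_reslot[OF \<sigma> N1])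
  also have "\<dots> = fscale (?sg * shift_sign es) (lin (perm_slots \<sigma>) ?C)" by (rule lin_fscale)
  also have "eqv ?R \<dots> (fscale (?sg * shift_sign es) (rep (reslot H M N \<sigma> ?P)))"
    using eqv_pcompose_rep[OF \<phi> \<psi> pos len(1)]
    by (intro eqv_fscale eqv_sym[OF eqv_reslot[OF \<sigma> N1]])
  finally have "eqv ?R (fscale (koszul (map ((+) 1) ds) \<sigma>) (rep (reslot H M N \<sigma> ?P')))
      (fscale (koszul (map ((+) 1) ds) \<sigma>) (fscale (?sg * shift_sign es) (rep (reslot H M N \<sigma> ?P))))"
    by (rule eqv_fscale)
  moreover have "koszul (map ((+) 1) ds) \<sigma> * (?sg * shift_sign es)
      = shift_sign ds * (of_int (sign \<sigma>) * koszul ds \<sigma> * ?sg)"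
    using koszul_shift[of \<sigma> ds, where ?'k = 'k] \<sigma> ds by (simp add: es_def mult_ac)
  ultimately show "eqv ?R (fscale (koszul (map ((+) 1) ds) \<sigma>) (rep (reslot H M (k + l - 1) \<sigma>
        (pcompose H M (transport k \<phi>) (transport l \<psi>) (take l (permute_list \<sigma> xs)) (drop l (permute_list \<sigma> xs))))))
    (fscale (shift_sign ds) (fscale (of_int (sign \<sigma>) * koszul ds \<sigma> * (-1) ^ (l * (k - 1)))
       (rep (reslot H M (k + l - 1) \<sigma>
         (pcompose H M \<phi> \<psi> (take l (permute_list \<sigma> xs)) (drop l (permute_list \<sigma> xs)))))))"
    unfolding N(1) us_def es_def by (simp only: free.scale_scale)
qed

section \<open>Transport of whole families and the bijection\<close>

definition transport_family :: "(nat \<Rightarrow> ('k, 'h, 'm) pmap) \<Rightarrow> (nat \<Rightarrow> ('k, 'h, 'm) pmap)" where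
  "transport_family \<beta> = (\<lambda>k\<in>{1..}. transport k (\<beta> k))"

lemma transport_family_mem:
  assumes "\<beta> \<in> (\<Pi>\<^sub>E k\<in>{1..}. polyHom H M (p k) k)"
  shows "transport_family \<beta> \<in> (\<Pi>\<^sub>E k\<in>{1..}. polyHom H M (p k) k)"
  using assms unfolding transport_family_def by (auto intro!: transport_polyHom)

lemma transport_family_involution:
  assumes "\<beta> \<in> (\<Pi>\<^sub>E k\<in>{1..}. polyHom H M (p k) k)"
  shows "transport_family (transport_family \<beta>) = \<beta>"
proof (rule PiE_ext[OF transport_family_mem[OF transport_family_mem[OF assms]] assms])
  fix k :: nat assume k: "k \<in> {1..}"
  then have "\<beta> k \<in> polyHom H M (p k) k" using assms by (rule PiE_mem[rotated])
  then show "transport_family (transport_family \<beta>) k = \<beta> k"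
    using k by (simp add: transport_family_def transport_transport)
qed

text \<open>Stated for every family of polylinear maps of the right degrees, so that both inclusions
  needed for the bijection follow from it once transport is known to be an involution.\<close>

lemma maurer_cartan_transport_iff:
  assumes \<beta>: "\<beta> \<in> (\<Pi>\<^sub>E k\<in>{1..}. polyHom H M (int k - 2) k)" and two: "(2::'k) \<noteq> 0"
  shows "transport_family \<beta> \<in> maurer_cartan H (shift (-1) M) \<longleftrightarrow> \<beta> \<in> Linf_structures H M"
proof -
  interpret W: pseudo_module H "shift (-1) M"
    using graded_left_module_shift[OF graded_module] by unfold_locales
  let ?\<eta> = "transport_family \<beta>"
  have \<beta>k: "\<beta> k \<in> polyHom H M (int k - 2) k" if "1 \<le> k" for k
    using PiE_mem[OF \<beta>, of k] that by simp
  have \<eta>k: "?\<eta> k = transport k (\<beta> k)" if "1 \<le> k" for k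
    using that by (simp add: transport_family_def)
  have \<eta>W: "?\<eta> k \<in> polyHom H (shift (-1) M) (-1) k" if "1 \<le> k" for k
    using \<eta>k[OF that] transport_polyHom[OF \<beta>k[OF that]] by (simp add: polyHom_shift)
  have "?\<eta> \<in> symHom H (shift (-1) M) (-1) \<longleftrightarrow>
      \<beta> \<in> (\<Pi>\<^sub>E k\<in>{1..}. {\<phi> \<in> polyHom H M (int k - 2) k. graded_skew_symmetric H M k \<phi>})"
  proof -
    have "?\<eta> \<in> symHom H (shift (-1) M) (-1) \<longleftrightarrow>
        (\<forall>k\<in>{1..}. graded_symmetric H (shift (-1) M) k (?\<eta> k))"
      unfolding symHom_def using \<eta>W by (auto simp: PiE_iff transport_family_def)
    also have "\<dots> \<longleftrightarrow> (\<forall>k\<in>{1..}. graded_skew_symmetric H M k (\<beta> k))"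
      using graded_symmetric_transport[OF \<beta>k] by (intro ball_cong refl) (simp add: \<eta>k)
    also have "\<dots> \<longleftrightarrow> \<beta> \<in> (\<Pi>\<^sub>E k\<in>{1..}. {\<phi> \<in> polyHom H M (int k - 2) k. graded_skew_symmetric H M k \<phi>})"
      using \<beta> by (auto simp: PiE_iff)
    finally show ?thesis .
  qed
  moreover have "bracket H (shift (-1) M) (-1) (-1) ?\<eta> ?\<eta> = symHom_zero H (shift (-1) M) \<longleftrightarrow>
      (\<forall>N\<ge>1. \<forall>xs ds. length xs = N \<and> homogeneous M xs ds \<longrightarrow>
         cls (Prel H M N)
           (\<Sum>(k, l)\<in>{(k, l). 1 \<le> k \<and> 1 \<le> l \<and> k + l = N + 1}. \<Sum>\<sigma>\<in>shuffles l (k - 1).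
              fscale (of_int (sign \<sigma>) * koszul ds \<sigma> * (-1) ^ (l * (k - 1)))
                (rep (reslot H M N \<sigma>
                  (pcompose H M (\<beta> k) (\<beta> l)
                     (take l (permute_list \<sigma> xs)) (drop l (permute_list \<sigma> xs))))))
         = cls (Prel H M N) 0)"
    (is "?mc \<longleftrightarrow> (\<forall>N\<ge>1. \<forall>xs ds. _ N xs ds \<longrightarrow> cls _ (?L N xs ds) = _)")
  proof -
    let ?P = "\<lambda>N::nat. {(k, l). 1 \<le> k \<and> 1 \<le> l \<and> k + l = N + 1}"
    let ?D = "\<lambda>N xs es. \<Sum>(k, l)\<in>?P N. W.diamond_term k l (?\<eta> k) (?\<eta> l) es xs"
    \<comment> \<open>The grading enters \<open>diamond_term\<close> only through the list of
      degrees it is given, so the shifted module yields the same expression.\<close>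
    have W_term: "W.diamond_term k l \<phi> \<psi> es xs = diamond_term k l \<phi> \<psi> es xs" for k l \<phi> \<psi> es xs
      by (simp add: W.diamond_term_def diamond_term_def)
    \<comment> \<open>The sign \<open>shift_sign ds\<close> is common to all pairs
      \<open>(k, l)\<close> as well, so the complete sum for given arguments is only multiplied by
      one invertible scalar.\<close>
    have key: "eqv (Prel H M N) (?D N xs (map ((+) 1) ds)) 0 \<longleftrightarrow> eqv (Prel H M N) (?L N xs ds) 0"
      if xs: "length xs = N" "homogeneous M xs ds" for N xs ds
    proof -
      have "eqv (Prel H M N) (?D N xs (map ((+) 1) ds))
          (\<Sum>x\<in>?P N. fscale (shift_sign ds) (case x of (k, l) \<Rightarrow> Linf_term k l (\<beta> k) (\<beta> l) ds xs))"
      proof (rule eqv_sum)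
        fix x assume "x \<in> ?P N"
        then obtain k l where x: "x = (k, l)" "1 \<le> k" "1 \<le> l" "k + l = N + 1" by auto
        then show "eqv (Prel H M N) (case x of (k, l) \<Rightarrow> W.diamond_term k l (?\<eta> k) (?\<eta> l) (map ((+) 1) ds) xs)
          (fscale (shift_sign ds) (case x of (k, l) \<Rightarrow> Linf_term k l (\<beta> k) (\<beta> l) ds xs))"
          using diamond_term_transport[OF \<beta>k \<beta>k x(2-4) xs] by (simp add: W_term \<eta>k)
      qed
      also have "\<dots> = fscale (shift_sign ds) (\<Sum>(k, l)\<in>?P N. Linf_term k l (\<beta> k) (\<beta> l) ds xs)"
        by (simp add: free.scale_sum_right)
      also have "(\<Sum>(k, l)\<in>?P N. Linf_term k l (\<beta> k) (\<beta> l) ds xs) = ?L N xs ds"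
        by (intro sum.cong) (auto simp: Linf_term_def)
      finally have "eqv (Prel H M N) (?D N xs (map ((+) 1) ds)) 0 \<longleftrightarrow>
          eqv (Prel H M N) (fscale (shift_sign ds) (?L N xs ds)) (fscale (shift_sign ds) 0)"
        unfolding free.scale_zero_right by (rule eqv_cong_left)
      also have "\<dots> \<longleftrightarrow> eqv (Prel H M N) (?L N xs ds) 0"
        using shift_sign_square[of ds, where ?'k = 'k] by (intro eqv_fscale_iff) force
      finally show ?thesis .
    qed
    have "?mc \<longleftrightarrow> (\<forall>N\<ge>1. \<forall>xs es. length xs = N \<and> homogeneous (shift (-1) M) xs es \<longrightarrow>
        eqv (Prel H M N) (?D N xs es) 0)"
      using W.bracket_eq_zero_iff[of ?\<eta>, OF \<eta>W two] by simp
    also have "\<dots> \<longleftrightarrow> (\<forall>N\<ge>1. \<forall>xs ds. length xs = N \<and> homogeneous M xs ds \<longrightarrow>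
        eqv (Prel H M N) (?D N xs (map ((+) 1) ds)) 0)"
    proof (intro all_cong iffI allI impI; elim conjE)
      fix N xs ds
      assume "\<forall>xs es. length xs = N \<and> homogeneous (shift (-1) M) xs es \<longrightarrow> eqv (Prel H M N) (?D N xs es) 0"
        and "length xs = N" "homogeneous M xs ds"
      then show "eqv (Prel H M N) (?D N xs (map ((+) 1) ds)) 0"
        using homogeneous_shift[of M xs ds] by blast
    next
      fix N xs es
      assume *: "\<forall>xs ds. length xs = N \<and> homogeneous M xs ds \<longrightarrow> eqv (Prel H M N) (?D N xs (map ((+) 1) ds)) 0"
        and "length xs = N" "homogeneous (shift (-1) M) xs es"
      from this(3) obtain ds where "es = map ((+) 1) ds" "homogeneous M xs ds" by (rule homogeneous_shiftE)
      then show "eqv (Prel H M N) (?D N xs es) 0"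
        using * \<open>length xs = N\<close> by blast
    qed
    also have "\<dots> \<longleftrightarrow> (\<forall>N\<ge>1. \<forall>xs ds. length xs = N \<and> homogeneous M xs ds \<longrightarrow>
        cls (Prel H M N) (?L N xs ds) = cls (Prel H M N) 0)"
      unfolding cls_eq_iff using key by blast
    finally show ?thesis .
  qed
  ultimately show ?thesis
    unfolding maurer_cartan_def Linf_structures_def mem_Collect_eq by (rule conj_cong)
qed

end

text \<open>The second conjunct fixes the values of the bijection on homogeneous tensors by an
  explicit sign, so the correspondence is more than an equality of cardinalities.\<close>

theorem theorem3p8:
  fixes H :: "('k::field, 'h::ring_1) hopf"
    and L :: "('h, 'm::ab_group_add) gmod"
  assumes "cocommutative_hopf_algebra H"
    and "graded_left_module L"
    and "(2::'k) \<noteq> 0"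
  shows "\<exists>\<Phi>. bij_betw \<Phi> (Linf_structures H L) (maurer_cartan H (shift (-1) L)) \<and>
    (\<forall>\<beta>\<in>Linf_structures H L. \<forall>k\<ge>1. \<forall>xs ds. length xs = k \<and> homogeneous L xs ds \<longrightarrow>
       \<Phi> \<beta> k (pure H (shift (-1) L) xs) =
       cls (Prel H L k)
         (fscale ((-1) powi (\<Sum>i<k. int (k - 1 - i) * ds ! i)) (rep (\<beta> k (pure H L xs)))))"
proof -
  interpret pseudo_module H L using assms by unfold_locales
  let ?X = "\<Pi>\<^sub>E k\<in>{1..}. polyHom H L (int k - 2) k"
  have Linf: "Linf_structures H L \<subseteq> ?X"
    unfolding Linf_structures_def
    by (intro subsetI, elim CollectE conjE, erule rev_subsetD[OF _ PiE_mono]) simp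
  have MC: "maurer_cartan H (shift (-1) L) \<subseteq> ?X"
    unfolding maurer_cartan_def symHom_def polyHom_shift
    by (intro subsetI, elim CollectE conjE, erule rev_subsetD[OF _ PiE_mono]) simp
  show ?thesis
  proof (intro exI conjI ballI allI impI)
    show "bij_betw transport_family (Linf_structures H L) (maurer_cartan H (shift (-1) L))"
    proof (rule bij_betw_byWitness[of _ transport_family])
      show "\<forall>\<beta>\<in>Linf_structures H L. transport_family (transport_family \<beta>) = \<beta>"
        using Linf transport_family_involution[of _ "\<lambda>k. int k - 2"] by blast
      show inv: "\<forall>\<eta>\<in>maurer_cartan H (shift (-1) L). transport_family (transport_family \<eta>) = \<eta>"
        using MC transport_family_involution[of _ "\<lambda>k. int k - 2"] by blast
      show "transport_family ` Linf_structures H L \<subseteq> maurer_cartan H (shift (-1) L)"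
        using maurer_cartan_transport_iff[OF _ assms(3)] Linf by blast
      show "transport_family ` maurer_cartan H (shift (-1) L) \<subseteq> Linf_structures H L"
      proof
        fix \<beta> assume "\<beta> \<in> transport_family ` maurer_cartan H (shift (-1) L)"
        then obtain \<eta> where \<eta>: "\<eta> \<in> maurer_cartan H (shift (-1) L)" "\<beta> = transport_family \<eta>" by blast
        then have "\<beta> \<in> ?X" using MC transport_family_mem[of \<eta> "\<lambda>k. int k - 2"] by blast
        \<comment> \<open>Transporting \<open>\<beta>\<close> once more returns
          \<open>\<eta>\<close>, so the equivalence applied to \<open>\<beta>\<close> shows that it
          is an L-infinity structure.\<close>
        moreover have "transport_family \<beta> \<in> maurer_cartan H (shift (-1) L)" using \<eta> inv by simp
        ultimately show "\<beta> \<in> Linf_structures H L"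
          using maurer_cartan_transport_iff[OF _ assms(3)] by blast
      qed
    qed
  next
    fix \<beta> and k :: nat and xs ds
    assume \<beta>: "\<beta> \<in> Linf_structures H L" and k: "1 \<le> k" and xs: "length xs = k \<and> homogeneous L xs ds"
    have "\<beta> k \<in> polyHom H L (int k - 2) k"
      using PiE_mem[of \<beta> "{1..}" _ k] Linf \<beta> k by blast
    then have "transport k (\<beta> k) (pure H L xs) = cls (Prel H L k) (fscale (shift_sign ds) (rep (\<beta> k (pure H L xs))))"
      using xs by (intro transport_pure) auto
    moreover have "length ds = k" using xs by (auto simp: homogeneous_def dest: list_all2_lengthD)
    ultimately show "transport_family \<beta> k (pure H (shift (-1) L) xs) = cls (Prel H L k)
       (fscale ((-1) powi (\<Sum>i<k. int (k - 1 - i) * ds ! i)) (rep (\<beta> k (pure H L xs))))"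
      using k by (simp add: transport_family_def shift_sign_def)
  qed
qed

end
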